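(* Let $\mathcal{X}$ be an irreducible sofic shift, with shift map $\sigma$, whose topological entropy is $\ln\lambda>0$. Suppose that the minimal right-resolving presentation of $\mathcal{X}$ has period $p$. Then, as $N\to\infty$ ($N\in\mathbb{N}$), $$\pi_\sigma(N) \sim \frac{p\,\lambda^{p\left(\left\lfloor\frac{N}{p}\right\rfloor+1\right)}}{N(\lambda^p-1)},\qquad \mathcal{M}_\sigma(N) \sim \frac{p\,e^{-\gamma}}{\alpha N},$$ and $$\mathscr{M}_\sigma(N) = \ln \left\lfloor\frac{N}{p}\right\rfloor + \gamma + \ln \alpha - C + o(1),$$ where $\gamma$ is the Euler--Mascheroni constant, $\alpha$ is a positive constant specified by $$\alpha = \lim_{z \rightarrow \lambda^{-1}} (1-\lambda^p z^p)\, \zeta_{\sigma}(z)$$ with $\zeta_\sigma(z)$ the Artin--Mazur zeta function of $(\mathcal{X},\sigma)$ (as a rational function), and $C$ is a positive constant specified by $$C = \sum_{\tau} \left(\ln \left(\frac{1}{1-\lambda^{-\lvert\tau\rvert}}\right) - \frac{1}{\lambda^{\lvert \tau \rvert}}\right),$$ the sum being over all closed orbits $\tau$ of $(\mathcal{X},\sigma)$.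
   Context: Labelled graphs and sofic shifts. Let $G=(V,E)$ be a finite directed graph (multiple edges and loops allowed) in which every vertex has at least one incoming and at least one outgoing edge; $i(e)$ and $t(e)$ denote the initial and terminal vertices of an edge $e$. Let $\mathcal{A}$ be a finite set and $\mathcal{L}:E\to\mathcal{A}$ a labelling; $\mathcal{G}=(G,\mathcal{L})$ is called a labelled graph. A bi-infinite path is a sequence $\{e_k\}_{k\in\mathbb{Z}}$ of edges with $t(e_k)=i(e_{k+1})$ for all $k$. The sofic shift presented by $\mathcal{G}$ is the set $\mathcal{X}\subseteq\mathcal{A}^{\mathbb{Z}}$ (product topology of the discrete topology) of all label sequences $\{\mathcal{L}(e_k)\}_{k\in\mathbb{Z}}$ of bi-infinite paths in $\mathcal{G}$, together with the left shift $\sigma:\mathcal{X}\to\mathcal{X}$, $\sigma(\{x_k\})=\{x_{k+1}\}$; $\mathcal{G}$ is called a presentation of $\mathcal{X}$. A word of $\mathcal{X}$ is a finite sequence $x_kx_{k+1}\cdots x_{k+n-1}$ occurring in some $x\in\mathcal{X}$; $\mathcal{B}(\mathcal{X})$ is the set of words. $\mathcal{X}$ is irreducible if for all $u,v\in\mathcal{B}(\mathcal{X})$ either $uv\in\mathcal{B}(\mathcal{X})$ or there is $w\in\mathcal{B}(\mathcal{X})$ with $uwv\in\mathcal{B}(\mathcal{X})$. A labelled graph is right-resolving if at each vertex the outgoing edges have pairwise distinct labels. The minimal right-resolving presentation of $\mathcal{X}$ is the right-resolving presentation with the fewest vertices among all right-resolving presentations of $\mathcal{X}$; for irreducible $\mathcal{X}$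 it is unique up to (labelled) graph isomorphism and its adjacency matrix is irreducible. The period of a labelled graph with irreducible adjacency matrix $A$ is $\gcd\{n\in\mathbb{N} : (A^n)_{ii}>0\}$ (independent of the index $i$). Closed orbits and counting functions. A closed orbit of $(\mathcal{X},\sigma)$ is a set $\tau=\{x,\sigma(x),\dots,\sigma^{n-1}(x)\}$ with $\sigma^n(x)=x$ and $\sigma^k(x)\ne x$ for $1\le k\le n-1$; $\lvert\tau\rvert=n$ is its size. With topological entropy $h=\ln\lambda$, put $$\pi_\sigma(N)=\sum_{\tau:\,\lvert\tau\rvert\le N}1,\qquad \mathcal{M}_\sigma(N)=\prod_{\tau:\,\lvert\tau\rvert\le N}\left(1-\frac1{e^{h\lvert\tau\rvert}}\right),\qquad \mathscr{M}_\sigma(N)=\sum_{\tau:\,\lvert\tau\rvert\le N}\frac1{e^{h\lvert\tau\rvert}},$$ where $\tau$ runs through closed orbits. Zeta function. $\zeta_\sigma(z)=\exp\left(\sum_{n\ge1}\frac{F_\sigma(n)}{n}z^n\right)$ (where it converges), where $F_\sigma(n)$ is the number of $x\in\mathcal{X}$ with $\sigma^n(x)=x$. It is known to be a rational function, given as follows. Let $\mathcal{G}$ be a right-resolving presentation of $\mathcal{X}$ with vertex set $V=\{1,\dots,S\}$; for $v\in V$, $a\in\mathcal{A}$, let $v(a)$ be the terminal vertex of the unique edge from $v$ labelled $a$, if it exists. For $1\le j\le S$ let $V_j$ be the set of $j$-element subsets of $V$, each written in increasing order. Let $A_j$ be the integer matrix indexed by $V_j$ whose $(\{v_1<\dots<v_j\},\{\tilde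 v_1<\dots<\tilde v_j\})$-entry is the sum, over all $a\in\mathcal{A}$ for which $v_1(a),\dots,v_j(a)$ are all defined, distinct, and form the set $\{\tilde v_1,\dots,\tilde v_j\}$, of $+1$ if $(v_1(a),\dots,v_j(a))$ is an even permutation of $(\tilde v_1,\dots,\tilde v_j)$ and $-1$ otherwise. Then $\zeta_\sigma(z)=\prod_{j=1}^{S}\left(\det(I-zA_j)\right)^{(-1)^j}$. Notation: $f(N)\sim g(N)$ means $f(N)/g(N)\to1$ as $N\to\infty$. *)

theory Defs
  imports
    "HOL-Analysis.Analysis"
    "HOL-Computational_Algebra.Computational_Algebra"
    "HOL-Computational_Algebra.Field_as_Ring"
    "HOL-Library.Landau_Symbols"
    "Graph_Theory.Digraph"
begin

section \<open>Labelled graphs and their adjacency matrices\<close>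

text \<open>A labelled graph is a finite directed multigraph \<open>G\<close> as below together with an arbitrary
  function \<open>L\<close> on its arcs.  The alphabet is not a separate parameter: the label set in use is
  the finite set \<open>L ` arcs G\<close>.\<close>

locale essential_digraph = fin_digraph G for G :: "('v, 'e) pre_digraph" +
  assumes ex_in_arc: "v \<in> verts G \<Longrightarrow> \<exists>e\<in>arcs G. head G e = v"
    and ex_out_arc: "v \<in> verts G \<Longrightarrow> \<exists>e\<in>arcs G. tail G e = v"

definition right_resolving :: "('v, 'e) pre_digraph \<Rightarrow> ('e \<Rightarrow> 'a) \<Rightarrow> bool" where
  "right_resolving G L \<longleftrightarrow>
     (\<forall>e\<in>arcs G. \<forall>f\<in>arcs G. tail G e = tail G f \<and> L e = L f \<longrightarrow> e = f)"

definition adj_matrix :: "('v, 'e) pre_digraph \<Rightarrow> 'v \<Rightarrow> 'v \<Rightarrow> nat" where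
  "adj_matrix G u v = card {e \<in> arcs G. tail G e = u \<and> head G e = v}"

primrec adj_power :: "('v, 'e) pre_digraph \<Rightarrow> nat \<Rightarrow> 'v \<Rightarrow> 'v \<Rightarrow> nat" where
  "adj_power G 0 u v = (if u = v then 1 else 0)"
| "adj_power G (Suc n) u v = (\<Sum>w\<in>verts G. adj_power G n u w * adj_matrix G w v)"

text \<open>Only meant for graphs whose adjacency matrix is irreducible, where the value does not
  depend on the chosen vertex.\<close>

definition graph_period :: "('v, 'e) pre_digraph \<Rightarrow> nat" where
  "graph_period G =
     (let i = (SOME i. i \<in> verts G) in Gcd {n. n > 0 \<and> adj_power G n i i > 0})"

section \<open>Sofic shifts\<close>

definition bi_infinite_path :: "('v, 'e) pre_digraph \<Rightarrow> (int \<Rightarrow> 'e) \<Rightarrow> bool" where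
  "bi_infinite_path G e \<longleftrightarrow> (\<forall>k. e k \<in> arcs G \<and> head G (e k) = tail G (e (k + 1)))"

definition presentation ::
    "('v, 'e) pre_digraph \<Rightarrow> ('e \<Rightarrow> 'a) \<Rightarrow> (int \<Rightarrow> 'a) set \<Rightarrow> bool" where
  "presentation G L X \<longleftrightarrow>
     essential_digraph G \<and> X = {\<lambda>k. L (e k) | e. bi_infinite_path G e}"

text \<open>Graphs on natural numbers suffice in the next two definitions, since every finite graph
  is isomorphic to such a graph.\<close>

definition sofic_shift :: "(int \<Rightarrow> 'a) set \<Rightarrow> bool" where
  "sofic_shift X \<longleftrightarrow> (\<exists>(G :: (nat, nat) pre_digraph) L. presentation G L X)"

definition minimal_rr_presentation ::
    "('v, 'e) pre_digraph \<Rightarrow> ('e \<Rightarrow> 'a) \<Rightarrow> (int \<Rightarrow> 'a) set \<Rightarrow> bool" where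
  "minimal_rr_presentation G L X \<longleftrightarrow>
     presentation G L X \<and> right_resolving G L \<and>
     (\<forall>(H :: (nat, nat) pre_digraph) K.
        presentation H K X \<and> right_resolving H K \<longrightarrow> card (verts G) \<le> card (verts H))"

definition shift_map :: "(int \<Rightarrow> 'a) \<Rightarrow> (int \<Rightarrow> 'a)" where
  "shift_map x = (\<lambda>k. x (k + 1))"

definition block :: "(int \<Rightarrow> 'a) \<Rightarrow> int \<Rightarrow> nat \<Rightarrow> 'a list" where
  "block x k n = map (\<lambda>i. x (k + int i)) [0..<n]"

definition words_of_length :: "(int \<Rightarrow> 'a) set \<Rightarrow> nat \<Rightarrow> 'a list set" where
  "words_of_length X n = {block x k n | x k. x \<in> X}"

definition shift_words :: "(int \<Rightarrow> 'a) set \<Rightarrow> 'a list set" where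
  "shift_words X = (\<Union>n. words_of_length X n)"

definition irreducible_shift :: "(int \<Rightarrow> 'a) set \<Rightarrow> bool" where
  "irreducible_shift X \<longleftrightarrow>
     (\<forall>u\<in>shift_words X. \<forall>v\<in>shift_words X.
        u @ v \<in> shift_words X \<or> (\<exists>w\<in>shift_words X. u @ w @ v \<in> shift_words X))"

text \<open>Topological entropy of a shift space as the exponential growth rate of the number of its
  words of length \<open>n\<close>; the limit exists for every nonempty shift space by subadditivity.\<close>

definition topological_entropy :: "(int \<Rightarrow> 'a) set \<Rightarrow> real" where
  "topological_entropy X = lim (\<lambda>n. ln (real (card (words_of_length X n))) / real n)"

section \<open>Closed orbits and counting functions\<close>

definition closed_orbits :: "(int \<Rightarrow> 'a) set \<Rightarrow> (int \<Rightarrow> 'a) set set" where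
  "closed_orbits X =
     {{(shift_map ^^ k) x | k. k < n} | x n.
        x \<in> X \<and> n \<ge> 1 \<and> (shift_map ^^ n) x = x \<and>
        (\<forall>k. 1 \<le> k \<and> k \<le> n - 1 \<longrightarrow> (shift_map ^^ k) x \<noteq> x)}"

definition orbit_count :: "(int \<Rightarrow> 'a) set \<Rightarrow> nat \<Rightarrow> real" where
  "orbit_count X N = (\<Sum>\<tau> | \<tau> \<in> closed_orbits X \<and> card \<tau> \<le> N. 1)"

definition mertens_product :: "(int \<Rightarrow> 'a) set \<Rightarrow> nat \<Rightarrow> real" where
  "mertens_product X N =
     (\<Prod>\<tau> | \<tau> \<in> closed_orbits X \<and> card \<tau> \<le> N.
        1 - 1 / exp (topological_entropy X * real (card \<tau>)))"

definition mertens_sum :: "(int \<Rightarrow> 'a) set \<Rightarrow> nat \<Rightarrow> real" where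
  "mertens_sum X N =
     (\<Sum>\<tau> | \<tau> \<in> closed_orbits X \<and> card \<tau> \<le> N.
        1 / exp (topological_entropy X * real (card \<tau>)))"

section \<open>The Artin--Mazur zeta function\<close>

definition fixed_point_count :: "(int \<Rightarrow> 'a) set \<Rightarrow> nat \<Rightarrow> nat" where
  "fixed_point_count X n = card {x \<in> X. (shift_map ^^ n) x = x}"

definition zeta_term :: "(int \<Rightarrow> 'a) set \<Rightarrow> complex \<Rightarrow> nat \<Rightarrow> complex" where
  "zeta_term X z n = of_nat (fixed_point_count X n) / of_nat n * z ^ n"

text \<open>\<open>is_zeta_fraction X P Q\<close>: the rational function \<open>P / Q\<close>, in lowest terms, equals
  \<open>exp (\<Sum>n\<ge>1. F(n) / n * z ^ n)\<close> near \<open>0\<close>.\<close>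

definition is_zeta_fraction :: "(int \<Rightarrow> 'a) set \<Rightarrow> complex poly \<Rightarrow> complex poly \<Rightarrow> bool" where
  "is_zeta_fraction X P Q \<longleftrightarrow>
     Q \<noteq> 0 \<and> coprime P Q \<and>
     (\<forall>\<^sub>F z in nhds 0. summable (\<lambda>n. zeta_term X z (Suc n)) \<and>
        poly P z / poly Q z = exp (\<Sum>n. zeta_term X z (Suc n)))"

text \<open>The zeta function as a rational function on the whole plane (with value \<open>0\<close> at its
  poles).  Lemma \<open>zeta_eq_fraction\<close> below shows that this is a proper definite description as
  soon as the zeta function is rational.\<close>

definition artin_mazur_zeta :: "(int \<Rightarrow> 'a) set \<Rightarrow> complex \<Rightarrow> complex" where
  "artin_mazur_zeta X =
     (THE f. \<exists>P Q. is_zeta_fraction X P Q \<and> f = (\<lambda>z. poly P z / poly Q z))"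

lemma is_zeta_fraction_unique:
  assumes 1: "is_zeta_fraction X P Q" and 2: "is_zeta_fraction X P' Q'"
  shows "poly P z / poly Q z = poly P' z / poly Q' z"
proof -
  have "\<forall>\<^sub>F z in nhds 0. poly P z / poly Q z = exp (\<Sum>n. zeta_term X z (Suc n))"
    using 1 unfolding is_zeta_fraction_def by (auto elim: eventually_mono)
  moreover have "\<forall>\<^sub>F z in nhds 0. poly P' z / poly Q' z = exp (\<Sum>n. zeta_term X z (Suc n))"
    using 2 unfolding is_zeta_fraction_def by (auto elim: eventually_mono)
  ultimately have "\<forall>\<^sub>F w in nhds 0. poly (P * Q' - P' * Q) w = 0"
  proof eventually_elim
    case (elim w)
    then have eq: "poly P w / poly Q w = poly P' w / poly Q' w" by simp
    have "poly Q w \<noteq> 0" "poly Q' w \<noteq> 0"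
      using elim exp_not_eq_zero[of "\<Sum>n. zeta_term X w (Suc n)"] by auto
    with eq show ?case by (simp add: field_simps)
  qed
  then obtain S where S: "open S" "0 \<in> S" "\<And>w. w \<in> S \<Longrightarrow> poly (P * Q' - P' * Q) w = 0"
    by (auto simp: eventually_nhds)
  have "infinite S"
    using S(1,2) finite_imp_not_open by blast
  moreover have "S \<subseteq> {w. poly (P * Q' - P' * Q) w = 0}"
    using S(3) by blast
  ultimately have "infinite {w. poly (P * Q' - P' * Q) w = 0}"
    using infinite_super by blast
  then have "P * Q' - P' * Q = 0"
    using poly_roots_finite by blast
  then have eq: "P * Q' = P' * Q" by simp
  have cop: "coprime Q P" "coprime Q' P'"
    using 1 2 by (simp_all add: is_zeta_fraction_def coprime_commute)
  have "Q dvd P * Q'" unfolding eq by simp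
  then have QQ': "Q dvd Q'" using cop(1) by (simp add: coprime_dvd_mult_right_iff)
  have "Q' dvd P' * Q" unfolding eq[symmetric] by simp
  then have Q'Q: "Q' dvd Q" using cop(2) by (simp add: coprime_dvd_mult_right_iff)
  have zero: "poly Q z = 0 \<longleftrightarrow> poly Q' z = 0"
    using QQ' Q'Q by (meson dvd_trans poly_eq_0_iff_dvd)
  have "poly P z * poly Q' z = poly P' z * poly Q z"
    using arg_cong[OF eq, of "\<lambda>p. poly p z"] by simp
  with zero show ?thesis
    by (cases "poly Q z = 0") (auto simp: field_simps)
qed

lemma zeta_eq_fraction:
  assumes "is_zeta_fraction X P Q"
  shows "artin_mazur_zeta X = (\<lambda>z. poly P z / poly Q z)"
  unfolding artin_mazur_zeta_def
  by (rule the_equality) (use assms is_zeta_fraction_unique in blast)+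

end

theory Submission
  imports
    Defs
    "HOL-Complex_Analysis.Complex_Analysis"
    "HOL-Real_Asymp.Real_Asymp"
    "HOL-Number_Theory.Cong"
    "Jordan_Normal_Form.Schur_Decomposition"
begin

text \<open>The minimal right-resolving presentation is treated as a partial deterministic automaton: a word
acts on the finite set of states by a partial map.  A word \<open>w\<close> of length \<open>n\<close> gives a point fixed by
the \<open>n\<close>-th power of the shift exactly when it permutes some nonempty set of states, so counting
periodic points means counting such \<^emph>\<open>cyclic\<close> words (\<open>fixed_point_count_cyclic_words\<close>).

Let \<open>F(n)\<close> be the number of points fixed by the \<open>n\<close>-th power of the shift.
Why \<open>F(n) = p * \<lambda> ^ n + O(\<beta> ^ n)\<close> for \<open>p dvd n\<close>, and \<open>O(\<beta> ^ n)\<close> otherwise, with \<open>\<beta> < \<lambda>\<close>.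
Minimality makes the graph strongly connected, because a removable state would be removed, and
separates states by their sets of readable words, because equivalent states would be merged.
Hence there is a synchronizing word, one that sends every state on which it can be read to the same
state.  A cyclic word either has exactly one fixed state or permutes a set of at least two
states.  Words of the second kind must avoid the synchronizing word everywhere, and measured
against the Perron eigenvector they lose a fixed proportion in every block of bounded length
(\<open>embedding_count_bound\<close>).  Up to this error \<open>F(n)\<close> is therefore the number of closed paths, the
trace of the \<open>n\<close>-th power of the adjacency matrix.  Conjugation by the Perron eigenvector turns this
matrix into a stochastic kernel.  Its powers with exponents divisible by \<open>p\<close> preserve each of the \<open>p\<close>
cyclic classes and converge there, exponentially fast, to kernels with equal rows, and these have
trace \<open>1\<close> on each class (\<open>trace_asymptotics\<close>).  This
yields \<open>cyclic_word_asymptotics\<close>.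

Why the zeta function is rational.  For a partial map of a finite set, the sum of
\<open>(-1) ^ card E\<close> times the sign of the induced permutation over all permuted sets \<open>E\<close> is \<open>0\<close> if
there is a cycle and \<open>1\<close> otherwise: adding or deleting a fixed cycle reverses the sign
(\<open>signed_invariant_sets\<close>).  So \<open>F(n)\<close> is the difference of the traces of the \<open>n\<close>-th powers of two
signed matrices indexed by the sets of odd and of nonzero even size, hence a difference of power
sums of eigenvalues, and the exponential of the corresponding series is a quotient of polynomials
(\<open>is_zeta_fraction_power_sums\<close>).

Why \<open>\<alpha>\<close> exists.  The series \<open>-ln (1 - \<lambda> ^ p * z ^ p)\<close> has coefficients \<open>p * \<lambda> ^ n / n\<close> at
the multiples \<open>n\<close> of \<open>p\<close>, so \<open>(1 - \<lambda> ^ p * z ^ p) * \<zeta>(z)\<close> is the exponential of a power series whose radius of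
convergence exceeds \<open>1 / \<lambda>\<close>.  Its value at \<open>1 / \<lambda>\<close> is the positive number \<open>\<alpha>\<close>
(\<open>zeta_residue\<close>).

The rest is elementary (locale \<open>orbit_growth\<close>).  From \<open>F(n) = (\<Sum>d | d dvd n. d * orb(d))\<close>, where
\<open>orb(d)\<close> is the number of closed orbits of size \<open>d\<close>, one gets
\<open>orb(n) = p * \<lambda> ^ n / n + c(n) - e(n)\<close> (first summand only if \<open>p dvd n\<close>) where \<open>c\<close> and \<open>e\<close>
(\<open>growth_defect\<close> and \<open>imprimitive_share\<close>) grow more slowly than \<open>\<lambda> ^ n\<close>.  Summed with weights \<open>\<lambda> ^ (-n)\<close> the first summand gives a harmonic number, the
sum of the second tends to \<open>ln \<alpha>\<close>, and that of \<open>e\<close> tends to \<open>C\<close>, as one sees by rearranging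
the double series for \<open>C\<close> according to \<open>n = d * k\<close>.  The three asymptotic formulas follow.\<close>

section \<open>Deterministic automata and the minimal presentation\<close>

primrec run :: "('v \<Rightarrow> 'a \<Rightarrow> 'v option) \<Rightarrow> 'v \<Rightarrow> 'a list \<Rightarrow> 'v option" where
  "run \<delta> v [] = Some v"
| "run \<delta> v (a # w) = Option.bind (\<delta> v a) (\<lambda>u. run \<delta> u w)"

lemma run_append: "run \<delta> v (w @ w') = Option.bind (run \<delta> v w) (\<lambda>u. run \<delta> u w')"
  by (induction w arbitrary: v) (auto split: Option.bind_splits)

text \<open>State sequences replace bi-infinite edge paths: in a right-resolving graph the current state and
the label determine the edge.\<close>

definition aut_shift :: "('v \<Rightarrow> 'a \<Rightarrow> 'v option) \<Rightarrow> (int \<Rightarrow> 'a) set" where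
  "aut_shift \<delta> = {x. \<exists>q. \<forall>t. \<delta> (q t) (x t) = Some (q (t + 1))}"

locale automaton =
  fixes V :: "'v set" and S :: "'a set" and \<delta> :: "'v \<Rightarrow> 'a \<Rightarrow> 'v option"
  assumes finite_V: "finite V" and finite_S: "finite S"
    and step: "\<delta> v a = Some u \<Longrightarrow> v \<in> V \<and> a \<in> S \<and> u \<in> V"
begin

lemma run_in_V: "run \<delta> v w = Some u \<Longrightarrow> v \<in> V \<Longrightarrow> u \<in> V"
  by (induction w arbitrary: v) (auto split: Option.bind_splits dest: step)

lemma run_letters: "run \<delta> v w = Some u \<Longrightarrow> set w \<subseteq> S"
  by (induction w arbitrary: v) (auto split: Option.bind_splits dest: step)

lemma run_in_V_nonempty: "run \<delta> v w = Some u \<Longrightarrow> w \<noteq> [] \<Longrightarrow> v \<in> V \<and> u \<in> V"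
  by (cases w) (auto split: Option.bind_splits dest: step intro: run_in_V)

end

locale essential_automaton = automaton V S \<delta>
  for V :: "'v set" and S :: "'a set" and \<delta> :: "'v \<Rightarrow> 'a \<Rightarrow> 'v option" +
  assumes out_step: "v \<in> V \<Longrightarrow> \<exists>a u. \<delta> v a = Some u"
    and in_step: "u \<in> V \<Longrightarrow> \<exists>v a. \<delta> v a = Some u"

lemma run_block:
  assumes "\<forall>t. \<delta> (q t) (x t) = Some (q (t + 1))"
  shows "run \<delta> (q k) (block x k n) = Some (q (k + int n))"
proof (induction n)
  case 0
  then show ?case by (simp add: block_def)
next
  case (Suc n)
  have "block x k (Suc n) = block x k n @ [x (k + int n)]"
    by (simp add: block_def)
  then show ?case using Suc assms by (simp add: run_append add_ac)
qed

context essential_automaton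
begin

lemma forward_path:
  assumes "v \<in> V"
  shows "\<exists>q x. q 0 = v \<and> (\<forall>i::nat. \<delta> (q i) (x i) = Some (q (Suc i)))"
proof -
  have "\<exists>q. \<forall>i. (q i \<in> V \<and> (i = 0 \<longrightarrow> q i = v)) \<and> (\<exists>a. \<delta> (q i) a = Some (q (Suc i)))"
  proof (rule dependent_nat_choice[of "\<lambda>i s. s \<in> V \<and> (i = 0 \<longrightarrow> s = v)" "\<lambda>i s s'. \<exists>a. \<delta> s a = Some s'"])
    show "\<exists>s. s \<in> V \<and> (0 = (0::nat) \<longrightarrow> s = v)" using assms by blast
  next
    fix s n assume "s \<in> V \<and> (n = (0::nat) \<longrightarrow> s = v)"
    then obtain a s' where "\<delta> s a = Some s'" "s' \<in> V" using out_step step by metis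
    then show "\<exists>s'. (s' \<in> V \<and> (Suc n = 0 \<longrightarrow> s' = v)) \<and> (\<exists>a. \<delta> s a = Some s')" by auto
  qed
  then obtain q where q: "q 0 = v" "\<And>i. \<exists>a. \<delta> (q i) a = Some (q (Suc i))" by metis
  then show ?thesis by metis
qed

lemma backward_path:
  assumes "v \<in> V"
  shows "\<exists>q x. q 0 = v \<and> (\<forall>i::nat. \<delta> (q (Suc i)) (x i) = Some (q i))"
proof -
  have "\<exists>q. \<forall>i. (q i \<in> V \<and> (i = 0 \<longrightarrow> q i = v)) \<and> (\<exists>a. \<delta> (q (Suc i)) a = Some (q i))"
  proof (rule dependent_nat_choice[of "\<lambda>i s. s \<in> V \<and> (i = 0 \<longrightarrow> s = v)" "\<lambda>i s s'. \<exists>a. \<delta> s' a = Some s"])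
    show "\<exists>s. s \<in> V \<and> (0 = (0::nat) \<longrightarrow> s = v)" using assms by blast
  next
    fix s n assume "s \<in> V \<and> (n = (0::nat) \<longrightarrow> s = v)"
    then obtain a s' where "\<delta> s' a = Some s" "s' \<in> V" using in_step step by metis
    then show "\<exists>s'. (s' \<in> V \<and> (Suc n = 0 \<longrightarrow> s' = v)) \<and> (\<exists>a. \<delta> s' a = Some s)" by auto
  qed
  then obtain q where q: "q 0 = v" "\<And>i. \<exists>a. \<delta> (q (Suc i)) a = Some (q i)" by metis
  then show ?thesis by metis
qed

lemma forward_path_run:
  assumes "v \<in> V" "run \<delta> v w = Some u"
  shows "\<exists>q x. q 0 = v \<and> (\<forall>i::nat. \<delta> (q i) (x i) = Some (q (Suc i))) \<and>
           (\<forall>i<length w. x i = w ! i)"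
  using assms
proof (induction w arbitrary: v)
  case Nil
  then show ?case using forward_path[of v] by auto
next
  case (Cons a w)
  then obtain s where s: "\<delta> v a = Some s" "run \<delta> s w = Some u"
    by (auto split: Option.bind_splits)
  with Cons.IH[of s] step obtain q x where
    q: "q 0 = s" "\<forall>i::nat. \<delta> (q i) (x i) = Some (q (Suc i))" "\<forall>i<length w. x i = w ! i"
    by blast
  let ?q = "case_nat v q" and ?x = "case_nat a x"
  have "\<forall>i. \<delta> (?q i) (?x i) = Some (?q (Suc i))"
    using q s by (auto split: nat.splits)
  moreover have "\<forall>i<length (a # w). ?x i = (a # w) ! i"
    using q by (auto split: nat.splits)
  ultimately show ?case by (intro exI[of _ ?q] exI[of _ ?x]) auto
qed

lemma bi_infinite_path_run:
  assumes "v \<in> V" "run \<delta> v w \<noteq> None"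
  shows "\<exists>q x. q 0 = v \<and> (\<forall>t. \<delta> (q t) (x t) = Some (q (t + 1))) \<and> block x 0 (length w) = w"
proof -
  obtain qf xf where f: "qf 0 = v" "\<And>i::nat. \<delta> (qf i) (xf i) = Some (qf (Suc i))"
    "\<And>i. i < length w \<Longrightarrow> xf i = w ! i"
    using assms forward_path_run[OF assms(1), of w] by (metis not_Some_eq)
  obtain qb xb where b0: "qb 0 = v \<and> (\<forall>i::nat. \<delta> (qb (Suc i)) (xb i) = Some (qb i))"
    using backward_path[OF assms(1)] by (elim exE)
  then have b: "qb 0 = v" "\<And>i. \<delta> (qb (Suc i)) (xb i) = Some (qb i)" by simp_all
  let ?q = "\<lambda>t. if t \<ge> 0 then qf (nat t) else qb (nat (-t))"
  let ?x = "\<lambda>t. if t \<ge> 0 then xf (nat t) else xb (nat (-t-1))"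
  have "\<delta> (?q t) (?x t) = Some (?q (t + 1))" for t
  proof (cases "t \<ge> 0")
    case True
    then show ?thesis using f(2)[of "nat t"] by (simp add: nat_add_distrib)
  next
    case False
    then have "nat (-t) = Suc (nat (-t-1))" by linarith
    moreover have "nat (-1-t) = nat (-t-1)" by simp
    ultimately show ?thesis using False b(2)[of "nat (-t-1)"] f(1) b(1)
      by (cases "t = -1") (auto simp: algebra_simps)
  qed
  moreover have "block ?x 0 (length w) = w"
    using f(3) by (auto simp: block_def intro: nth_equalityI)
  ultimately show ?thesis using f(1)
    by (intro exI[of _ ?q] exI[of _ ?x]) simp
qed

lemma words_of_length_aut_shift:
  "words_of_length (aut_shift \<delta>) n = {w. length w = n \<and> (\<exists>v\<in>V. run \<delta> v w \<noteq> None)}"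
proof (intro equalityI subsetI)
  fix w assume "w \<in> words_of_length (aut_shift \<delta>) n"
  then obtain x k where w: "w = block x k n" "x \<in> aut_shift \<delta>"
    by (auto simp: words_of_length_def)
  then obtain q where "\<forall>t. \<delta> (q t) (x t) = Some (q (t + 1))" by (auto simp: aut_shift_def)
  with run_block[of \<delta> q x k n] w step show "w \<in> {w. length w = n \<and> (\<exists>v\<in>V. run \<delta> v w \<noteq> None)}"
    by (auto simp: block_def intro!: bexI[of _ "q k"])
next
  fix w assume "w \<in> {w. length w = n \<and> (\<exists>v\<in>V. run \<delta> v w \<noteq> None)}"
  then obtain v where w: "length w = n" "v \<in> V" "run \<delta> v w \<noteq> None" by auto
  then obtain q x where "\<forall>t. \<delta> (q t) (x t) = Some (q (t + 1))" "block x 0 (length w) = w"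
    using bi_infinite_path_run by metis
  then have "x \<in> aut_shift \<delta>" "w = block x 0 n" using w by (auto simp: aut_shift_def)
  then show "w \<in> words_of_length (aut_shift \<delta>) n"
    unfolding words_of_length_def by auto
qed

lemma shift_words_aut_shift:
  "shift_words (aut_shift \<delta>) = {w. \<exists>v\<in>V. run \<delta> v w \<noteq> None}"
  unfolding shift_words_def words_of_length_aut_shift by auto

end

text \<open>Compactness of the product of countably many copies of a finite discrete set, in the form of
Koenig's lemma: one coordinate after the other is made constant on an infinite set of indices.\<close>

lemma finite_valued_compactness:
  fixes f :: "nat \<Rightarrow> nat \<Rightarrow> 'v"
  assumes "finite V" "\<And>n i. f n i \<in> V"
  shows "\<exists>q. \<forall>m. infinite {n. \<forall>i<m. f n i = q i}"
proof -
  have "\<exists>g. \<forall>m. infinite {n. \<forall>i<m. f n i = g m i} \<and> (\<forall>i<m. g (Suc m) i = g m i)"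
  proof (rule dependent_nat_choice[of "\<lambda>m g. infinite {n. \<forall>i<m. f n i = g i}" "\<lambda>m g g'. \<forall>i<m. g' i = g i"])
    show "\<exists>g. infinite {n. \<forall>i<0. f n i = g i}" by simp
  next
    fix g m assume inf: "infinite {n. \<forall>i<m. f n i = g i}"
    let ?I = "{n. \<forall>i<m. f n i = g i}"
    have "\<exists>v\<in>V. infinite {n\<in>?I. f n m = v}"
      using assms inf pigeonhole_infinite_rel[of ?I V "\<lambda>n v. f n m = v"] by blast
    then obtain v where v: "infinite {n\<in>?I. f n m = v}" by blast
    have "{n\<in>?I. f n m = v} = {n. \<forall>i<Suc m. f n i = (g(m := v)) i}"
      by (auto simp: less_Suc_eq)
    with v show "\<exists>g'. infinite {n. \<forall>i<Suc m. f n i = g' i} \<and> (\<forall>i<m. g' i = g i)"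
      by (intro exI[of _ "g(m := v)"]) auto
  qed
  then obtain g where g: "\<And>m. infinite {n. \<forall>i<m. f n i = g m i}"
    "\<And>m i. i < m \<Longrightarrow> g (Suc m) i = g m i" by blast
  have gi: "g m i = g (Suc i) i" if "i < m" for m i
    using that
  proof (induction m)
    case (Suc m)
    then show ?case using g(2)[of i m] by (cases "i = m") auto
  qed simp
  have eq: "{n. \<forall>i<m. f n i = g m i} = {n. \<forall>i<m. f n i = g (Suc i) i}" for m
    by (rule Collect_cong) (metis gi)
  have "infinite {n. \<forall>i<m. f n i = g (Suc i) i}" for m
    using g(1)[of m] unfolding eq .
  then have "\<forall>m. infinite {n. \<forall>i<m. f n i = g (Suc i) i}" ..
  then show ?thesis by (rule exI[where x = "\<lambda>i. g (Suc i) i"])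
qed

context automaton
begin

text \<open>A point all of whose blocks can be read lies in the shift.  The runs on longer and longer central
blocks need not be compatible, but by compactness some state sequence agrees with infinitely many
of them on every window.  Both uses of minimality below rest on this.\<close>

lemma aut_shift_closed:
  assumes rd: "\<And>k n. \<exists>v\<in>V. run \<delta> v (block x k n) \<noteq> None"
  shows "x \<in> aut_shift \<delta>"
proof -
  have "\<exists>q. (\<forall>t. q t \<in> V) \<and> (\<forall>t. - int n \<le> t \<and> t < int n \<longrightarrow> \<delta> (q t) (x t) = Some (q (t + 1)))" for n
  proof -
    obtain v where v: "v \<in> V" "run \<delta> v (block x (- int n) (2 * n)) \<noteq> None" using rd by blast
    have tk: "take i (block x (- int n) (2 * n)) = block x (- int n) i" if "i \<le> 2 * n" for i
      using that by (auto simp: block_def take_map min_def)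
    have nn: "run \<delta> v (block x (- int n) i) \<noteq> None" if "i \<le> 2 * n" for i
    proof -
      have "block x (- int n) (2 * n) = block x (- int n) i @ drop i (block x (- int n) (2 * n))"
        using tk[OF that] append_take_drop_id by metis
      then show ?thesis using v(2) run_append[of \<delta> v "block x (- int n) i"] by (metis bind.bind_lzero)
    qed
    define q where "q t = (if - int n \<le> t \<and> t \<le> int n then the (run \<delta> v (block x (- int n) (nat (t + int n)))) else v)" for t
    have "q t \<in> V" for t
      using nn[of "nat (t + int n)"] v(1) run_in_V[of v] by (auto simp: q_def)
    moreover have "\<delta> (q t) (x t) = Some (q (t + 1))" if t: "- int n \<le> t" "t < int n" for t
    proof -
      define i where "i = nat (t + int n)"
      have i: "t = int i - int n" "i < 2 * n" using t by (auto simp: i_def)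
      have "block x (- int n) (Suc i) = block x (- int n) i @ [x t]"
        by (simp add: block_def i)
      then have "run \<delta> v (block x (- int n) (Suc i)) = Option.bind (run \<delta> v (block x (- int n) i)) (\<lambda>u. \<delta> u (x t))"
        by (simp add: run_append)
      moreover have "nat (t + 1 + int n) = Suc i" using i by linarith
      ultimately show ?thesis using nn[of i] nn[of "Suc i"] i t
        by (auto simp: q_def i_def[symmetric])
    qed
    ultimately show ?thesis by (intro exI[of _ q]) auto
  qed
  then obtain q where q: "\<And>n t. q n t \<in> V"
    "\<And>n t. - int n \<le> t \<Longrightarrow> t < int n \<Longrightarrow> \<delta> (q n t) (x t) = Some (q n (t + 1))" by metis
  obtain r where r: "\<And>m. infinite {n. \<forall>i<m. q n (int_decode i) = r i}"
    using finite_valued_compactness[OF finite_V, of "\<lambda>n i. q n (int_decode i)"] q(1) by blast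
  have "\<delta> (r (int_encode t)) (x t) = Some (r (int_encode (t + 1)))" for t
  proof -
    let ?m = "Suc (max (int_encode t) (int_encode (t + 1)))"
    obtain n where n: "n > nat \<bar>t\<bar>" "\<forall>i<?m. q n (int_decode i) = r i"
      using r[of ?m] by (metis (mono_tags, lifting) infinite_nat_iff_unbounded mem_Collect_eq)
    have "q n t = r (int_encode t)" "q n (t + 1) = r (int_encode (t + 1))"
      using n(2)[rule_format, of "int_encode t"] n(2)[rule_format, of "int_encode (t + 1)"] by auto
    then show ?thesis using q(2)[of n t] n(1) by auto
  qed
  then show ?thesis unfolding aut_shift_def by (intro CollectI exI[of _ "\<lambda>t. r (int_encode t)"]) auto
qed

end

text \<open>Only automata over the same type of states compete: the two competitors used below live on
subsets of the given state set.\<close>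

definition minimal_automaton :: "'v set \<Rightarrow> ('v \<Rightarrow> 'a \<Rightarrow> 'v option) \<Rightarrow> bool" where
  "minimal_automaton V \<delta> \<longleftrightarrow>
    (\<forall>W S \<epsilon>. essential_automaton W S \<epsilon> \<and> aut_shift \<epsilon> = aut_shift \<delta> \<longrightarrow> card V \<le> card (W :: 'v set))"

context essential_automaton
begin

text \<open>Deleting a state may leave states that lie on no bi-infinite path; keeping only the states and
transitions that occur on such paths restores an essential automaton for the same shift.\<close>

lemma restriction_essential:
  fixes v :: 'v
  defines "\<epsilon> \<equiv> \<lambda>s a. if s = v \<or> \<delta> s a = Some v then None else \<delta> s a"
  obtains W \<epsilon>' where "essential_automaton W S \<epsilon>'" "W \<subseteq> V - {v}" "aut_shift \<epsilon>' = aut_shift \<epsilon>"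
proof -
  define W where "W = {s. \<exists>q x t. (\<forall>t. \<epsilon> (q t) (x t) = Some (q (t + 1 :: int))) \<and> q t = s}"
  define \<epsilon>' where "\<epsilon>' s a = (if \<exists>q x t. (\<forall>t. \<epsilon> (q t) (x t) = Some (q (t + 1 :: int))) \<and> q t = s \<and> x t = a
     then \<epsilon> s a else None)" for s a
  have le: "\<delta> s a = Some u \<and> s \<noteq> v" if "\<epsilon> s a = Some u" for s a u
    using that by (auto simp: \<epsilon>_def split: if_splits)
  have WV: "W \<subseteq> V - {v}"
  proof
    fix s assume "s \<in> W"
    then obtain q x t where "\<epsilon> (q t) (x t) = Some (q (t + 1 :: int))" "q t = s" unfolding W_def by blast
    then show "s \<in> V - {v}" using le[of "q t" "x t"] step[of "q t" "x t"] by auto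
  qed
  have e': "s \<in> W \<and> u \<in> W \<and> \<epsilon> s a = Some u" if su: "\<epsilon>' s a = Some u" for s a u
  proof -
    obtain q x t where q: "\<forall>t. \<epsilon> (q t) (x t) = Some (q (t + 1 :: int))" "q t = s" "x t = a" "\<epsilon> s a = Some u"
      using su unfolding \<epsilon>'_def by (metis option.distinct(1))
    then have "q (t + 1) = u" by force
    with q show ?thesis unfolding W_def by blast
  qed
  have path': "\<forall>t. \<epsilon>' (q t) (x t) = Some (q (t + 1 :: int))" if q: "\<forall>t. \<epsilon> (q t) (x t) = Some (q (t + 1 :: int))" for q x
  proof
    fix t
    have "\<exists>q' x' t'. (\<forall>t. \<epsilon> (q' t) (x' t) = Some (q' (t + 1 :: int))) \<and> q' t' = q t \<and> x' t' = x t"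
      using q by blast
    then show "\<epsilon>' (q t) (x t) = Some (q (t + 1))" using q by (simp add: \<epsilon>'_def)
  qed
  show thesis
  proof
    show "W \<subseteq> V - {v}" by fact
    show "aut_shift \<epsilon>' = aut_shift \<epsilon>"
      unfolding aut_shift_def using e' path' by blast
    show "essential_automaton W S \<epsilon>'"
    proof
      show "finite W" by (rule finite_subset[OF WV]) (simp add: finite_V)
      show "finite S" by (rule finite_S)
      show "s \<in> W \<and> a \<in> S \<and> u \<in> W" if "\<epsilon>' s a = Some u" for s a u
        using e'[OF that] le[of s a u] step by blast
    next
      fix s assume "s \<in> W"
      then obtain q x t where q: "\<forall>t. \<epsilon> (q t) (x t) = Some (q (t + 1 :: int))" "q t = s"
        unfolding W_def by blast
      from path'[OF q(1)] q(2) show "\<exists>a u. \<epsilon>' s a = Some u" by blast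
      have "\<epsilon>' (q (t - 1)) (x (t - 1)) = Some (q (t - 1 + 1))" using path'[OF q(1)] by blast
      then show "\<exists>u a. \<epsilon>' u a = Some s" using q(2) by auto
    qed
  qed
qed

text \<open>If every word could be read while avoiding \<open>v\<close>, then by compactness so could every point, and the
automaton without \<open>v\<close> would present the same shift.\<close>

lemma minimal_forced_visit:
  assumes min: "minimal_automaton V \<delta>" and v: "v \<in> V"
  obtains w where "\<exists>s\<in>V. run \<delta> s w \<noteq> None"
    "\<And>s. run \<delta> s w \<noteq> None \<Longrightarrow> \<exists>i\<le>length w. run \<delta> s (take i w) = Some v"
proof (rule ccontr)
  assume neg: "\<not> thesis"
  note visit = that
  define \<epsilon> where "\<epsilon> = (\<lambda>s a. if s = v \<or> \<delta> s a = Some v then None else \<delta> s a)"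
  interpret E: automaton V S \<epsilon>
    by unfold_locales (use finite_V finite_S step in \<open>auto simp: \<epsilon>_def split: if_splits\<close>)
  have avoid: "run \<epsilon> s w = run \<delta> s w" if "\<forall>i\<le>length w. run \<delta> s (take i w) \<noteq> Some v" for s w
    using that
  proof (induction w arbitrary: s)
    case (Cons a w)
    have s: "s \<noteq> v" using Cons.prems[rule_format, of 0] by simp
    have na: "\<delta> s a \<noteq> Some v" using Cons.prems[rule_format, of 1] by (auto split: Option.bind_splits)
    have "run \<epsilon> u w = run \<delta> u w" if "\<delta> s a = Some u" for u
      by (rule Cons.IH) (use Cons.prems[rule_format, of "Suc _"] that in auto)
    then show ?case using s na by (auto simp: \<epsilon>_def split: Option.bind_splits)
  qed simp
  have rd: "\<exists>s\<in>V. run \<epsilon> s w \<noteq> None" if w: "w \<noteq> []" "\<exists>s\<in>V. run \<delta> s w \<noteq> None" for w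
  proof -
    obtain s where s: "run \<delta> s w \<noteq> None" "\<forall>i\<le>length w. run \<delta> s (take i w) \<noteq> Some v"
      using neg visit[of w] w(2) by blast
    moreover have "s \<in> V" using s(1) w(1) run_in_V_nonempty by auto
    ultimately show ?thesis using avoid by metis
  qed
  have "aut_shift \<delta> \<subseteq> aut_shift \<epsilon>"
  proof
    fix x assume "x \<in> aut_shift \<delta>"
    then obtain q where q: "\<forall>t. \<delta> (q t) (x t) = Some (q (t + 1))" unfolding aut_shift_def by blast
    show "x \<in> aut_shift \<epsilon>"
    proof (rule E.aut_shift_closed)
      fix k n
      show "\<exists>v\<in>V. run \<epsilon> v (block x k n) \<noteq> None"
      proof (cases "n = 0")
        case True
        then show ?thesis using v by (auto simp: block_def)
      next
        case False
        then have "block x k n \<noteq> []" by (simp add: block_def)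
        moreover have "run \<delta> (q k) (block x k n) \<noteq> None" "q k \<in> V" 
          using run_block[of \<delta> q x k n] q step by auto
        ultimately show ?thesis using rd by blast
      qed
    qed
  qed
  moreover have "aut_shift \<epsilon> \<subseteq> aut_shift \<delta>"
  proof
    fix x assume "x \<in> aut_shift \<epsilon>"
    then obtain q where "\<forall>t. \<epsilon> (q t) (x t) = Some (q (t + 1))" unfolding aut_shift_def by blast
    then have "\<forall>t. \<delta> (q t) (x t) = Some (q (t + 1))"
      by (auto simp: \<epsilon>_def split: if_split_asm)
    then show "x \<in> aut_shift \<delta>" unfolding aut_shift_def by blast
  qed
  ultimately have eq: "aut_shift \<epsilon> = aut_shift \<delta>" by blast
  obtain W \<epsilon>' where W: "essential_automaton W S \<epsilon>'" "W \<subseteq> V - {v}" "aut_shift \<epsilon>' = aut_shift \<epsilon>"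
    by (rule restriction_essential[of v, folded \<epsilon>_def])
  have "card V \<le> card W"
    using min[unfolded minimal_automaton_def, rule_format, of W S \<epsilon>'] W eq by simp
  moreover have "card W < card V"
    using W(2) v by (intro psubset_card_mono[OF finite_V]) auto
  ultimately show False by simp
qed

text \<open>Join a word that forces a visit to \<open>s\<close> and a word that forces a visit to \<open>t\<close> by irreducibility of
the shift; any run of the result contains a path from \<open>s\<close> to \<open>t\<close>.\<close>

theorem minimal_strongly_connected:
  assumes min: "minimal_automaton V \<delta>" and irr: "irreducible_shift (aut_shift \<delta>)"
    and s: "s \<in> V" and t: "t \<in> V"
  shows "\<exists>w. run \<delta> s w = Some t"
proof -
  obtain ws where ws: "\<exists>z\<in>V. run \<delta> z ws \<noteq> None"
    "\<And>z. run \<delta> z ws \<noteq> None \<Longrightarrow> \<exists>i\<le>length ws. run \<delta> z (take i ws) = Some s"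
    using minimal_forced_visit[OF min s] by blast
  obtain wt where wt: "\<exists>z\<in>V. run \<delta> z wt \<noteq> None"
    "\<And>z. run \<delta> z wt \<noteq> None \<Longrightarrow> \<exists>i\<le>length wt. run \<delta> z (take i wt) = Some t"
    using minimal_forced_visit[OF min t] by blast
  have "ws \<in> shift_words (aut_shift \<delta>)" "wt \<in> shift_words (aut_shift \<delta>)"
    using ws(1) wt(1) by (auto simp: shift_words_aut_shift)
  then have "ws @ wt \<in> shift_words (aut_shift \<delta>) \<or> (\<exists>w\<in>shift_words (aut_shift \<delta>). ws @ w @ wt \<in> shift_words (aut_shift \<delta>))"
    using irr unfolding irreducible_shift_def by blast
  then obtain w where "ws @ w @ wt \<in> shift_words (aut_shift \<delta>)" by (metis append_Nil)
  then obtain z where "run \<delta> z (ws @ w @ wt) \<noteq> None" by (auto simp: shift_words_aut_shift)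
  then obtain z1 z2 where z: "run \<delta> z ws = Some z1" "run \<delta> z1 w = Some z2" "run \<delta> z2 wt \<noteq> None"
    by (auto simp: run_append split: Option.bind_splits)
  obtain i where i: "run \<delta> z (take i ws) = Some s" using ws(2) z(1) by auto
  obtain j where j: "run \<delta> z2 (take j wt) = Some t" using wt(2) z(3) by auto
  have "run \<delta> z (take i ws @ drop i ws) = Some z1" using z(1) by simp
  then have "run \<delta> s (drop i ws) = Some z1" using i by (subst (asm) run_append) simp
  then have "run \<delta> s (drop i ws @ w @ take j wt) = Some t"
    using z(2) j by (simp add: run_append)
  then show ?thesis by blast
qed

text \<open>States with the same readable words can be merged: the automaton on chosen representatives reads
the same words, hence presents the same shift.\<close>

theorem minimal_follower_separated:
  assumes min: "minimal_automaton V \<delta>" and u: "u \<in> V" and v: "v \<in> V"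
    and same: "\<And>w. run \<delta> u w = None \<longleftrightarrow> run \<delta> v w = None"
  shows "u = v"
proof (rule ccontr)
  assume "u \<noteq> v"
  define F where "F s = {w. run \<delta> s w \<noteq> None}" for s
  define rep where "rep s = (SOME t. t \<in> V \<and> F t = F s)" for s
  have rep: "rep s \<in> V" "F (rep s) = F s" if "s \<in> V" for s
    unfolding rep_def using someI[of "\<lambda>t. t \<in> V \<and> F t = F s" s] that by auto
  have rep_cong: "F s = F t \<Longrightarrow> rep s = rep t" for s t by (simp add: rep_def)
  define \<epsilon> where "\<epsilon> s a = (if s \<in> rep ` V then map_option rep (\<delta> s a) else None)" for s a
  have F_step: "F s = F t \<Longrightarrow> \<delta> s a = Some s' \<Longrightarrow> \<exists>t'. \<delta> t a = Some t' \<and> F s' = F t'" for s t s' a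
  proof -
    assume F: "F s = F t" and d: "\<delta> s a = Some s'"
    have "[a] \<in> F s" using d by (simp add: F_def)
    then have "[a] \<in> F t" using F by simp
    then obtain t' where t': "\<delta> t a = Some t'" by (auto simp: F_def split: Option.bind_splits)
    have "w \<in> F s' \<longleftrightarrow> a # w \<in> F s" "w \<in> F t' \<longleftrightarrow> a # w \<in> F t" for w
      using d t' by (auto simp: F_def)
    then show ?thesis using F t' by auto
  qed
  have eps: "\<epsilon> (rep s) a = map_option rep (\<delta> s a)" if "s \<in> V" for s a
  proof -
    note Fs = rep(2)[OF that]
    have "map_option rep (\<delta> (rep s) a) = map_option rep (\<delta> s a)"
    proof (cases "\<delta> s a")
      case None
      then have "\<delta> (rep s) a = None"
        using F_step[of "rep s" s a] Fs by (cases "\<delta> (rep s) a") auto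
      with None show ?thesis by simp
    next
      case (Some s')
      then obtain t' where "\<delta> (rep s) a = Some t'" "F s' = F t'"
        using F_step[of s "rep s" a s'] Fs by auto
      then show ?thesis using Some rep_cong[of s' t'] by simp
    qed
    then show ?thesis using that by (auto simp: \<epsilon>_def)
  qed
  have run_eps: "run \<epsilon> (rep s) w = map_option rep (run \<delta> s w)" if "s \<in> V" for s w
    using that
  proof (induction w arbitrary: s)
    case (Cons a w)
    then show ?case by (cases "\<delta> s a") (auto simp: eps dest: step)
  qed simp
  interpret E: essential_automaton "rep ` V" S \<epsilon>
  proof
    show "finite (rep ` V)" "finite S" using finite_V finite_S by auto
    show "s \<in> rep ` V \<and> a \<in> S \<and> t \<in> rep ` V" if "\<epsilon> s a = Some t" for s a t
      using that step by (auto simp: \<epsilon>_def split: if_splits)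
  next
    fix s assume "s \<in> rep ` V"
    then obtain s0 where s0: "s = rep s0" "s0 \<in> V" by blast
    obtain a t where "\<delta> s0 a = Some t" using out_step s0 by blast
    then show "\<exists>a t. \<epsilon> s a = Some t" using eps s0 by auto
    obtain a t where "\<delta> t a = Some s0" using in_step s0 by blast
    then have "\<epsilon> (rep t) a = Some s" using eps[of t a] s0 step by auto
    then show "\<exists>t a. \<epsilon> t a = Some s" by blast
  qed
  have "aut_shift \<epsilon> = aut_shift \<delta>"
  proof (intro equalityI subsetI)
    fix x assume "x \<in> aut_shift \<epsilon>"
    then obtain q where q: "\<forall>t. \<epsilon> (q t) (x t) = Some (q (t + 1))" unfolding aut_shift_def by blast
    show "x \<in> aut_shift \<delta>"
    proof (rule aut_shift_closed)
      fix k n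
      have "q k \<in> rep ` V" using q E.step by blast
      then obtain s where "s \<in> V" "q k = rep s" by blast
      then show "\<exists>v\<in>V. run \<delta> v (block x k n) \<noteq> None"
        using run_eps[of s "block x k n"] run_block[of \<epsilon> q x k n] q by (intro bexI[of _ s]) auto
    qed
  next
    fix x assume "x \<in> aut_shift \<delta>"
    then obtain q where q: "\<forall>t. \<delta> (q t) (x t) = Some (q (t + 1))" unfolding aut_shift_def by blast
    have "\<epsilon> (rep (q t)) (x t) = Some (rep (q (t + 1)))" for t
      using q[rule_format, of t] eps[of "q t" "x t"] step[of "q t" "x t"] by simp
    then show "x \<in> aut_shift \<epsilon>"
      unfolding aut_shift_def by (intro CollectI exI[of _ "\<lambda>t. rep (q t)"] allI)
  qed
  then have "card V \<le> card (rep ` V)"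
    using min[unfolded minimal_automaton_def, rule_format, of "rep ` V" S \<epsilon>]
      E.essential_automaton_axioms by simp
  then have "inj_on rep V" by (meson card_image_le eq_card_imp_inj_on finite_V le_antisym)
  moreover have "rep u = rep v" using same by (intro rep_cong) (auto simp: F_def)
  ultimately show False using u v \<open>u \<noteq> v\<close> by (auto dest: inj_onD)
qed

text \<open>Take a word \<open>m\<close> whose set of end states is nonempty and as small as possible.  Two distinct end
states would be separated by a word readable from only one of them, and appending that word to \<open>m\<close>
would shrink the set further.\<close>

theorem minimal_synchronizing_word:
  assumes min: "minimal_automaton V \<delta>" and ne: "V \<noteq> {}"
  obtains m s z where "s \<in> V" "run \<delta> s m = Some z" "\<And>t. t \<in> V \<Longrightarrow> run \<delta> t m \<in> {None, Some z}"
proof -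
  define img where "img w = {u. \<exists>s\<in>V. run \<delta> s w = Some u}" for w
  have "img [] \<noteq> {}" using ne by (simp add: img_def)
  from ex_has_least_nat[of "\<lambda>w. img w \<noteq> {}", OF this, of "\<lambda>w. card (img w)"]
  obtain m where "img m \<noteq> {} \<and> (\<forall>w. img w \<noteq> {} \<longrightarrow> card (img m) \<le> card (img w))"
    by (elim exE)
  then have m: "img m \<noteq> {}" "\<And>w. img w \<noteq> {} \<Longrightarrow> card (img m) \<le> card (img w)"
    by simp_all
  have sub: "img w \<subseteq> V" for w using run_in_V by (auto simp: img_def)
  have no: False if uv: "u \<in> img m" "v \<in> img m" and w: "run \<delta> u w \<noteq> None" "run \<delta> v w = None" for u v w
  proof -
    let ?D = "{s\<in>img m. run \<delta> s w \<noteq> None}"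
    have im: "img (m @ w) = (\<lambda>s. the (run \<delta> s w)) ` ?D"
    proof (intro equalityI subsetI)
      fix z assume "z \<in> img (m @ w)"
      then obtain s where s: "s \<in> V" "run \<delta> s (m @ w) = Some z" by (auto simp: img_def)
      then obtain y where y: "run \<delta> s m = Some y" "run \<delta> y w = Some z"
        by (auto simp: run_append bind_eq_Some_conv)
      have "y \<in> ?D" using s y by (auto simp: img_def)
      moreover have "z = the (run \<delta> y w)" using y by simp
      ultimately show "z \<in> (\<lambda>s. the (run \<delta> s w)) ` ?D" by (rule rev_image_eqI)
    next
      fix z assume "z \<in> (\<lambda>s. the (run \<delta> s w)) ` ?D"
      then obtain s y where "s \<in> V" "run \<delta> s m = Some y" "run \<delta> y w = Some z"
        by (auto simp: img_def)
      then have "s \<in> V" "run \<delta> s (m @ w) = Some z" by (simp_all add: run_append)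
      then show "z \<in> img (m @ w)" unfolding img_def by blast
    qed
    have fin: "finite (img m)" by (rule finite_subset[OF sub finite_V])
    have "img (m @ w) \<noteq> {}" using uv w unfolding im by auto
    then have "card (img m) \<le> card (img (m @ w))" by (rule m(2))
    also have "\<dots> \<le> card ?D" unfolding im using fin by (intro card_image_le) auto
    also have "\<dots> < card (img m)"
    proof (rule psubset_card_mono[OF fin], rule psubsetI)
      have "v \<notin> ?D" using w(2) by simp
      then show "?D \<noteq> img m" using uv(2) by blast
    qed blast
    finally show False by simp
  qed
  have single: "u = v" if "u \<in> img m" "v \<in> img m" for u v
  proof (rule minimal_follower_separated[OF min])
    show "u \<in> V" "v \<in> V" using that sub by auto
    show "run \<delta> u w = None \<longleftrightarrow> run \<delta> v w = None" for w
    proof (rule ccontr)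
      assume "\<not> (run \<delta> u w = None \<longleftrightarrow> run \<delta> v w = None)"
      then consider "run \<delta> u w \<noteq> None" "run \<delta> v w = None"
        | "run \<delta> v w \<noteq> None" "run \<delta> u w = None" by argo
      then show False by cases (rule no[OF that], assumption+, rule no[OF that(2,1)], assumption+)
    qed
  qed
  obtain z where z: "z \<in> img m" using m(1) by (metis all_not_in_conv)
  then obtain s where "s \<in> V" "run \<delta> s m = Some z" unfolding img_def by (elim CollectE bexE)
  moreover have "run \<delta> t m \<in> {None, Some z}" if "t \<in> V" for t
  proof (cases "run \<delta> t m")
    case (Some y)
    then have "y \<in> img m" using that unfolding img_def by blast
    from single[OF z this] show ?thesis using Some by simp
  qed simp
  ultimately show thesis by (rule that)
qed

end

section \<open>Perron eigenvectors and entropy\<close>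

text \<open>One coordinate after the other is made convergent by passing to a further subsequence.\<close>

lemma bounded_coordinates_subsequence:
  fixes x :: "nat \<Rightarrow> 'v \<Rightarrow> real"
  assumes "finite V" "\<And>n v. v \<in> V \<Longrightarrow> x n v \<in> {a..b}"
  shows "\<exists>r y. strict_mono (r :: nat \<Rightarrow> nat) \<and> (\<forall>v\<in>V. (\<lambda>n. x (r n) v) \<longlonglongrightarrow> y v)"
  using assms
proof (induction V)
  case empty
  then show ?case by (intro exI[of _ id]) (simp add: strict_mono_def)
next
  case (insert v V)
  then obtain r y where r: "strict_mono (r :: nat \<Rightarrow> nat)" "\<forall>v\<in>V. (\<lambda>n. x (r n) v) \<longlonglongrightarrow> y v"
    by auto
  have "seq_compact {a..b}" by (simp add: compact_imp_seq_compact)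
  moreover have "\<forall>n. x (r n) v \<in> {a..b}" using insert.prems by simp
  ultimately obtain l s where s: "strict_mono (s :: nat \<Rightarrow> nat)" "((\<lambda>n. x (r n) v) \<circ> s) \<longlonglongrightarrow> l"
    by (rule seq_compactE) 
  have "(\<lambda>n. x ((r \<circ> s) n) u) \<longlonglongrightarrow> (y(v := l)) u" if "u \<in> insert v V" for u
  proof (cases "u = v")
    case True
    then show ?thesis using s(2) by (simp add: o_def)
  next
    case False
    then have "(\<lambda>n. x (r n) u) \<longlonglongrightarrow> y u" using r(2) that by simp
    from LIMSEQ_subseq_LIMSEQ[OF this s(1)] show ?thesis using False by (simp add: o_def)
  qed
  moreover have "strict_mono (r \<circ> s)" using r(1) s(1) by (rule strict_mono_o)
  ultimately show ?case by blast
qed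

text \<open>Collatz--Wielandt: the largest \<open>\<rho>\<close> with \<open>\<rho> y \<le> M y\<close> for some probability vector \<open>y\<close> is attained by
compactness.  If \<open>M y \<noteq> \<rho> y\<close>, then the strictly positive matrix \<open>B\<close>, which commutes with \<open>M\<close>,
turns the inequality into a strict one at every coordinate, and \<open>\<rho>\<close> could be increased.  For an
irreducible \<open>M\<close> a suitable \<open>B\<close> is a sum of powers of \<open>M\<close>.\<close>

theorem perron_eigenvector:
  fixes M B :: "'v \<Rightarrow> 'v \<Rightarrow> real"
  assumes fin: "finite V" and ne: "V \<noteq> {}"
    and M0: "\<And>u v. M u v \<ge> 0"
    and Mpos: "\<And>u. u \<in> V \<Longrightarrow> \<exists>v\<in>V. M u v > 0"
    and Bpos: "\<And>u v. u \<in> V \<Longrightarrow> v \<in> V \<Longrightarrow> B u v > 0"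
    and comm: "\<And>u w. u \<in> V \<Longrightarrow> w \<in> V \<Longrightarrow> (\<Sum>v\<in>V. B u v * M v w) = (\<Sum>v\<in>V. M u v * B v w)"
  shows "\<exists>\<rho> r. \<rho> > 0 \<and> (\<forall>v\<in>V. r v > 0) \<and> (\<forall>u\<in>V. (\<Sum>v\<in>V. M u v * r v) = \<rho> * r u)"
proof -
  define ap where "ap A x u = (\<Sum>v\<in>V. A u v * x v)" for A :: "'v \<Rightarrow> 'v \<Rightarrow> real" and x u
  have ap_comm: "ap M (ap B x) u = ap B (ap M x) u" if "u \<in> V" for x u
  proof -
    have "ap M (ap B x) u = (\<Sum>v\<in>V. \<Sum>w\<in>V. M u v * B v w * x w)"
      by (simp add: ap_def sum_distrib_left mult.assoc)
    also have "\<dots> = (\<Sum>w\<in>V. (\<Sum>v\<in>V. M u v * B v w) * x w)"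
      by (subst sum.swap) (simp add: sum_distrib_right)
    also have "\<dots> = (\<Sum>w\<in>V. (\<Sum>v\<in>V. B u v * M v w) * x w)"
      using comm that by simp
    also have "\<dots> = (\<Sum>w\<in>V. \<Sum>v\<in>V. B u v * M v w * x w)"
      by (simp add: sum_distrib_right)
    also have "\<dots> = ap B (ap M x) u"
      by (subst sum.swap) (simp add: ap_def sum_distrib_left mult.assoc)
    finally show ?thesis .
  qed
  have ap_pos: "ap B x u > 0" if "u \<in> V" "\<And>v. v \<in> V \<Longrightarrow> x v \<ge> 0" "w \<in> V" "x w > 0" for x u w
    unfolding ap_def
  proof (rule sum_pos2[OF fin that(3)])
    show "0 < B u w * x w" using Bpos that by simp
    show "0 \<le> B u v * x v" if v: "v \<in> V" for v
      using Bpos[OF \<open>u \<in> V\<close> v] \<open>\<And>v. v \<in> V \<Longrightarrow> x v \<ge> 0\<close>[OF v] by simp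
  qed
  define K where "K = {x :: 'v \<Rightarrow> real. (\<forall>v\<in>V. x v \<ge> 0) \<and> (\<Sum>v\<in>V. x v) = 1}"
  define R where "R = {\<rho>. \<exists>x\<in>K. \<forall>u\<in>V. \<rho> * x u \<le> ap M x u}"
  have K_le: "x v \<le> 1" if "x \<in> K" "v \<in> V" for x v
    using that member_le_sum[of v V x] fin unfolding K_def by auto
  have R0: "0 \<in> R"
  proof -
    define x where "x = (\<lambda>v::'v. 1 / real (card V))"
    have "x \<in> K" using fin ne by (simp add: K_def x_def)
    moreover have "0 * x u \<le> ap M x u" for u
      using M0 by (simp add: ap_def x_def sum_nonneg)
    ultimately show ?thesis unfolding R_def by blast
  qed
  have R_le: "\<rho> \<le> (\<Sum>u\<in>V. \<Sum>v\<in>V. M u v)" if "\<rho> \<in> R" for \<rho>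
  proof -
    obtain x where x: "x \<in> K" "\<And>u. u \<in> V \<Longrightarrow> \<rho> * x u \<le> ap M x u" using \<open>\<rho> \<in> R\<close> unfolding R_def by blast
    have "\<rho> = (\<Sum>u\<in>V. \<rho> * x u)" using x(1) by (simp add: K_def flip: sum_distrib_left)
    also have "\<dots> \<le> (\<Sum>u\<in>V. ap M x u)" by (intro sum_mono x(2))
    also have "\<dots> \<le> (\<Sum>u\<in>V. \<Sum>v\<in>V. M u v)"
      unfolding ap_def using K_le[OF x(1)] M0 by (intro sum_mono mult_left_le) auto
    finally show ?thesis .
  qed
  have bdd: "bdd_above R" using R_le by (auto simp: bdd_above_def)
  define \<rho> where "\<rho> = Sup R"
  have le_rho: "s \<le> \<rho>" if "s \<in> R" for s unfolding \<rho>_def by (rule cSup_upper[OF that bdd])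
  have "\<exists>s\<in>R. \<rho> - inverse (real (Suc n)) < s" for n
    using less_cSup_iff[of R "\<rho> - inverse (real (Suc n))"] R0 bdd unfolding \<rho>_def by auto
  then obtain s where s: "\<And>n. s n \<in> R" "\<And>n. \<rho> - inverse (real (Suc n)) < s n" by metis
  have "\<exists>x\<in>K. \<forall>u\<in>V. s n * x u \<le> ap M x u" for n using s(1)[of n] unfolding R_def by blast
  then obtain x where x: "\<And>n. x n \<in> K" "\<And>n u. u \<in> V \<Longrightarrow> s n * x n u \<le> ap M (x n) u" by metis
  have slim: "s \<longlonglongrightarrow> \<rho>"
  proof (rule tendsto_sandwich[OF always_eventually always_eventually])
    show "\<forall>n. \<rho> - inverse (real (Suc n)) \<le> s n" using s(2) less_imp_le by blast
    show "\<forall>n. s n \<le> \<rho>" using le_rho s(1) by blast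
    show "(\<lambda>n. \<rho> - inverse (real (Suc n))) \<longlonglongrightarrow> \<rho>"
      using tendsto_diff[OF tendsto_const LIMSEQ_inverse_real_of_nat, of \<rho>] by simp
  qed simp
  have "x n v \<in> {0..1}" if "v \<in> V" for n v
    using K_le[OF x(1)[of n] that] x(1)[of n] that by (auto simp: K_def)
  from bounded_coordinates_subsequence[of V x 0 1, OF fin this]
  obtain f y where f: "strict_mono (f :: nat \<Rightarrow> nat)" "\<And>v. v \<in> V \<Longrightarrow> (\<lambda>n. x (f n) v) \<longlonglongrightarrow> y v" by blast
  have y0: "y v \<ge> 0" if "v \<in> V" for v
  proof (rule LIMSEQ_le_const[OF f(2)[OF that]])
    show "\<exists>N. \<forall>n\<ge>N. 0 \<le> x (f n) v" using x(1) that unfolding K_def by blast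
  qed
  have ysum: "(\<Sum>v\<in>V. y v) = 1"
  proof (rule LIMSEQ_unique)
    show "(\<lambda>n. \<Sum>v\<in>V. x (f n) v) \<longlonglongrightarrow> (\<Sum>v\<in>V. y v)" by (intro tendsto_sum f(2))
    show "(\<lambda>n. \<Sum>v\<in>V. x (f n) v) \<longlonglongrightarrow> 1" using x(1) by (simp add: K_def)
  qed
  have yM: "\<rho> * y u \<le> ap M y u" if "u \<in> V" for u
  proof (rule LIMSEQ_le)
    show "(\<lambda>n. s (f n) * x (f n) u) \<longlonglongrightarrow> \<rho> * y u"
      using LIMSEQ_subseq_LIMSEQ[OF slim f(1)] f(2)[OF that] by (intro tendsto_mult) (simp_all add: o_def)
    show "(\<lambda>n. ap M (x (f n)) u) \<longlonglongrightarrow> ap M y u"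
      unfolding ap_def by (intro tendsto_intros f(2))
    show "\<exists>N. \<forall>n\<ge>N. s (f n) * x (f n) u \<le> ap M (x (f n)) u" using x(2) that by blast
  qed
  obtain w0 where w0: "w0 \<in> V" "y w0 > 0"
  proof -
    have "\<exists>w\<in>V. y w > 0"
    proof (rule ccontr)
      assume "\<not> (\<exists>w\<in>V. y w > 0)"
      then have "(\<Sum>v\<in>V. y v) \<le> 0" by (intro sum_nonpos) force
      then show False using ysum by simp
    qed
    then show thesis using that by blast
  qed
  \<comment> \<open>\<open>B y\<close> is strictly positive, while \<open>y\<close> itself is only known to be nonnegative.\<close>
  define r where "r = ap B y"
  have rpos: "r v > 0" if "v \<in> V" for v
    unfolding r_def by (rule ap_pos[of v y w0]) (use that y0 w0 in auto)
  have eig: "ap M y u = \<rho> * y u" if u: "u \<in> V" for u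
  proof (rule ccontr)
    assume neq: "ap M y u \<noteq> \<rho> * y u"
    define d where "d v = ap M y v - \<rho> * y v" for v
    have d0: "d v \<ge> 0" if "v \<in> V" for v using yM[OF that] by (simp add: d_def)
    have du: "d u > 0" using d0[OF u] neq by (auto simp: d_def)
    have Bd: "ap B d v = ap M r v - \<rho> * r v" if "v \<in> V" for v
    proof -
      have "ap B d v = ap B (ap M y) v - \<rho> * ap B y v"
        by (simp add: ap_def d_def right_diff_distrib sum_subtractf sum_distrib_left mult_ac)
      then show ?thesis using ap_comm[OF that, of y] by (simp add: r_def)
    qed
    define e where "e = Min ((\<lambda>v. ap B d v / r v) ` V)"
    have epos: "e > 0"
      unfolding e_def using fin ne rpos ap_pos[of _ d u] d0 u du by (subst Min_gr_iff) auto
    have e_le: "e * r v \<le> ap B d v" if "v \<in> V" for v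
    proof -
      have "e \<le> ap B d v / r v" unfolding e_def using fin that by (intro Min_le) auto
      then show ?thesis using rpos[OF that] by (simp add: pos_le_divide_eq)
    qed
    define Z where "Z = (\<Sum>v\<in>V. r v)"
    have Zpos: "Z > 0" unfolding Z_def using fin ne rpos by (intro sum_pos) auto
    define z where "z = (\<lambda>v. r v / Z)"
    have "z \<in> K"
      using rpos Zpos unfolding K_def z_def
      by (auto simp: less_imp_le simp flip: sum_divide_distrib) (simp add: Z_def[symmetric])
    moreover have "(\<rho> + e) * z v \<le> ap M z v" if "v \<in> V" for v
    proof -
      have "(\<rho> + e) * r v \<le> ap M r v" using e_le[OF that] Bd[OF that] by (simp add: algebra_simps)
      then have "(\<rho> + e) * r v / Z \<le> ap M r v / Z" using Zpos by (simp add: divide_right_mono)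
      then show ?thesis by (simp add: z_def ap_def sum_divide_distrib)
    qed
    ultimately have "\<rho> + e \<in> R" unfolding R_def by blast
    from le_rho[OF this] epos show False by simp
  qed
  have "ap M r u = \<rho> * r u" if "u \<in> V" for u
  proof -
    have "ap M r u = ap B (ap M y) u" using ap_comm[OF that] by (simp add: r_def)
    also have "\<dots> = ap B (\<lambda>v. \<rho> * y v) u" using eig by (simp add: ap_def)
    also have "\<dots> = \<rho> * r u" by (simp add: r_def ap_def sum_distrib_left mult_ac)
    finally show ?thesis .
  qed
  moreover have "\<rho> > 0"
  proof -
    obtain u where u: "u \<in> V" using ne by blast
    obtain v where v: "v \<in> V" "M u v > 0" using Mpos[OF u] by blast
    have "ap M r u > 0"
      unfolding ap_def
    proof (rule sum_pos2[OF fin v(1)])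
      show "0 < M u v * r v" using v rpos by simp
      show "0 \<le> M u w * r w" if "w \<in> V" for w using M0 rpos[OF that] by simp
    qed
    then have "\<rho> * r u > 0" using \<open>\<And>u. u \<in> V \<Longrightarrow> ap M r u = \<rho> * r u\<close>[OF u] by simp
    then show ?thesis using rpos[OF u] by (simp add: zero_less_mult_iff)
  qed
  ultimately show ?thesis using rpos unfolding ap_def by blast
qed

definition words :: "'a set \<Rightarrow> nat \<Rightarrow> 'a list set" where
  "words S n = {w. length w = n \<and> set w \<subseteq> S}"

lemma finite_words: "finite S \<Longrightarrow> finite (words S n)"
  using finite_lists_length_eq[of S n] by (simp add: words_def conj_commute)

lemma words_0 [simp]: "words S 0 = {[]}"
  by (auto simp: words_def)

lemma words_Suc: "words S (Suc n) = (\<lambda>(a, w). a # w) ` (S \<times> words S n)"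
  by (auto simp: words_def image_iff length_Suc_conv)

lemma sum_words_Suc: "(\<Sum>w\<in>words S (Suc n). f w) = (\<Sum>a\<in>S. \<Sum>w\<in>words S n. f (a # w))"
  unfolding words_Suc sum.cartesian_product
  by (subst sum.reindex) (auto simp: inj_on_def case_prod_unfold)

lemma sum_words_add:
  "(\<Sum>w\<in>words S (m + n). f w) = (\<Sum>u\<in>words S m. \<Sum>v\<in>words S n. f (u @ v))"
proof (induction m arbitrary: f)
  case (Suc m)
  show ?case by (simp add: sum_words_Suc Suc)
qed simp

context automaton
begin

definition path_count :: "nat \<Rightarrow> 'v \<Rightarrow> 'v \<Rightarrow> real" where
  "path_count n u v = (\<Sum>w\<in>words S n. if run \<delta> u w = Some v then 1 else 0)"

lemma path_count_nonneg: "path_count n u v \<ge> 0"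
  unfolding path_count_def by (intro sum_nonneg) auto

lemma path_count_0: "path_count 0 u v = (if u = v then 1 else 0)"
  by (simp add: path_count_def)

lemma sum_run_states:
  fixes f :: "'v \<Rightarrow> real"
  assumes "u \<in> V"
  shows "(\<Sum>w\<in>words S n. case run \<delta> u w of None \<Rightarrow> 0 | Some v \<Rightarrow> f v) = (\<Sum>v\<in>V. path_count n u v * f v)"
proof -
  have "(\<Sum>v\<in>V. path_count n u v * f v)
    = (\<Sum>w\<in>words S n. \<Sum>v\<in>V. (if run \<delta> u w = Some v then 1 else 0) * f v)"
    unfolding path_count_def sum_distrib_right by (rule sum.swap)
  also have "\<dots> = (\<Sum>w\<in>words S n. case run \<delta> u w of None \<Rightarrow> 0 | Some v \<Rightarrow> f v)"
  proof (rule sum.cong[OF refl])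
    fix w
    show "(\<Sum>v\<in>V. (if run \<delta> u w = Some v then 1 else 0) * f v) = (case run \<delta> u w of None \<Rightarrow> 0 | Some v \<Rightarrow> f v)"
    proof (cases "run \<delta> u w")
      case (Some t)
      then have "t \<in> V" using run_in_V assms by blast
      have "(\<Sum>v\<in>V. (if run \<delta> u w = Some v then 1 else 0) * f v) = (\<Sum>v\<in>V. if v = t then f v else 0)"
        using Some by (intro sum.cong) auto
      then show ?thesis using Some \<open>t \<in> V\<close> finite_V by (simp add: sum.delta)
    qed simp
  qed
  finally show ?thesis by simp
qed

lemma path_count_add:
  assumes "u \<in> V"
  shows "path_count (m + n) u t = (\<Sum>v\<in>V. path_count m u v * path_count n v t)"
proof -
  have "path_count (m + n) u t = (\<Sum>w\<in>words S m. case run \<delta> u w of None \<Rightarrow> 0 | Some v \<Rightarrow> path_count n v t)"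
    unfolding path_count_def sum_words_add
  proof (rule sum.cong[OF refl])
    fix w
    show "(\<Sum>w'\<in>words S n. if run \<delta> u (w @ w') = Some t then 1 else 0)
      = (case run \<delta> u w of None \<Rightarrow> 0 | Some v \<Rightarrow> \<Sum>w\<in>words S n. if run \<delta> v w = Some t then 1 else (0::real))"
      by (cases "run \<delta> u w") (simp_all add: run_append)
  qed
  then show ?thesis using sum_run_states[OF assms] by simp
qed

definition reach :: "nat \<Rightarrow> 'v \<Rightarrow> 'v \<Rightarrow> bool" where
  "reach n u v \<longleftrightarrow> (\<exists>w. length w = n \<and> run \<delta> u w = Some v)"

lemma reach_add: "reach m u v \<Longrightarrow> reach n v t \<Longrightarrow> reach (m + n) u t"
  unfolding reach_def
proof (elim exE conjE)
  fix w w' assume "length w = m" "run \<delta> u w = Some v" "length w' = n" "run \<delta> v w' = Some t"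
  then show "\<exists>w. length w = m + n \<and> run \<delta> u w = Some t"
    by (intro exI[of _ "w @ w'"]) (simp add: run_append)
qed

lemma path_count_pos_iff: "path_count n u v > 0 \<longleftrightarrow> reach n u v"
proof
  assume "path_count n u v > 0"
  then have "path_count n u v \<noteq> 0" by simp
  then obtain w where "w \<in> words S n" "(if run \<delta> u w = Some v then 1 else (0::real)) \<noteq> 0"
    unfolding path_count_def by (rule sum.not_neutral_contains_not_neutral)
  then show "reach n u v" unfolding reach_def words_def by (auto split: if_split_asm)
next
  assume "reach n u v"
  then obtain w where w: "length w = n" "run \<delta> u w = Some v" unfolding reach_def by blast
  then have "w \<in> words S n" using run_letters by (simp add: words_def)
  then show "path_count n u v > 0"
    unfolding path_count_def
    using w(2) by (intro sum_pos2[OF finite_words[OF finite_S], of w]) auto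
qed

end

locale connected_automaton = essential_automaton V S \<delta>
  for V :: "'v set" and S :: "'a set" and \<delta> :: "'v \<Rightarrow> 'a \<Rightarrow> 'v option" +
  assumes V_nonempty: "V \<noteq> {}"
    and connected: "u \<in> V \<Longrightarrow> v \<in> V \<Longrightarrow> \<exists>w. run \<delta> u w = Some v"
begin

lemma connected_reach: "u \<in> V \<Longrightarrow> v \<in> V \<Longrightarrow> \<exists>n. reach n u v"
  using connected unfolding reach_def by blast

theorem perron_eigenvector_exists:
  "\<exists>\<rho> r. \<rho> > 0 \<and> (\<forall>v\<in>V. r v > 0) \<and> (\<forall>u\<in>V. (\<Sum>v\<in>V. path_count 1 u v * r v) = \<rho> * r u)"
proof -
  define k where "k u v = (LEAST n. reach n u v)" for u v
  have k: "reach (k u v) u v" if "u \<in> V" "v \<in> V" for u v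
    unfolding k_def using connected_reach[OF that] by (rule LeastI_ex)
  define K where "K = Max ((\<lambda>(u, v). k u v) ` (V \<times> V))"
  have K: "k u v \<le> K" if "u \<in> V" "v \<in> V" for u v
    unfolding K_def using finite_V that by (intro Max_ge) auto
  define B where "B u v = (\<Sum>n\<le>K. path_count n u v)" for u v
  show ?thesis
  proof (rule perron_eigenvector[where B = B and M = "path_count 1"])
    show "finite V" "V \<noteq> {}" using finite_V V_nonempty by auto
    show "path_count 1 u v \<ge> 0" for u v by (rule path_count_nonneg)
    show "\<exists>v\<in>V. path_count 1 u v > 0" if u: "u \<in> V" for u
    proof -
      obtain a v where a: "\<delta> u a = Some v" using out_step[OF u] by blast
      then have "reach 1 u v" unfolding reach_def by (intro exI[of _ "[a]"]) simp
      moreover have "v \<in> V" using step[OF a] by simp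
      ultimately show ?thesis using path_count_pos_iff by blast
    qed
    show "B u v > 0" if uv: "u \<in> V" "v \<in> V" for u v
      unfolding B_def
    proof (rule sum_pos2[of _ "k u v"])
      show "0 < path_count (k u v) u v" using k[OF uv] path_count_pos_iff by simp
    qed (use K[OF uv] path_count_nonneg in auto)
    show "(\<Sum>v\<in>V. B u v * path_count 1 v w) = (\<Sum>v\<in>V. path_count 1 u v * B v w)" if "u \<in> V" for u w
    proof -
      have "(\<Sum>v\<in>V. B u v * path_count 1 v w) = (\<Sum>n\<le>K. \<Sum>v\<in>V. path_count n u v * path_count 1 v w)"
        unfolding B_def sum_distrib_right by (rule sum.swap)
      also have "\<dots> = (\<Sum>n\<le>K. path_count (n + 1) u w)"
        unfolding path_count_add[OF that] by (rule refl)
      also have "\<dots> = (\<Sum>n\<le>K. path_count (1 + n) u w)" by (simp add: add.commute)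
      also have "\<dots> = (\<Sum>n\<le>K. \<Sum>v\<in>V. path_count 1 u v * path_count n v w)"
        unfolding path_count_add[OF that] by (rule refl)
      also have "\<dots> = (\<Sum>v\<in>V. path_count 1 u v * B v w)"
        unfolding B_def sum_distrib_left by (rule sum.swap)
      finally show ?thesis .
    qed
  qed
qed

end

locale perron_automaton = connected_automaton V S \<delta>
  for V :: "'v set" and S :: "'a set" and \<delta> :: "'v \<Rightarrow> 'a \<Rightarrow> 'v option" +
  fixes \<rho> :: real and r :: "'v \<Rightarrow> real"
  assumes rho_pos: "\<rho> > 0" and r_pos: "v \<in> V \<Longrightarrow> r v > 0"
    and eigen: "u \<in> V \<Longrightarrow> (\<Sum>v\<in>V. path_count 1 u v * r v) = \<rho> * r u"
begin

lemma eigen_power: "u \<in> V \<Longrightarrow> (\<Sum>v\<in>V. path_count n u v * r v) = \<rho> ^ n * r u"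
proof (induction n)
  case 0
  then show ?case using finite_V by (simp add: path_count_0 if_distrib[of "\<lambda>x. x * _"] cong: if_cong)
next
  case (Suc n)
  have "(\<Sum>v\<in>V. path_count (n + 1) u v * r v) = (\<Sum>v\<in>V. \<Sum>s\<in>V. path_count n u s * path_count 1 s v * r v)"
    unfolding path_count_add[OF Suc.prems] sum_distrib_right by (rule refl)
  also have "\<dots> = (\<Sum>s\<in>V. path_count n u s * (\<Sum>v\<in>V. path_count 1 s v * r v))"
    by (subst sum.swap) (simp add: sum_distrib_left mult.assoc)
  also have "\<dots> = (\<Sum>s\<in>V. path_count n u s * (\<rho> * r s))" using eigen by simp
  also have "\<dots> = \<rho> * (\<Sum>s\<in>V. path_count n u s * r s)" by (simp add: sum_distrib_left mult_ac)
  finally show ?case using Suc by simp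
qed

lemma r_bounds: obtains a b where "a > 0" "b > 0" "\<And>v. v \<in> V \<Longrightarrow> a \<le> r v" "\<And>v. v \<in> V \<Longrightarrow> r v \<le> b"
proof
  show "Min (r ` V) > 0" using finite_V V_nonempty r_pos by (subst Min_gr_iff) auto
  show min: "\<And>v. v \<in> V \<Longrightarrow> Min (r ` V) \<le> r v" using finite_V by (intro Min_le) auto
  show max: "\<And>v. v \<in> V \<Longrightarrow> r v \<le> Max (r ` V)" using finite_V by (intro Max_ge) auto
  obtain v where v: "v \<in> V" using V_nonempty by blast
  show "Max (r ` V) > 0" using max[OF v] r_pos[OF v] by simp
qed

lemma sum_run_eigen:
  "u \<in> V \<Longrightarrow> (\<Sum>w\<in>words S n. case run \<delta> u w of None \<Rightarrow> 0 | Some v \<Rightarrow> r v) = \<rho> ^ n * r u"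
  using sum_run_states[of u r n] eigen_power[of u n] by simp

text \<open>The eigenvector is bounded between positive constants, so the number of words of length \<open>n\<close> is
\<open>\<rho> ^ n\<close> up to bounded factors.\<close>

theorem topological_entropy_eq: "topological_entropy (aut_shift \<delta>) = ln \<rho>"
proof -
  obtain a b where ab: "a > 0" "b > 0" "\<And>v. v \<in> V \<Longrightarrow> a \<le> r v" "\<And>v. v \<in> V \<Longrightarrow> r v \<le> b"
    using r_bounds by blast
  define W where "W n = {w\<in>words S n. \<exists>v\<in>V. run \<delta> v w \<noteq> None}" for n
  have Weq: "words_of_length (aut_shift \<delta>) n = W n" for n
    unfolding words_of_length_aut_shift W_def words_def using run_letters by auto
  have finW: "finite (W n)" for n unfolding W_def using finite_words[OF finite_S] by simp
  obtain v0 where v0: "v0 \<in> V" using V_nonempty by blast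
  have lower: "\<rho> ^ n * r v0 / b \<le> real (card (W n))" for n
  proof -
    have "\<rho> ^ n * r v0 = (\<Sum>w\<in>words S n. case run \<delta> v0 w of None \<Rightarrow> 0 | Some v \<Rightarrow> r v)"
      using sum_run_eigen[OF v0] by simp
    also have "\<dots> \<le> (\<Sum>w\<in>words S n. if w \<in> W n then b else 0)"
    proof (rule sum_mono)
      fix w assume w: "w \<in> words S n"
      show "(case run \<delta> v0 w of None \<Rightarrow> 0 | Some v \<Rightarrow> r v) \<le> (if w \<in> W n then b else 0)"
      proof (cases "run \<delta> v0 w")
        case None
        then show ?thesis using ab(2) by simp
      next
        case (Some v)
        then have "w \<in> W n" using w v0 unfolding W_def by auto
        then show ?thesis using Some ab(4) run_in_V[OF Some v0] by simp
      qed
    qed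
    also have "\<dots> = real (card (W n)) * b"
      using finite_words[OF finite_S] by (simp add: sum.If_cases W_def Int_def)
    finally show ?thesis using ab(2) by (simp add: pos_divide_le_eq)
  qed
  have upper: "real (card (W n)) \<le> \<rho> ^ n * ((\<Sum>v\<in>V. r v) / a)" for n
  proof -
    have "real (card (W n)) * a = (\<Sum>w\<in>words S n. if w \<in> W n then a else 0)"
      using finite_words[OF finite_S] by (simp add: sum.If_cases W_def Int_def)
    also have "\<dots> \<le> (\<Sum>w\<in>words S n. \<Sum>u\<in>V. case run \<delta> u w of None \<Rightarrow> 0 | Some v \<Rightarrow> r v)"
    proof (rule sum_mono)
      fix w assume w: "w \<in> words S n"
      have nn: "(case run \<delta> u w of None \<Rightarrow> 0 | Some v \<Rightarrow> r v) \<ge> 0" if "u \<in> V" for u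
        using that r_pos run_in_V by (auto split: option.splits intro: less_imp_le)
      show "(if w \<in> W n then a else 0) \<le> (\<Sum>u\<in>V. case run \<delta> u w of None \<Rightarrow> 0 | Some v \<Rightarrow> r v)"
      proof (cases "w \<in> W n")
        case True
        then obtain u v where u: "u \<in> V" "run \<delta> u w = Some v" unfolding W_def by blast
        have "a \<le> (case run \<delta> u w of None \<Rightarrow> 0 | Some v \<Rightarrow> r v)"
          using u ab(3) run_in_V[OF u(2) u(1)] by simp
        also have "\<dots> \<le> (\<Sum>u\<in>V. case run \<delta> u w of None \<Rightarrow> 0 | Some v \<Rightarrow> r v)"
          using finite_V nn u(1) by (intro member_le_sum) auto
        finally show ?thesis using True by simp
      next
        case False
        then show ?thesis using nn by (simp add: sum_nonneg)
      qed
    qed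
    also have "\<dots> = (\<Sum>u\<in>V. \<rho> ^ n * r u)"
      by (subst sum.swap) (simp add: sum_run_eigen)
    also have "\<dots> = \<rho> ^ n * (\<Sum>v\<in>V. r v)" by (simp add: sum_distrib_left)
    finally show ?thesis using ab(1) by (simp add: pos_le_divide_eq)
  qed
  define c1 c2 where "c1 = r v0 / b" and "c2 = (\<Sum>v\<in>V. r v) / a"
  have c: "c1 > 0" "c2 > 0"
    unfolding c1_def c2_def using ab r_pos[OF v0] finite_V V_nonempty r_pos
    by (auto intro!: divide_pos_pos sum_pos)
  have ln_lower: "ln \<rho> + ln c1 / real n \<le> ln (real (card (W n))) / real n"
    and ln_upper: "ln (real (card (W n))) / real n \<le> ln \<rho> + ln c2 / real n" if "n > 0" for n
  proof -
    have l: "\<rho> ^ n * c1 \<le> real (card (W n))" and u: "real (card (W n)) \<le> \<rho> ^ n * c2"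
      using lower[of n] upper[of n] by (simp_all add: c1_def c2_def)
    have pos: "\<rho> ^ n * c1 > 0" using rho_pos c by simp
    have "ln (\<rho> ^ n * c1) \<le> ln (real (card (W n)))" using l pos by simp
    moreover have "ln (real (card (W n))) \<le> ln (\<rho> ^ n * c2)" using l u pos by simp
    moreover have "ln (\<rho> ^ n * c1) = real n * ln \<rho> + ln c1" "ln (\<rho> ^ n * c2) = real n * ln \<rho> + ln c2"
      using rho_pos c by (simp_all add: ln_mult ln_realpow)
    ultimately have "(real n * ln \<rho> + ln c1) / real n \<le> ln (real (card (W n))) / real n"
      "ln (real (card (W n))) / real n \<le> (real n * ln \<rho> + ln c2) / real n"
      by (simp_all add: divide_right_mono)
    then show "ln \<rho> + ln c1 / real n \<le> ln (real (card (W n))) / real n"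
      "ln (real (card (W n))) / real n \<le> ln \<rho> + ln c2 / real n"
      using that by (simp_all add: add_divide_distrib)
  qed
  have "(\<lambda>n. ln (real (card (W n))) / real n) \<longlonglongrightarrow> ln \<rho>"
  proof (rule tendsto_sandwich)
    show "eventually (\<lambda>n. ln \<rho> + ln c1 / real n \<le> ln (real (card (W n))) / real n) sequentially"
      using eventually_gt_at_top[of 0] by eventually_elim (rule ln_lower)
    show "eventually (\<lambda>n. ln (real (card (W n))) / real n \<le> ln \<rho> + ln c2 / real n) sequentially"
      using eventually_gt_at_top[of 0] by eventually_elim (rule ln_upper)
    have "(\<lambda>n. ln \<rho> + c / real n) \<longlonglongrightarrow> ln \<rho> + 0" for c
      by (intro tendsto_add tendsto_const lim_const_over_n)
    then show "(\<lambda>n. ln \<rho> + ln c1 / real n) \<longlonglongrightarrow> ln \<rho>" "(\<lambda>n. ln \<rho> + ln c2 / real n) \<longlonglongrightarrow> ln \<rho>"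
      by simp_all
  qed
  then show ?thesis unfolding topological_entropy_def Weq by (rule limI)
qed

end

section \<open>Closed paths: exponential convergence of the trace\<close>

text \<open>The least positive difference \<open>d\<close> of two elements of the semigroup (with \<open>0\<close> adjoined) divides
every element, by division with remainder, so it is the gcd.  If \<open>d\<close> is the difference of \<open>y + d\<close>
and \<open>y = d * k\<close>, every \<open>d * m\<close> with \<open>m > k * k\<close> is a combination of \<open>y\<close> and \<open>y + d\<close>: divide \<open>m\<close>
by \<open>k\<close> (if \<open>k = 0\<close>, then \<open>d\<close> itself is an element).\<close>

lemma numerical_semigroup_eventually_all:
  fixes A :: "nat set"
  assumes add: "\<And>a b. a \<in> A \<Longrightarrow> b \<in> A \<Longrightarrow> a + b \<in> A"
    and pos: "0 \<notin> A" and ne: "A \<noteq> {}"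
  shows "Gcd A > 0 \<and> (\<exists>M. \<forall>m\<ge>M. Gcd A * m \<in> A)"
proof -
  define A0 where "A0 = insert 0 A"
  have add0: "a + b \<in> A0" if "a \<in> A0" "b \<in> A0" for a b
    using that add unfolding A0_def by auto
  have mult0: "n * a \<in> A0" if "a \<in> A0" for n a
  proof (induction n)
    case 0
    then show ?case by (simp add: A0_def)
  next
    case (Suc n)
    from add0[OF that Suc] show ?case by simp
  qed
  define D where "D d \<longleftrightarrow> d > 0 \<and> (\<exists>y\<in>A0. y + d \<in> A0)" for d
  define d where "d = (LEAST d. D d)"
  obtain a0 where a0: "a0 \<in> A" using ne by blast
  then have "a0 > 0" using pos by (cases a0) auto
  then have "D a0" using a0 unfolding D_def A0_def by (intro conjI bexI[of _ 0]) auto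
  then have Dd: "D d" unfolding d_def by (rule LeastI)
  then obtain y where y: "d > 0" "y \<in> A0" "y + d \<in> A0" unfolding D_def by blast
  have dvd: "d dvd a" if a: "a \<in> A0" for a
  proof (rule ccontr)
    assume "\<not> d dvd a"
    then have mod: "a mod d > 0" by (simp add: mod_greater_zero_iff_not_dvd)
    let ?q = "a div d"
    have "?q * (y + d) \<in> A0" using mult0[OF y(3)] .
    moreover have "?q * (y + d) + a mod d = a + ?q * y"
      by (metis add.assoc add.commute div_mult_mod_eq distrib_left)
    moreover have "a + ?q * y \<in> A0" using add0[OF a mult0[OF y(2)]] .
    ultimately have "D (a mod d)" using mod unfolding D_def by (metis)
    then have "d \<le> a mod d" unfolding d_def by (rule Least_le)
    then show False using mod_less_divisor[OF y(1), of a] by simp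
  qed
  have "d dvd Gcd A" using dvd by (intro Gcd_greatest) (auto simp: A0_def)
  moreover have "Gcd A dvd d"
  proof -
    have "Gcd A dvd a" if "a \<in> A0" for a using that by (auto simp: A0_def)
    from this[OF y(2)] this[OF y(3)] show ?thesis by (simp add: dvd_add_right_iff)
  qed
  ultimately have p: "Gcd A = d" by (rule dvd_antisym[symmetric])
  obtain k where k: "y = d * k" using dvd[OF y(2)] by (elim dvdE)
  have "d * m \<in> A" if m: "m \<ge> k * k + 1" for m
  proof -
    \<comment> \<open>In the division of \<open>m\<close> by \<open>k\<close>, the remainder \<open>s < k\<close> is at most the quotient \<open>q\<close>, because \<open>m \<ge> k * k\<close>.\<close>
    have "d * m \<in> A0"
    proof (cases "k = 0")
      case True
      then show ?thesis using mult0[OF y(3), of m] k by (simp add: mult.commute)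
    next
      case False
      define q s where "q = m div k" and "s = m mod k"
      have s: "s < k" using False by (simp add: s_def)
      have "q \<ge> k"
        using div_le_mono[of "k * k" m k] m False by (simp add: q_def)
      then have qs: "q \<ge> s" using s by simp
      have "m = q * k + s" by (simp add: q_def s_def)
      then have "d * m = q * y + s * d" by (simp add: k algebra_simps)
      also have "\<dots> = (q - s) * y + s * (y + d)"
      proof -
        obtain t where "q = s + t" using qs by (auto simp: le_iff_add)
        then show ?thesis by (simp add: algebra_simps)
      qed
      finally show ?thesis using add0[OF mult0[OF y(2)] mult0[OF y(3)]] by simp
    qed
    moreover have "d * m \<noteq> 0" using m y(1) by simp
    ultimately show ?thesis by (simp add: A0_def)
  qed
  then show ?thesis using p y(1) by auto
qed

context connected_automaton
begin

definition return_period :: "'v \<Rightarrow> nat" where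
  "return_period v = Gcd {n. n > 0 \<and> reach n v v}"

lemma return_times_eventually:
  assumes v: "v \<in> V"
  shows "return_period v > 0 \<and> (\<exists>M. \<forall>m\<ge>M. reach (return_period v * m) v v)"
proof -
  obtain a u where a: "\<delta> v a = Some u" using out_step[OF v] by blast
  then have u: "u \<in> V" using step by blast
  have "reach 1 v u" using a unfolding reach_def by (intro exI[of _ "[a]"]) simp
  moreover obtain n where "reach n u v" using connected_reach[OF u v] by blast
  ultimately have "reach (1 + n) v v" by (rule reach_add)
  then have ne: "{n. n > 0 \<and> reach n v v} \<noteq> {}" by auto
  have "return_period v > 0 \<and> (\<exists>M. \<forall>m\<ge>M. return_period v * m \<in> {n. n > 0 \<and> reach n v v})"
    unfolding return_period_def
    by (rule numerical_semigroup_eventually_all[OF _ _ ne]) (auto intro: reach_add)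
  then show ?thesis by blast
qed

lemma return_period_dvd: "reach n v v \<Longrightarrow> return_period v dvd n"
  unfolding return_period_def by (cases "n = 0") auto

text \<open>The class of a state is the length of any path to it from \<open>b\<close>, modulo the period.  Two states of
the same class are joined by paths of all sufficiently large lengths divisible by the period: go
to \<open>b\<close>, loop there, and continue.\<close>

lemma cyclic_classes:
  assumes b: "b \<in> V"
  defines "p \<equiv> return_period b"
  obtains c :: "'v \<Rightarrow> nat" and M where
    "\<And>v. c v < p"
    "\<And>n u v. u \<in> V \<Longrightarrow> v \<in> V \<Longrightarrow> reach n u v \<Longrightarrow> [c u + n = c v] (mod p)"
    "\<And>j. j < p \<Longrightarrow> \<exists>v\<in>V. c v = j"
    "\<And>m u v. m \<ge> M \<Longrightarrow> u \<in> V \<Longrightarrow> v \<in> V \<Longrightarrow> c u = c v \<Longrightarrow> reach (p * m) u v"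
proof -
  obtain M0 where p: "p > 0" and M0: "\<And>m. m \<ge> M0 \<Longrightarrow> reach (p * m) b b"
    using return_times_eventually[OF b] unfolding p_def by blast
  define e where "e v = (SOME n. reach n b v)" for v
  have e: "reach (e v) b v" if "v \<in> V" for v
    unfolding e_def using connected_reach[OF b that] by (rule someI_ex)
  define c where "c v = e v mod p" for v
  have cong_e: "[e u + n = e v] (mod p)" if uv: "u \<in> V" "v \<in> V" and n: "reach n u v" for n u v
  proof -
    obtain k where k: "reach k v b" using connected_reach[OF uv(2) b] by blast
    have "p dvd e u + n + k"
      unfolding p_def by (intro return_period_dvd reach_add[OF reach_add[OF e[OF uv(1)] n] k])
    moreover have "p dvd e v + k"
      unfolding p_def by (intro return_period_dvd reach_add[OF e[OF uv(2)] k])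
    ultimately have "[e u + n + k = e v + k] (mod p)"
      by (simp add: cong_def mod_eq_0_iff_dvd[THEN iffD2] dvd_imp_mod_0)
    then show ?thesis by (simp add: cong_add_rcancel_nat)
  qed
  have c_cong: "[c u + n = c v] (mod p)" if "u \<in> V" "v \<in> V" "reach n u v" for n u v
    using cong_e[OF that] unfolding c_def cong_def by (simp add: mod_simps)
  have "\<exists>M. \<forall>m\<ge>M. reach (p * m) u v" if uv: "u \<in> V" "v \<in> V" "c u = c v" for u v
  proof -
    obtain s where s: "reach s u b" using connected_reach[OF uv(1) b] by blast
    obtain t where t: "reach t b v" using connected_reach[OF b uv(2)] by blast
    have "[c u + (s + t) = c v] (mod p)" by (rule c_cong[OF uv(1,2) reach_add[OF s t]])
    then have "[c v + (s + t) = c v + 0] (mod p)" using uv(3) by simp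
    then have "[s + t = 0] (mod p)" by (simp only: cong_add_lcancel_nat)
    then have "p dvd s + t" by (simp add: cong_0_iff)
    then obtain k where k: "s + t = p * k" by (elim dvdE)
    have "reach (p * m) u v" if m: "m \<ge> M0 + k" for m
    proof -
      have "reach (s + p * (m - k) + t) u v"
        by (rule reach_add[OF reach_add[OF s M0] t]) (use m in simp)
      moreover have "s + p * (m - k) + t = p * (m - k) + p * k" using k by simp
      moreover have "p * (m - k) + p * k = p * m" using m by (simp flip: distrib_left)
      ultimately show ?thesis by simp
    qed
    then show ?thesis by blast
  qed
  then have "\<forall>u\<in>V. \<forall>v\<in>V. \<exists>M. c u = c v \<longrightarrow> (\<forall>m\<ge>M. reach (p * m) u v)" by blast
  then obtain M where "\<forall>u\<in>V. \<forall>v\<in>V. c u = c v \<longrightarrow> (\<forall>m\<ge>M u v. reach (p * m) u v)"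
    unfolding bchoice_iff by (elim exE)
  then have M: "\<And>u v m. u \<in> V \<Longrightarrow> v \<in> V \<Longrightarrow> c u = c v \<Longrightarrow> m \<ge> M u v \<Longrightarrow> reach (p * m) u v"
    by blast
  define M1 where "M1 = Max ((\<lambda>(u, v). M u v) ` (V \<times> V))"
  have M1: "M u v \<le> M1" if "u \<in> V" "v \<in> V" for u v
    unfolding M1_def using finite_V that by (intro Max_ge) auto
  show thesis
  proof (rule that)
    show "c v < p" for v using p by (simp add: c_def)
    show "[c u + n = c v] (mod p)" if "u \<in> V" "v \<in> V" "reach n u v" for n u v
      using c_cong[OF that] .
    show "reach (p * m) u v" if "m \<ge> M1" "u \<in> V" "v \<in> V" "c u = c v" for m u v
      using M[OF that(2,3,4)] M1[OF that(2,3)] that(1) by simp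
    show "\<exists>v\<in>V. c v = j" if j: "j < p" for j
    proof -
      obtain q x where q: "q 0 = b" "\<forall>i::nat. \<delta> (q i) (x i) = Some (q (Suc i))"
        using forward_path[OF b] by (elim exE conjE)
      have qV: "q i \<in> V" for i using q(2) step by blast
      have r1: "reach 1 (q i) (q (Suc i))" for i
        unfolding reach_def using q(2) by (intro exI[of _ "[x i]"]) simp
      have rb: "reach i b (q i)" for i
      proof (induction i)
        case 0
        then show ?case using q(1) by (simp add: reach_def)
      next
        case (Suc i)
        from reach_add[OF Suc r1] show ?case by simp
      qed
      have cb: "[c b + n = c v] (mod p)" if "v \<in> V" "reach n b v" for n v
        using c_cong[OF b that] .
      have "p dvd e b" unfolding p_def by (rule return_period_dvd[OF e[OF b]])
      then have "c b = 0" by (simp add: c_def)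
      then have "[j = c (q j)] (mod p)" using cb[OF qV rb, of j] by simp
      then have "c (q j) = j" using j p by (simp add: cong_def c_def)
      then show ?thesis using qV by blast
    qed
  qed
qed

end

text \<open>A factor \<open>\<theta> < 1\<close> gained once in every block of length \<open>K\<close> is an exponential gain.\<close>

lemma power_div_le_exponential:
  fixes \<theta> :: real
  assumes "0 < \<theta>" "\<theta> < 1" "K > 0"
  obtains \<kappa> C where "0 < \<kappa>" "\<kappa> < 1" "C > 0" "\<And>n. \<theta> ^ (n div K) \<le> C * \<kappa> ^ n"
proof -
  define \<kappa> where "\<kappa> = root K \<theta>"
  have k: "0 < \<kappa>" "\<kappa> < 1" "\<kappa> ^ K = \<theta>"
    using assms real_root_less_mono[of K \<theta> 1] by (simp_all add: \<kappa>_def)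
  have "\<theta> ^ (n div K) \<le> (1 / \<theta>) * \<kappa> ^ n" for n
  proof -
    have "\<kappa> ^ K \<le> \<kappa> ^ (n mod K)" using k assms(3) by (intro power_decreasing) (auto intro: less_imp_le)
    then have "\<theta> ^ (n div K) * \<theta> \<le> \<theta> ^ (n div K) * \<kappa> ^ (n mod K)"
      using k(3) assms(1) by (intro mult_left_mono) auto
    also have "\<dots> = \<kappa> ^ (K * (n div K) + n mod K)"
      unfolding power_add power_mult k(3) ..
    also have "\<dots> = \<kappa> ^ n" by simp
    finally show ?thesis using assms(1) by (simp add: field_simps)
  qed
  then show thesis using that[of \<kappa> "1 / \<theta>"] k assms(1) by simp
qed

context perron_automaton
begin

text \<open>The Doob transform of the path counts: the transition probabilities of a Markov chain on the
states.\<close>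

definition kernel :: "nat \<Rightarrow> 'v \<Rightarrow> 'v \<Rightarrow> real" where
  "kernel n u v = path_count n u v * r v / (\<rho> ^ n * r u)"

lemma kernel_nonneg: "u \<in> V \<Longrightarrow> v \<in> V \<Longrightarrow> kernel n u v \<ge> 0"
  unfolding kernel_def using path_count_nonneg r_pos rho_pos by (simp add: less_imp_le)

lemma kernel_sum: "u \<in> V \<Longrightarrow> (\<Sum>v\<in>V. kernel n u v) = 1"
  unfolding kernel_def sum_divide_distrib[symmetric]
  using eigen_power[of u n] r_pos[of u] rho_pos by simp

lemma kernel_le_1: "u \<in> V \<Longrightarrow> v \<in> V \<Longrightarrow> kernel n u v \<le> 1"
  using member_le_sum[of v V "kernel n u"] kernel_nonneg kernel_sum[of u n] finite_V by auto

lemma kernel_add: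
  assumes u: "u \<in> V"
  shows "kernel (m + n) u t = (\<Sum>v\<in>V. kernel m u v * kernel n v t)"
proof -
  have "kernel m u v * kernel n v t = path_count m u v * path_count n v t * r t / (\<rho> ^ (m + n) * r u)"
    if "v \<in> V" for v
    using r_pos[OF that] r_pos[OF u] rho_pos by (simp add: kernel_def power_add field_simps)
  then show ?thesis
    unfolding kernel_def path_count_add[OF u] by (simp add: sum_distrib_right sum_divide_distrib)
qed

lemma kernel_pos_iff: "u \<in> V \<Longrightarrow> v \<in> V \<Longrightarrow> kernel n u v > 0 \<longleftrightarrow> reach n u v"
proof -
  assume "u \<in> V" "v \<in> V"
  then have *: "r v > 0" "\<rho> ^ n * r u > 0" using r_pos rho_pos by auto
  have "kernel n u v > 0 \<longleftrightarrow> path_count n u v * r v > 0"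
    unfolding kernel_def using *(2) by (simp add: pos_less_divide_eq)
  also have "\<dots> \<longleftrightarrow> path_count n u v > 0"
    using *(1) by (auto simp: zero_less_mult_iff)
  finally show ?thesis unfolding path_count_pos_iff .
qed

text \<open>Doeblin's argument.  If every row of the \<open>K\<close>-step kernel has an entry of at least \<open>\<epsilon>\<close> at the common
place \<open>t\<close>, then \<open>K\<close> further steps move an average of the old values \<open>kernel n u t\<close>, \<open>u \<in> U\<close>, by the
proportion \<open>\<epsilon>\<close> towards the same number, so that their spread shrinks by the factor \<open>1 - \<epsilon>\<close>.\<close>

lemma kernel_contraction:
  assumes U: "U \<subseteq> V" and t: "t \<in> U"
    and closed: "\<And>u v. u \<in> U \<Longrightarrow> v \<in> V \<Longrightarrow> v \<notin> U \<Longrightarrow> kernel K u v = 0"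
    and eps: "\<And>u. u \<in> U \<Longrightarrow> \<epsilon> \<le> kernel K u t" and \<epsilon>1: "\<epsilon> < 1"
  shows "\<exists>lo. \<forall>u\<in>U. lo \<le> kernel (K * j + s) u t \<and> kernel (K * j + s) u t \<le> lo + (1 - \<epsilon>) ^ j"
proof (induction j)
  case 0
  have "0 \<le> kernel s u t \<and> kernel s u t \<le> 0 + 1" if "u \<in> U" for u
    using kernel_nonneg[of u t s] kernel_le_1[of u t s] that U t by auto
  then show ?case by (intro exI[of _ 0]) simp
next
  case (Suc j)
  let ?h = "\<lambda>u. kernel (K * j + s) u t" and ?w = "(1 - \<epsilon>) ^ j"
  from Suc obtain lo where lo0: "\<forall>u\<in>U. lo \<le> ?h u \<and> ?h u \<le> lo + ?w" by (elim exE)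
  then have lo: "\<And>u. u \<in> U \<Longrightarrow> lo \<le> ?h u" "\<And>u. u \<in> U \<Longrightarrow> ?h u \<le> lo + ?w" by auto
  have finU: "finite U" using U finite_V by (rule finite_subset)
  let ?lo = "(1 - \<epsilon>) * lo + \<epsilon> * ?h t"
  have "?lo \<le> kernel (K * Suc j + s) u t \<and> kernel (K * Suc j + s) u t \<le> ?lo + (1 - \<epsilon>) ^ Suc j"
    if u: "u \<in> U" for u
  proof -
    define q where "q v = kernel K u v - (if v = t then \<epsilon> else 0)" for v
    have uV: "u \<in> V" using u U by blast
    have q0: "q v \<ge> 0" if "v \<in> U" for v
      using eps[OF u] kernel_nonneg[of u v K] uV that U by (auto simp: q_def)
    have restrict: "(\<Sum>v\<in>V. kernel K u v * f v) = (\<Sum>v\<in>U. kernel K u v * f v)" for f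
      using U finite_V closed[OF u] by (intro sum.mono_neutral_right) auto
    have qs: "(\<Sum>v\<in>U. q v * f v) = (\<Sum>v\<in>U. kernel K u v * f v) - \<epsilon> * f t" for f
    proof -
      have "(\<Sum>v\<in>U. q v * f v) = (\<Sum>v\<in>U. kernel K u v * f v) - (\<Sum>v\<in>U. if v = t then \<epsilon> * f v else 0)"
        unfolding sum_subtractf[symmetric] by (intro sum.cong) (auto simp: q_def algebra_simps)
      then show ?thesis using finU t by (simp add: sum.delta)
    qed
    have qsum: "(\<Sum>v\<in>U. q v) = 1 - \<epsilon>"
      using qs[of "\<lambda>_. 1"] restrict[of "\<lambda>_. 1"] kernel_sum[OF uV, of K] by simp
    have "kernel (K * Suc j + s) u t = (\<Sum>v\<in>V. kernel K u v * ?h v)"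
      using kernel_add[OF uV, of K "K * j + s" t] by (simp add: algebra_simps)
    also have "\<dots> = (\<Sum>v\<in>U. q v * ?h v) + \<epsilon> * ?h t" using restrict[of ?h] qs[of ?h] by simp
    finally have eq: "kernel (K * Suc j + s) u t = (\<Sum>v\<in>U. q v * ?h v) + \<epsilon> * ?h t" .
    have "(\<Sum>v\<in>U. q v) * lo \<le> (\<Sum>v\<in>U. q v * ?h v)"
      unfolding sum_distrib_right using q0 lo(1) by (intro sum_mono mult_left_mono) auto
    moreover have "(\<Sum>v\<in>U. q v * ?h v) \<le> (\<Sum>v\<in>U. q v) * (lo + ?w)"
      unfolding sum_distrib_right using q0 lo(2) by (intro sum_mono mult_left_mono) auto
    ultimately show ?thesis unfolding eq qsum by (simp add: algebra_simps)
  qed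
  then show ?case by blast
qed

text \<open>If \<open>p\<close> does not divide \<open>n\<close> there are no closed paths.  If it does, replace each diagonal entry
\<open>kernel n t t\<close> by \<open>kernel n u t\<close> with \<open>u\<close> a fixed representative of the class of \<open>t\<close>, at
exponentially small cost.  The new entries sum to \<open>1\<close> over each of the \<open>p\<close> classes.\<close>

theorem trace_asymptotics:
  assumes b: "b \<in> V"
  defines "p \<equiv> return_period b"
  obtains C \<beta> where "0 < \<beta>" "\<beta> < \<rho>" "C > 0"
    "\<And>n. \<bar>(\<Sum>v\<in>V. path_count n v v) - (if p dvd n then real p * \<rho> ^ n else 0)\<bar> \<le> C * \<beta> ^ n"
proof -
  have p: "p > 0" using return_times_eventually[OF b] by (simp add: p_def)
  obtain c :: "'v \<Rightarrow> nat" and M where c: "\<And>v. c v < p"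
    "\<And>n u v. u \<in> V \<Longrightarrow> v \<in> V \<Longrightarrow> reach n u v \<Longrightarrow> [c u + n = c v] (mod p)"
    "\<And>j. j < p \<Longrightarrow> \<exists>v\<in>V. c v = j"
    and M: "\<And>m u v. m \<ge> M \<Longrightarrow> u \<in> V \<Longrightarrow> v \<in> V \<Longrightarrow> c u = c v \<Longrightarrow> reach (p * m) u v"
    by (rule cyclic_classes[OF b, folded p_def], rule that)
  \<comment> \<open>A positive multiple of the period after which any two states of the same class are joined.\<close>
  define K where "K = p * (M + 1)"
  have K: "K > 0" "p dvd K" using p by (simp_all add: K_def)
  define E where "E = (\<lambda>(u, v). kernel K u v) ` {(u, v) \<in> V \<times> V. c u = c v}"
  have finE: "finite E"
    unfolding E_def by (rule finite_imageI, rule finite_subset[of _ "V \<times> V"]) (use finite_V in auto)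
  have Epos: "x > 0" if "x \<in> E" for x
    using that M[of "M + 1"] kernel_pos_iff unfolding E_def K_def by auto
  \<comment> \<open>The bound \<open>1 / 2\<close> keeps the contraction factor \<open>1 - \<epsilon>\<close> positive.\<close>
  define \<epsilon> where "\<epsilon> = Min (insert (1/2) E)"
  have eps: "\<epsilon> > 0" "\<epsilon> \<le> 1/2"
  proof -
    show "\<epsilon> > 0" unfolding \<epsilon>_def using finE Epos by (subst Min_gr_iff) auto
    show "\<epsilon> \<le> 1/2" unfolding \<epsilon>_def using finE by (intro Min_le) auto
  qed
  have eps_le: "\<epsilon> \<le> kernel K u t" if "u \<in> V" "t \<in> V" "c u = c t" for u t
    unfolding \<epsilon>_def using finE that by (intro Min_le) (auto simp: E_def)
  have class0: "kernel n u v = 0" if "u \<in> V" "v \<in> V" "p dvd n" "c u \<noteq> c v" for n u v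
  proof (rule ccontr)
    assume "kernel n u v \<noteq> 0"
    then have "reach n u v" using kernel_pos_iff[OF that(1,2), of n] kernel_nonneg[OF that(1,2), of n] by simp
    from c(2)[OF that(1,2) this] have "[c u = c v] (mod p)"
      using that(3) by (auto simp: cong_def elim!: dvdE)
    then show False using c(1) that(4) by (simp add: cong_def)
  qed
  have osc: "\<bar>kernel n u t - kernel n u' t\<bar> \<le> (1 - \<epsilon>) ^ (n div K)"
    if "u \<in> V" "u' \<in> V" "t \<in> V" "c u = c t" "c u' = c t" for n u u' t
  proof -
    have "\<exists>lo. \<forall>u\<in>{u\<in>V. c u = c t}. lo \<le> kernel (K * (n div K) + n mod K) u t
        \<and> kernel (K * (n div K) + n mod K) u t \<le> lo + (1 - \<epsilon>) ^ (n div K)"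
      by (rule kernel_contraction) (use that K class0 eps eps_le in auto)
    then obtain lo where "\<forall>u\<in>{u\<in>V. c u = c t}. lo \<le> kernel n u t
        \<and> kernel n u t \<le> lo + (1 - \<epsilon>) ^ (n div K)" by auto
    then have "lo \<le> kernel n u t" "kernel n u t \<le> lo + (1 - \<epsilon>) ^ (n div K)"
      "lo \<le> kernel n u' t" "kernel n u' t \<le> lo + (1 - \<epsilon>) ^ (n div K)" using that by auto
    then show ?thesis by linarith
  qed
  have "\<forall>j. \<exists>v. j < p \<longrightarrow> v \<in> V \<and> c v = j" using c(3) by blast
  then obtain g where "\<forall>j. j < p \<longrightarrow> g j \<in> V \<and> c (g j) = j" by (rule exE[OF choice])
  then have g: "\<And>j. j < p \<Longrightarrow> g j \<in> V" "\<And>j. j < p \<Longrightarrow> c (g j) = j" by auto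
  have tr: "(\<Sum>v\<in>V. path_count n v v) = \<rho> ^ n * (\<Sum>v\<in>V. kernel n v v)" for n
  proof -
    have "path_count n v v = \<rho> ^ n * kernel n v v" if "v \<in> V" for v
      using r_pos[OF that] rho_pos by (simp add: kernel_def)
    then show ?thesis by (simp add: sum_distrib_left)
  qed
  obtain \<kappa> C where kC: "0 < \<kappa>" "\<kappa> < 1" "C > 0" "\<And>n. (1 - \<epsilon>) ^ (n div K) \<le> C * \<kappa> ^ n"
    using power_div_le_exponential[of "1 - \<epsilon>" K] eps K by auto
  have bound: "\<bar>(\<Sum>v\<in>V. kernel n v v) - (if p dvd n then real p else 0)\<bar> \<le> real (card V) * (C * \<kappa> ^ n)" for n
  proof (cases "p dvd n")
    case True
    have "(\<Sum>t\<in>V. kernel n (g (c t)) t) = (\<Sum>j<p. \<Sum>t\<in>{t\<in>V. c t = j}. kernel n (g (c t)) t)"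
      by (rule sum.group[symmetric]) (use finite_V c(1) in auto)
    also have "\<dots> = (\<Sum>j<p. \<Sum>t\<in>V. kernel n (g j) t)"
    proof (rule sum.cong[OF refl])
      fix j assume j: "j \<in> {..<p}"
      show "(\<Sum>t\<in>{t\<in>V. c t = j}. kernel n (g (c t)) t) = (\<Sum>t\<in>V. kernel n (g j) t)"
      proof (rule sum.mono_neutral_cong_left)
        show "\<forall>t\<in>V - {t\<in>V. c t = j}. kernel n (g j) t = 0"
          using class0[of "g j" _ n] g[of j] True j by auto
      qed (use finite_V in auto)
    qed
    also have "\<dots> = real p" using g(1) by (simp add: kernel_sum)
    finally have "(\<Sum>v\<in>V. kernel n v v) - real p = (\<Sum>t\<in>V. kernel n t t - kernel n (g (c t)) t)"
      by (simp add: sum_subtractf)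
    also have "\<bar>\<dots>\<bar> \<le> (\<Sum>t\<in>V. \<bar>kernel n t t - kernel n (g (c t)) t\<bar>)" by (rule sum_abs)
    also have "\<dots> \<le> (\<Sum>t\<in>V. C * \<kappa> ^ n)"
    proof (rule sum_mono)
      fix t assume t: "t \<in> V"
      have "\<bar>kernel n t t - kernel n (g (c t)) t\<bar> \<le> (1 - \<epsilon>) ^ (n div K)"
        using t g[OF c(1)[of t]] by (intro osc) auto
      then show "\<bar>kernel n t t - kernel n (g (c t)) t\<bar> \<le> C * \<kappa> ^ n"
        using kC(4)[of n] by linarith
    qed
    finally show ?thesis using True by simp
  next
    case False
    have "kernel n v v = 0" if "v \<in> V" for v
    proof (rule ccontr)
      assume "kernel n v v \<noteq> 0"
      then have "reach n v v" using kernel_pos_iff[OF that that, of n] kernel_nonneg[OF that that, of n] by simp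
      from c(2)[OF that that this] have "[c v + n = c v + 0] (mod p)" by simp
      then have "[n = 0] (mod p)" by (simp only: cong_add_lcancel_nat)
      then show False using False by (simp add: cong_0_iff)
    qed
    then show ?thesis using False kC by simp
  qed
  have V0: "card V > 0" using finite_V V_nonempty by (simp add: card_gt_0_iff)
  show thesis
  proof (rule that)
    show "0 < \<rho> * \<kappa>" "\<rho> * \<kappa> < \<rho>" using rho_pos kC by simp_all
    show "0 < real (card V) * C" using V0 kC by simp
    show "\<bar>(\<Sum>v\<in>V. path_count n v v) - (if p dvd n then real p * \<rho> ^ n else 0)\<bar> \<le> real (card V) * C * (\<rho> * \<kappa>) ^ n" for n
    proof -
      have "(\<Sum>v\<in>V. path_count n v v) - (if p dvd n then real p * \<rho> ^ n else 0)
        = \<rho> ^ n * ((\<Sum>v\<in>V. kernel n v v) - (if p dvd n then real p else 0))"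
        by (simp add: tr algebra_simps)
      then have "\<bar>(\<Sum>v\<in>V. path_count n v v) - (if p dvd n then real p * \<rho> ^ n else 0)\<bar>
        = \<rho> ^ n * \<bar>(\<Sum>v\<in>V. kernel n v v) - (if p dvd n then real p else 0)\<bar>"
        using rho_pos by (simp add: abs_mult)
      also have "\<dots> \<le> \<rho> ^ n * (real (card V) * (C * \<kappa> ^ n))"
        using bound rho_pos by (intro mult_left_mono) auto
      finally show ?thesis by (simp add: power_mult_distrib mult_ac)
    qed
  qed
qed

end

section \<open>Words that permute several states are rare\<close>

definition embeds :: "('v \<Rightarrow> 'a \<Rightarrow> 'v option) \<Rightarrow> 'v set \<Rightarrow> 'a list \<Rightarrow> bool" where
  "embeds \<delta> E w \<longleftrightarrow> (\<forall>u\<in>E. run \<delta> u w \<noteq> None) \<and> inj_on (\<lambda>u. run \<delta> u w) E"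

definition run_image :: "('v \<Rightarrow> 'a \<Rightarrow> 'v option) \<Rightarrow> 'v set \<Rightarrow> 'a list \<Rightarrow> 'v set" where
  "run_image \<delta> E w = (\<lambda>u. the (run \<delta> u w)) ` E"

lemma embeds_Nil [simp]: "embeds \<delta> E []"
  by (simp add: embeds_def inj_on_def)

lemma run_image_Nil [simp]: "run_image \<delta> E [] = E"
  by (simp add: run_image_def)

lemma embeds_append:
  "embeds \<delta> E (w @ w') \<longleftrightarrow> embeds \<delta> E w \<and> embeds \<delta> (run_image \<delta> E w) w'"
proof (cases "\<forall>u\<in>E. run \<delta> u w \<noteq> None")
  case True
  define f where "f u = the (run \<delta> u w)" for u
  have f: "run \<delta> u w = Some (f u)" if "u \<in> E" for u using True that by (auto simp: f_def)
  have im: "run_image \<delta> E w = f ` E" by (simp add: run_image_def f_def)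
  have a: "run \<delta> u (w @ w') = run \<delta> (f u) w'" if "u \<in> E" for u
    using f[OF that] by (simp add: run_append)
  have "inj_on (\<lambda>u. run \<delta> u (w @ w')) E \<longleftrightarrow> inj_on (\<lambda>u. run \<delta> (f u) w') E"
    using a by (intro inj_on_cong) auto
  also have "\<dots> \<longleftrightarrow> inj_on f E \<and> inj_on (\<lambda>v. run \<delta> v w') (f ` E)"
  proof -
    have "(\<lambda>u. run \<delta> (f u) w') = (\<lambda>v. run \<delta> v w') \<circ> f" by auto
    then show ?thesis using comp_inj_on[of f E "\<lambda>v. run \<delta> v w'"]
        inj_on_imageI[of "\<lambda>v. run \<delta> v w'" f E] inj_on_imageI2[of "\<lambda>v. run \<delta> v w'" f E] by metis
  qed
  also have "inj_on f E \<longleftrightarrow> inj_on (\<lambda>u. run \<delta> u w) E"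
    using f by (auto simp: inj_on_def)
  finally show ?thesis using True f a unfolding embeds_def im by auto
next
  case False
  then show ?thesis by (auto simp: embeds_def run_append)
qed

lemma run_image_append:
  assumes "embeds \<delta> E w"
  shows "run_image \<delta> E (w @ w') = run_image \<delta> (run_image \<delta> E w) w'"
proof -
  have "the (run \<delta> u (w @ w')) = the (run \<delta> (the (run \<delta> u w)) w')" if "u \<in> E" for u
    using assms that by (auto simp: embeds_def run_append)
  then show ?thesis unfolding run_image_def image_image by (intro image_cong refl)
qed

lemma embeds_inj: "embeds \<delta> E w \<Longrightarrow> inj_on (\<lambda>u. the (run \<delta> u w)) E"
proof (rule inj_onI)
  fix u v assume e: "embeds \<delta> E w" and uv: "u \<in> E" "v \<in> E" "the (run \<delta> u w) = the (run \<delta> v w)"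
  then have "run \<delta> u w = run \<delta> v w" unfolding embeds_def by (intro option.expand) auto
  then show "u = v" using e uv unfolding embeds_def inj_on_def by blast
qed

lemma card_run_image: "embeds \<delta> E w \<Longrightarrow> card (run_image \<delta> E w) = card E"
  unfolding run_image_def by (intro card_image embeds_inj)

context automaton
begin

lemma run_image_subset: "E \<subseteq> V \<Longrightarrow> embeds \<delta> E w \<Longrightarrow> run_image \<delta> E w \<subseteq> V"
  unfolding run_image_def embeds_def using run_in_V by (auto dest: subsetD)

definition cyclic_word :: "'a list \<Rightarrow> bool" where
  "cyclic_word w \<longleftrightarrow> (\<exists>E\<subseteq>V. E \<noteq> {} \<and> embeds \<delta> E w \<and> run_image \<delta> E w = E)"

end

locale synchronized_automaton = perron_automaton V S \<delta> \<rho> r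
  for V :: "'v set" and S :: "'a set" and \<delta> :: "'v \<Rightarrow> 'a \<Rightarrow> 'v option"
    and \<rho> :: real and r :: "'v \<Rightarrow> real" +
  assumes sync: "\<exists>m s z. s \<in> V \<and> run \<delta> s m = Some z \<and> (\<forall>t\<in>V. run \<delta> t m \<in> {None, Some z})"
begin

text \<open>Lead \<open>v\<close> to a state where the synchronizing word can be read, and read it: whatever survives of
\<open>E\<close> ends in a single state.\<close>

lemma collapsing_word:
  assumes "v \<in> V"
  shows "\<exists>w. run \<delta> v w \<noteq> None \<and> (\<forall>E\<subseteq>V. card E \<ge> 2 \<longrightarrow> \<not> embeds \<delta> E w)"
proof -
  obtain m s z where m: "s \<in> V" "run \<delta> s m = Some z" "\<And>t. t \<in> V \<Longrightarrow> run \<delta> t m \<in> {None, Some z}"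
    using sync by blast
  obtain x where x: "run \<delta> v x = Some s" using connected[OF assms m(1)] by blast
  have bad: "\<not> embeds \<delta> E m" if E: "E \<subseteq> V" "card E \<ge> 2" for E
  proof
    assume e: "embeds \<delta> E m"
    have "E \<noteq> {}" using E(2) by auto
    then obtain u where u: "u \<in> E" by blast
    have all: "run \<delta> t m = Some z" if "t \<in> E" for t
      using m(3)[of t] E(1) e that unfolding embeds_def by auto
    have "t = u" if "t \<in> E" for t
      using e all[OF that] all[OF u] that u unfolding embeds_def inj_on_def by auto
    then have "E \<subseteq> {u}" by blast
    then have "card E \<le> card {u}" by (intro card_mono) auto
    then show False using E(2) by simp
  qed
  have "\<not> embeds \<delta> E (x @ m)" if E: "E \<subseteq> V" "card E \<ge> 2" for E
  proof
    assume "embeds \<delta> E (x @ m)"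
    then have e: "embeds \<delta> E x" "embeds \<delta> (run_image \<delta> E x) m" by (simp_all add: embeds_append)
    show False using bad[OF run_image_subset[OF E(1) e(1)]] e(2) card_run_image[OF e(1)] E(2) by simp
  qed
  moreover have "run \<delta> v (x @ m) \<noteq> None" using x m(2) by (simp add: run_append)
  ultimately show ?thesis by blast
qed

lemma collapsing_length:
  "\<exists>K>0. \<forall>v\<in>V. \<exists>w\<in>words S K. run \<delta> v w \<noteq> None \<and> (\<forall>E\<subseteq>V. card E \<ge> 2 \<longrightarrow> \<not> embeds \<delta> E w)"
proof -
  have "\<forall>v\<in>V. \<exists>w. run \<delta> v w \<noteq> None \<and> (\<forall>E\<subseteq>V. card E \<ge> 2 \<longrightarrow> \<not> embeds \<delta> E w)"
    using collapsing_word by blast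
  then obtain f where f: "\<forall>v\<in>V. run \<delta> v (f v) \<noteq> None \<and> (\<forall>E\<subseteq>V. card E \<ge> 2 \<longrightarrow> \<not> embeds \<delta> E (f v))"
    unfolding bchoice_iff by (elim exE)
  define K where "K = Suc (Max ((\<lambda>v. length (f v)) ` V))"
  have len: "length (f v) \<le> K" if "v \<in> V" for v
    unfolding K_def using finite_V that by (intro le_SucI Max_ge) auto
  have "\<exists>w\<in>words S K. run \<delta> v w \<noteq> None \<and> (\<forall>E\<subseteq>V. card E \<ge> 2 \<longrightarrow> \<not> embeds \<delta> E w)" if v: "v \<in> V" for v
  proof -
    obtain u where u: "run \<delta> v (f v) = Some u" using f v by blast
    have uV: "u \<in> V" using run_in_V[OF u v] .
    have ext: "\<exists>y. length y = n \<and> run \<delta> u y \<noteq> None" if "u \<in> V" for n u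
      using that
    proof (induction n arbitrary: u)
      case (Suc n)
      obtain a t where t: "\<delta> u a = Some t" using out_step[OF Suc.prems] by blast
      then have "t \<in> V" using step by blast
      from Suc.IH[OF this] obtain y where y: "length y = n" "run \<delta> t y \<noteq> None" by blast
      then show ?case using t by (intro exI[of _ "a # y"]) simp
    qed simp
    from ext[OF uV, of "K - length (f v)"]
    obtain y where y: "length y = K - length (f v)" "run \<delta> u y \<noteq> None" by blast
    have rn: "run \<delta> v (f v @ y) \<noteq> None" using u y(2) by (simp add: run_append)
    then obtain t where "run \<delta> v (f v @ y) = Some t" by blast
    then have "set (f v @ y) \<subseteq> S" by (rule run_letters)
    then have "f v @ y \<in> words S K" using y(1) len[OF v] by (simp add: words_def)
    moreover have "\<not> embeds \<delta> E (f v @ y)" if "E \<subseteq> V" "card E \<ge> 2" for E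
    proof -
      have "\<not> embeds \<delta> E (f v)" using f v that by blast
      then show ?thesis by (simp add: embeds_append)
    qed
    ultimately show ?thesis using rn by (intro bexI[of _ "f v @ y"] conjI allI impI)
  qed
  then show ?thesis by (intro exI[of _ K]) (simp add: K_def)
qed

text \<open>Words starting at \<open>v\<close>, weighted with the eigenvector at their end, have total weight
\<open>\<rho> ^ n * r v\<close>.  In each block of length \<open>K\<close> at least one of them collapses \<open>E\<close>, which costs a fixed
proportion of the weight; the remaining ones lead to a set of the same size, so that the argument can be
repeated.\<close>

lemma embedding_weight_decay:
  obtains K \<theta> where "K > 0" "0 < \<theta>" "\<theta> < 1"
    "\<And>E v j s. E \<subseteq> V \<Longrightarrow> card E \<ge> 2 \<Longrightarrow> v \<in> E \<Longrightarrow>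
      (\<Sum>w\<in>words S (K * j + s). if embeds \<delta> E w then r (the (run \<delta> v w)) else 0)
        \<le> \<theta> ^ j * (\<rho> ^ (K * j + s) * r v)"
proof -
  obtain K where K: "K > 0" "\<And>v. v \<in> V \<Longrightarrow> \<exists>w\<in>words S K. run \<delta> v w \<noteq> None \<and>
      (\<forall>E\<subseteq>V. card E \<ge> 2 \<longrightarrow> \<not> embeds \<delta> E w)" using collapsing_length by blast
  obtain a b where ab: "a > 0" "b > 0" "\<And>v. v \<in> V \<Longrightarrow> a \<le> r v" "\<And>v. v \<in> V \<Longrightarrow> r v \<le> b"
    using r_bounds by blast
  \<comment> \<open>One lost word carries weight at least \<open>a\<close>, out of a total of at most \<open>\<rho> ^ K * b\<close>.\<close>
  define d where "d = min (1/2) (a / (\<rho> ^ K * b))"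
  have d: "d > 0" "d \<le> 1/2" "d * (\<rho> ^ K * b) \<le> a"
  proof -
    have pos: "\<rho> ^ K * b > 0" using rho_pos ab by simp
    then show "d > 0" unfolding d_def using ab by simp
    show "d \<le> 1/2" unfolding d_def by (rule min.cobounded1)
    have "d \<le> a / (\<rho> ^ K * b)" unfolding d_def by simp
    then show "d * (\<rho> ^ K * b) \<le> a" using pos by (simp add: pos_le_divide_eq)
  qed
  let ?R = "\<lambda>v w. case run \<delta> v w of None \<Rightarrow> 0 | Some u \<Rightarrow> r u"
  have R0: "?R v w \<ge> 0" if "v \<in> V" for v w
    using run_in_V[of v w] r_pos that by (auto split: option.splits intro: less_imp_le)
  have emb_le: "(if embeds \<delta> E w then r (the (run \<delta> v w)) else 0) \<le> ?R v w"
    if "E \<subseteq> V" "v \<in> E" for E v w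
    using that R0[of v w] by (auto simp: embeds_def split: option.splits)
  have main: "(\<Sum>w\<in>words S (K * j + s). if embeds \<delta> E w then r (the (run \<delta> v w)) else 0)
      \<le> (1 - d) ^ j * (\<rho> ^ (K * j + s) * r v)" if "E \<subseteq> V" "card E \<ge> 2" "v \<in> E" for E v j s
    using that
  proof (induction j arbitrary: E v)
    case 0
    have "(\<Sum>w\<in>words S s. if embeds \<delta> E w then r (the (run \<delta> v w)) else 0) \<le> (\<Sum>w\<in>words S s. ?R v w)"
      by (rule sum_mono) (rule emb_le[OF 0(1) 0(3)])
    also have "\<dots> = \<rho> ^ s * r v" by (rule sum_run_eigen) (rule subsetD[OF 0(1) 0(3)])
    finally show ?case by simp
  next
    case (Suc j)
    let ?n = "K * j + s" and ?c = "(1 - d) ^ j * \<rho> ^ (K * j + s)"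
    have vV: "v \<in> V" using Suc.prems by blast
    have c0: "?c \<ge> 0" using d rho_pos by simp
    have "(\<Sum>w\<in>words S (K * Suc j + s). if embeds \<delta> E w then r (the (run \<delta> v w)) else 0)
      = (\<Sum>w\<in>words S (K + ?n). if embeds \<delta> E w then r (the (run \<delta> v w)) else 0)"
      by (simp add: algebra_simps)
    also have "\<dots> = (\<Sum>x\<in>words S K. \<Sum>y\<in>words S ?n. if embeds \<delta> E (x @ y) then r (the (run \<delta> v (x @ y))) else 0)"
      by (rule sum_words_add)
    also have "\<dots> \<le> (\<Sum>x\<in>words S K. ?c * (if embeds \<delta> E x then r (the (run \<delta> v x)) else 0))"
    proof (rule sum_mono)
      fix x
      show "(\<Sum>y\<in>words S ?n. if embeds \<delta> E (x @ y) then r (the (run \<delta> v (x @ y))) else 0)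
        \<le> ?c * (if embeds \<delta> E x then r (the (run \<delta> v x)) else 0)"
      proof (cases "embeds \<delta> E x")
        case True
        then obtain u where u: "run \<delta> v x = Some u" using Suc.prems(3) unfolding embeds_def by blast
        have "(\<Sum>y\<in>words S ?n. if embeds \<delta> E (x @ y) then r (the (run \<delta> v (x @ y))) else 0)
          = (\<Sum>y\<in>words S ?n. if embeds \<delta> (run_image \<delta> E x) y then r (the (run \<delta> u y)) else 0)"
        proof -
          have rx: "run \<delta> v (x @ y) = run \<delta> u y" for y using u by (simp add: run_append)
          show ?thesis unfolding embeds_append rx using True by simp
        qed
        also have "\<dots> \<le> (1 - d) ^ j * (\<rho> ^ ?n * r u)"
        proof (rule Suc.IH)
          show "run_image \<delta> E x \<subseteq> V" using run_image_subset[OF Suc.prems(1) True] .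
          show "card (run_image \<delta> E x) \<ge> 2" using card_run_image[OF True] Suc.prems(2) by simp
          show "u \<in> run_image \<delta> E x" using u Suc.prems(3) unfolding run_image_def by force
        qed
        finally show ?thesis using True u by (simp add: mult.assoc)
      next
        case False
        then show ?thesis by (simp add: embeds_append)
      qed
    qed
    also have "\<dots> = ?c * (\<Sum>x\<in>words S K. if embeds \<delta> E x then r (the (run \<delta> v x)) else 0)"
      by (simp only: sum_distrib_left)
    also have "\<dots> \<le> ?c * (\<rho> ^ K * r v - a)"
    proof (rule mult_left_mono[OF _ c0])
      from K(2)[OF vV] obtain w where w0: "w \<in> words S K" "run \<delta> v w \<noteq> None"
        "\<forall>E\<subseteq>V. card E \<ge> 2 \<longrightarrow> \<not> embeds \<delta> E w" by (elim bexE conjE)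
      from w0(2) obtain u where "run \<delta> v w = Some u" by blast
      with w0 Suc.prems have w: "w \<in> words S K" "run \<delta> v w = Some u" "\<not> embeds \<delta> E w" by simp_all
      have fin: "finite (words S K)" by (rule finite_words[OF finite_S])
      have "(\<Sum>x\<in>words S K. if embeds \<delta> E x then r (the (run \<delta> v x)) else 0)
        = (\<Sum>x\<in>words S K - {w}. if embeds \<delta> E x then r (the (run \<delta> v x)) else 0)"
        using w fin by (subst sum.remove[of _ w]) auto
      also have "\<dots> \<le> (\<Sum>x\<in>words S K - {w}. ?R v x)"
        by (rule sum_mono) (rule emb_le[OF Suc.prems(1) Suc.prems(3)])
      also have "\<dots> = (\<Sum>x\<in>words S K. ?R v x) - r u"
        using w fin by (simp add: sum.remove[of _ w])
      also have "\<dots> \<le> \<rho> ^ K * r v - a"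
        using sum_run_eigen[OF vV, of K] ab(3)[OF run_in_V[OF w(2) vV]] by simp
      finally show "(\<Sum>x\<in>words S K. if embeds \<delta> E x then r (the (run \<delta> v x)) else 0) \<le> \<rho> ^ K * r v - a" .
    qed
    also have "\<dots> \<le> ?c * ((1 - d) * (\<rho> ^ K * r v))"
    proof (rule mult_left_mono[OF _ c0])
      have "d * (\<rho> ^ K * r v) \<le> d * (\<rho> ^ K * b)"
        using d rho_pos ab(4)[OF vV] by (intro mult_left_mono) auto
      then have "d * (\<rho> ^ K * r v) \<le> a" using d(3) by linarith
      then show "\<rho> ^ K * r v - a \<le> (1 - d) * (\<rho> ^ K * r v)" by (simp add: algebra_simps)
    qed
    also have "\<dots> = (1 - d) ^ Suc j * (\<rho> ^ (K * Suc j + s) * r v)"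
      by (simp add: power_add mult_ac)
    finally show ?case .
  qed
  show thesis by (rule that[of K "1 - d"]) (use K d main in auto)
qed

lemma embedding_count_bound:
  obtains C \<beta> where "0 < \<beta>" "\<beta> < \<rho>" "C > 0"
    "\<And>E n. E \<subseteq> V \<Longrightarrow> card E \<ge> 2 \<Longrightarrow> real (card {w\<in>words S n. embeds \<delta> E w}) \<le> C * \<beta> ^ n"
proof -
  obtain K \<theta> where K: "K > 0" "0 < \<theta>" "\<theta> < 1" and decay:
    "\<And>E v j s. E \<subseteq> V \<Longrightarrow> card E \<ge> 2 \<Longrightarrow> v \<in> E \<Longrightarrow>
      (\<Sum>w\<in>words S (K * j + s). if embeds \<delta> E w then r (the (run \<delta> v w)) else 0)
        \<le> \<theta> ^ j * (\<rho> ^ (K * j + s) * r v)"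
    by (rule embedding_weight_decay, rule that)
  obtain \<kappa> C where kC: "0 < \<kappa>" "\<kappa> < 1" "C > 0" "\<And>n. \<theta> ^ (n div K) \<le> C * \<kappa> ^ n"
    by (rule power_div_le_exponential[OF K(2,3,1)], rule that)
  obtain a b where ab: "a > 0" "b > 0" "\<And>v. v \<in> V \<Longrightarrow> a \<le> r v" "\<And>v. v \<in> V \<Longrightarrow> r v \<le> b"
    using r_bounds by blast
  show thesis
  proof (rule that)
    show "0 < \<rho> * \<kappa>" "\<rho> * \<kappa> < \<rho>" "C * b / a > 0" using rho_pos kC ab by simp_all
    fix E n assume E: "E \<subseteq> V" "card E \<ge> 2"
    then have "E \<noteq> {}" by auto
    then obtain v where v: "v \<in> E" by blast
    have vV: "v \<in> V" using v E by blast
    have "real (card {w\<in>words S n. embeds \<delta> E w}) * a = (\<Sum>w\<in>words S n. if embeds \<delta> E w then a else 0)"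
      using finite_words[OF finite_S] by (simp add: sum.If_cases Int_def)
    also have "\<dots> \<le> (\<Sum>w\<in>words S n. if embeds \<delta> E w then r (the (run \<delta> v w)) else 0)"
    proof (rule sum_mono)
      fix w
      have "a \<le> r (the (run \<delta> v w))" if e: "embeds \<delta> E w"
      proof -
        obtain u where u: "run \<delta> v w = Some u" using e v unfolding embeds_def by blast
        show ?thesis using ab(3)[OF run_in_V[OF u vV]] u by simp
      qed
      then show "(if embeds \<delta> E w then a else 0) \<le> (if embeds \<delta> E w then r (the (run \<delta> v w)) else 0)" by simp
    qed
    also have "\<dots> \<le> \<theta> ^ (n div K) * (\<rho> ^ n * r v)"
      using decay[OF E v, of "n div K" "n mod K"] by simp
    also have "\<dots> \<le> (C * \<kappa> ^ n) * (\<rho> ^ n * b)"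
      using kC rho_pos ab(4)[OF vV] r_pos[OF vV] by (intro mult_mono) auto
    also have "\<dots> = C * b * (\<rho> * \<kappa>) ^ n" by (simp add: power_mult_distrib mult_ac)
    finally show "real (card {w\<in>words S n. embeds \<delta> E w}) \<le> C * b / a * (\<rho> * \<kappa>) ^ n"
      using ab(1) by (simp add: pos_le_divide_eq)
  qed
qed

text \<open>For a word that embeds no set of two or more states, being cyclic and having a fixed state are the
same, and there is at most one fixed state.\<close>

lemma fixed_states_cyclic_difference:
  "\<bar>(if cyclic_word w then 1 else 0) - real (card {v\<in>V. run \<delta> v w = Some v})\<bar>
     \<le> real (card V) * (\<Sum>E | E \<subseteq> V \<and> card E \<ge> 2. if embeds \<delta> E w then 1 else 0)"
proof -
  let ?F = "{v\<in>V. run \<delta> v w = Some v}" and ?D = "\<Sum>E | E \<subseteq> V \<and> card E \<ge> 2. if embeds \<delta> E w then 1 else (0::real)"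
  have fin: "finite {E. E \<subseteq> V \<and> card E \<ge> 2}"
    by (rule finite_subset[of _ "Pow V"]) (use finite_V in auto)
  have D: "?D \<ge> 1" if "E \<subseteq> V" "card E \<ge> 2" "embeds \<delta> E w" for E
  proof -
    have "(if embeds \<delta> E w then 1 else (0::real)) \<le> ?D"
      using fin that by (intro member_le_sum) auto
    then show ?thesis using that by simp
  qed
  have D0: "?D \<ge> 0" by (intro sum_nonneg) auto
  have FV: "card ?F \<le> card V" using finite_V by (intro card_mono) auto
  have V1: "card V \<ge> 1" using finite_V V_nonempty by (simp add: Suc_le_eq card_gt_0_iff)
  have fix_emb: "embeds \<delta> ?F w" "run_image \<delta> ?F w = ?F"
    by (auto simp: embeds_def inj_on_def run_image_def)
  consider "cyclic_word w" "card ?F = 1" | "card ?F = 0" "\<not> cyclic_word w"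
    | E where "E \<subseteq> V" "card E \<ge> 2" "embeds \<delta> E w"
  proof (cases "card ?F \<ge> 2")
    case True
    then show thesis using that(3)[of ?F] fix_emb by simp
  next
    case False
    show thesis
    proof (cases "card ?F = 1")
      case True
      then have "?F \<noteq> {}" by force
      then have "cyclic_word w" unfolding cyclic_word_def using fix_emb by (intro exI[of _ ?F]) blast
      then show thesis using that(1) True by simp
    next
      case F1: False
      then have F0: "card ?F = 0" using False by simp
      then have Fe: "?F = {}" using finite_V by simp
      show thesis
      proof (cases "cyclic_word w")
        case True
        then obtain E where E: "E \<subseteq> V" "E \<noteq> {}" "embeds \<delta> E w" "run_image \<delta> E w = E"
          unfolding cyclic_word_def by blast
        have finE: "finite E" using E(1) finite_V by (rule finite_subset)
        have "card E \<noteq> 0" using E finE by simp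
        moreover have "card E \<noteq> 1"
        proof
          assume "card E = 1"
          then obtain v where v: "E = {v}" by (rule card_1_singletonE)
          then have "run \<delta> v w \<noteq> None" "the (run \<delta> v w) = v"
            using E(3,4) by (auto simp: embeds_def run_image_def)
          then have "v \<in> ?F" using E(1) v by auto
          then show False using Fe by blast
        qed
        ultimately have "card E \<ge> 2" by linarith
        then show thesis using that(3) E by blast
      next
        case F: False
        show thesis by (rule that(2)[OF F0 F])
      qed
    qed
  qed
  then show ?thesis
  proof cases
    case 3
    have "\<bar>(if cyclic_word w then 1 else 0) - real (card ?F)\<bar> \<le> real (card V)" using FV V1 by auto
    also have "\<dots> \<le> real (card V) * ?D" using D[OF 3] mult_left_mono[OF D[OF 3], of "real (card V)"] by simp
    finally show ?thesis .
  qed (use D0 in auto)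
qed

theorem cyclic_word_asymptotics:
  assumes b: "b \<in> V"
  defines "p \<equiv> return_period b"
  obtains C \<beta> where "0 < \<beta>" "\<beta> < \<rho>" "C > 0"
    "\<And>n. \<bar>real (card {w\<in>words S n. cyclic_word w}) - (if p dvd n then real p * \<rho> ^ n else 0)\<bar> \<le> C * \<beta> ^ n"
proof -
  obtain C1 \<beta>1 where 1: "0 < \<beta>1" "\<beta>1 < \<rho>" "C1 > 0"
    "\<And>n. \<bar>(\<Sum>v\<in>V. path_count n v v) - (if p dvd n then real p * \<rho> ^ n else 0)\<bar> \<le> C1 * \<beta>1 ^ n"
    by (rule trace_asymptotics[OF b, folded p_def], rule that)
  obtain C2 \<beta>2 where 2: "0 < \<beta>2" "\<beta>2 < \<rho>" "C2 > 0"
    "\<And>E n. E \<subseteq> V \<Longrightarrow> card E \<ge> 2 \<Longrightarrow> real (card {w\<in>words S n. embeds \<delta> E w}) \<le> C2 * \<beta>2 ^ n"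
    by (rule embedding_count_bound, rule that)
  define m where "m = real (card V) * real (card {E. E \<subseteq> V \<and> card E \<ge> 2})"
  define \<beta> where "\<beta> = max \<beta>1 \<beta>2"
  have \<beta>: "0 < \<beta>" "\<beta> < \<rho>" "\<beta>1 ^ n \<le> \<beta> ^ n" "\<beta>2 ^ n \<le> \<beta> ^ n" for n
    using 1 2 by (auto simp: \<beta>_def intro!: power_mono)
  have finw: "finite (words S n)" for n by (rule finite_words[OF finite_S])
  have diff: "\<bar>real (card {w\<in>words S n. cyclic_word w}) - (\<Sum>v\<in>V. path_count n v v)\<bar> \<le> m * (C2 * \<beta>2 ^ n)" for n
  proof -
    have "(\<Sum>v\<in>V. path_count n v v) = (\<Sum>w\<in>words S n. \<Sum>v\<in>V. if run \<delta> v w = Some v then 1 else 0)"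
      unfolding path_count_def by (rule sum.swap)
    also have "\<dots> = (\<Sum>w\<in>words S n. real (card {v\<in>V. run \<delta> v w = Some v}))"
      using finite_V by (simp add: sum.If_cases Int_def)
    finally have tr: "(\<Sum>v\<in>V. path_count n v v) = (\<Sum>w\<in>words S n. real (card {v\<in>V. run \<delta> v w = Some v}))" .
    have cy: "real (card {w\<in>words S n. cyclic_word w}) = (\<Sum>w\<in>words S n. if cyclic_word w then 1 else 0)"
      using finw by (simp add: sum.If_cases Int_def)
    have "\<bar>real (card {w\<in>words S n. cyclic_word w}) - (\<Sum>v\<in>V. path_count n v v)\<bar>
      \<le> (\<Sum>w\<in>words S n. \<bar>(if cyclic_word w then 1 else 0) - real (card {v\<in>V. run \<delta> v w = Some v})\<bar>)"
      unfolding tr cy sum_subtractf[symmetric] by (rule sum_abs)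
    also have "\<dots> \<le> (\<Sum>w\<in>words S n. real (card V) * (\<Sum>E | E \<subseteq> V \<and> card E \<ge> 2. if embeds \<delta> E w then 1 else 0))"
      by (intro sum_mono fixed_states_cyclic_difference)
    also have "\<dots> = real (card V) * (\<Sum>E | E \<subseteq> V \<and> card E \<ge> 2. \<Sum>w\<in>words S n. if embeds \<delta> E w then 1 else 0)"
      by (subst sum.swap) (simp add: sum_distrib_left)
    also have "\<dots> = real (card V) * (\<Sum>E | E \<subseteq> V \<and> card E \<ge> 2. real (card {w\<in>words S n. embeds \<delta> E w}))"
      using finw by (simp add: sum.If_cases Int_def)
    also have "\<dots> \<le> real (card V) * (\<Sum>E | E \<subseteq> V \<and> card E \<ge> 2. C2 * \<beta>2 ^ n)"
      using 2 by (intro mult_left_mono sum_mono) auto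
    finally show ?thesis by (simp add: m_def mult.assoc)
  qed
  have m0: "m \<ge> 0" by (simp add: m_def)
  show thesis
  proof (rule that)
    show "0 < \<beta>" "\<beta> < \<rho>" by fact+
    show "C1 + m * C2 > 0" using 1 2 m0 by (simp add: add_pos_nonneg)
    show "\<bar>real (card {w\<in>words S n. cyclic_word w}) - (if p dvd n then real p * \<rho> ^ n else 0)\<bar> \<le> (C1 + m * C2) * \<beta> ^ n" for n
    proof -
      have "m * (C2 * \<beta>2 ^ n) \<le> m * (C2 * \<beta> ^ n)" "C1 * \<beta>1 ^ n \<le> C1 * \<beta> ^ n"
        using m0 1 2 \<beta>(3,4)[of n] by (auto intro!: mult_left_mono)
      then have "m * (C2 * \<beta>2 ^ n) + C1 * \<beta>1 ^ n \<le> (C1 + m * C2) * \<beta> ^ n"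
        by (simp add: algebra_simps)
      then show ?thesis using diff[of n] 1(4)[of n] by linarith
    qed
  qed
qed

end

section \<open>Periodic points and cyclic words\<close>

lemma funpow_shift_map: "(shift_map ^^ n) x = (\<lambda>k. x (k + int n))"
  by (induction n) (auto simp: shift_map_def add_ac)

lemma periodic_mod:
  fixes x :: "int \<Rightarrow> 'a"
  assumes "(shift_map ^^ n) x = x"
  shows "x (k mod int n) = x k"
proof -
  have p: "x (k + int n) = x k" for k
    using fun_cong[OF assms, of k] by (simp add: funpow_shift_map)
  have "x (k + int n * int j) = x k" for k j
  proof (induction j)
    case (Suc j)
    have "x (k + int n * int (Suc j)) = x ((k + int n * int j) + int n)" by (simp add: algebra_simps)
    then show ?case using p Suc by simp
  qed simp
  then have nn: "x (k + int n * j) = x k" if "j \<ge> 0" for k j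
    using that by (metis zero_le_imp_eq_int)
  have "x (k + int n * j) = x k" for k j
  proof (cases "j \<ge> 0")
    case False
    then have "x ((k + int n * j) + int n * (- j)) = x (k + int n * j)" by (intro nn) simp
    then show ?thesis by simp
  qed (use nn in simp)
  from this[of "k mod int n" "k div int n"] show ?thesis by (simp add: add.commute)
qed

lemma block_periodic:
  assumes "(shift_map ^^ n) x = x"
  shows "block x (int n * j) m = block x 0 m"
proof -
  have "x (int n * j + i) = x i" for i
    using periodic_mod[OF assms, of "int n * j + i"] periodic_mod[OF assms, of i] by simp
  then show ?thesis by (simp add: block_def)
qed

context automaton
begin

text \<open>The states reached after multiples of \<open>n\<close> steps repeat; the states between two repetitions form a
set permuted by the block.\<close>

lemma periodic_block_cyclic:
  assumes x: "x \<in> aut_shift \<delta>" and per: "(shift_map ^^ n) x = x"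
  shows "cyclic_word (block x 0 n)"
proof -
  let ?w = "block x 0 n"
  obtain q where q: "\<forall>t. \<delta> (q t) (x t) = Some (q (t + 1))" using x unfolding aut_shift_def by blast
  have qV: "q t \<in> V" for t using step q by blast
  define v where "v j = q (int n * int j)" for j :: nat
  have v_step: "run \<delta> (v j) ?w = Some (v (Suc j))" for j
  proof -
    have "run \<delta> (q (int n * int j)) (block x (int n * int j) n) = Some (q (int n * int j + int n))"
      by (rule run_block[where \<delta>=\<delta> and q=q and x=x, OF q])
    then show ?thesis unfolding block_periodic[OF per] v_def by (simp add: algebra_simps)
  qed
  have "\<not> inj v"
  proof
    assume "inj v"
    moreover have "finite (range v)"
      by (rule finite_subset[OF _ finite_V]) (use qV in \<open>auto simp: v_def\<close>)
    ultimately show False using finite_imageD infinite_UNIV_nat by blast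
  qed
  then obtain i0 j0 where "v i0 = v j0" "i0 \<noteq> j0" unfolding inj_def by blast
  then obtain i j where ij: "i < j" "v i = v j" by (metis nat_neq_iff)
  define E where "E = v ` {i..<j}"
  have im: "run_image \<delta> E ?w = E"
  proof -
    have "run_image \<delta> E ?w = v ` (Suc ` {i..<j})"
      unfolding run_image_def E_def image_image using v_step by simp
    also have "Suc ` {i..<j} = {Suc i..<j} \<union> {j}"
      using ij(1) by (simp add: image_Suc_atLeastLessThan) (auto)
    also have "v ` ({Suc i..<j} \<union> {j}) = v ` ({Suc i..<j} \<union> {i})" using ij(2) by simp
    also have "{Suc i..<j} \<union> {i} = {i..<j}" using ij(1) by auto
    finally show ?thesis unfolding E_def .
  qed
  have "embeds \<delta> E ?w"
    unfolding embeds_def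
  proof
    show "\<forall>u\<in>E. run \<delta> u ?w \<noteq> None" unfolding E_def using v_step by auto
    have "finite E" unfolding E_def by simp
    then have "inj_on (\<lambda>u. the (run \<delta> u ?w)) E"
      using im unfolding run_image_def by (intro eq_card_imp_inj_on) auto
    then show "inj_on (\<lambda>u. run \<delta> u ?w) E" unfolding inj_on_def by metis
  qed
  moreover have "E \<subseteq> V" "E \<noteq> {}" using qV ij(1) by (auto simp: E_def v_def)
  ultimately show ?thesis using im unfolding cyclic_word_def by blast
qed

text \<open>On a set \<open>E\<close> permuted by \<open>w\<close> the action can be iterated in both directions, which supplies the
states at all multiples of \<open>n\<close>; the prefixes of \<open>w\<close> supply those in between.\<close>

lemma cyclic_word_periodic_point:
  assumes w: "cyclic_word w" and n: "length w = n" "n > 0"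
  shows "\<exists>x\<in>aut_shift \<delta>. (shift_map ^^ n) x = x \<and> block x 0 n = w"
proof -
  obtain E where E: "E \<subseteq> V" "E \<noteq> {}" "embeds \<delta> E w" "run_image \<delta> E w = E"
    using w unfolding cyclic_word_def by blast
  define f where "f u = the (run \<delta> u w)" for u
  have f: "run \<delta> u w = Some (f u)" if "u \<in> E" for u
    using E(3) that unfolding embeds_def f_def by auto
  have fE: "f ` E = E" using E(4) by (simp add: run_image_def f_def)
  define g where "g = inv_into E f"
  have g: "g u \<in> E" "f (g u) = u" if "u \<in> E" for u
    using inv_into_into[of u f E] f_inv_into_f[of u f E] that fE by (auto simp: g_def)
  obtain e0 where e0: "e0 \<in> E" using E(2) by blast
  define v where "v j = (if j \<ge> 0 then (f ^^ nat j) e0 else (g ^^ nat (- j)) e0)" for j :: int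
  have fp: "(f ^^ i) e0 \<in> E" for i using e0 fE by (induction i) auto
  have gp: "(g ^^ i) e0 \<in> E" for i using e0 g by (induction i) auto
  have vE: "v j \<in> E" for j using fp gp by (simp add: v_def)
  have v_step: "f (v j) = v (j + 1)" for j
  proof (cases "j \<ge> 0")
    case True
    then show ?thesis by (simp add: v_def nat_add_distrib)
  next
    case False
    then obtain i where i: "j = - int (Suc i)" by (metis int_cases not_less of_nat_0_le_iff linorder_not_less)
    have "f (v j) = f (g ((g ^^ i) e0))" by (simp add: i v_def nat_add_distrib)
    also have "\<dots> = (g ^^ i) e0" using g gp by simp
    also have "\<dots> = v (j + 1)"
    proof -
      have "j + 1 = - int i" using i by simp
      then show ?thesis by (cases "i = 0") (simp_all add: v_def)
    qed
    finally show ?thesis .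
  qed
  define x where "x t = w ! nat (t mod int n)" for t
  define q where "q t = the (run \<delta> (v (t div int n)) (take (nat (t mod int n)) w))" for t
  have tk: "run \<delta> (v j) (take i w) \<noteq> None" for i j
  proof
    assume "run \<delta> (v j) (take i w) = None"
    then have "run \<delta> (v j) (take i w @ drop i w) = None" by (subst run_append) simp
    then show False using f[OF vE[of j]] by simp
  qed
  have "\<delta> (q t) (x t) = Some (q (t + 1))" for t
  proof -
    define j i where "j = t div int n" and "i = nat (t mod int n)"
    have i: "i < n" using n(2) by (simp add: i_def nat_less_iff)
    have t: "t = int n * j + int i" using n(2) by (simp add: j_def i_def)
    obtain s where s: "run \<delta> (v j) (take i w) = Some s" using tk[of j i] by blast
    obtain s' where s': "run \<delta> (v j) (take (Suc i) w) = Some s'" using tk[of j "Suc i"] by blast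
    have "take (Suc i) w = take i w @ [w ! i]" using i n(1) by (simp add: take_Suc_conv_app_nth)
    then have "\<delta> s (w ! i) = Some s'" using s s' by (simp add: run_append)
    moreover have "q t = s" "x t = w ! i" using s by (simp_all add: q_def x_def i_def j_def)
    moreover have "q (t + 1) = s'"
    proof (cases "Suc i = n")
      case True
      have t1: "t + 1 = int n * (j + 1) + 0" using t True by (simp add: algebra_simps)
      have "(t + 1) div int n = j + 1" "(t + 1) mod int n = 0" unfolding t1 using n(2) by simp_all
      then have "q (t + 1) = v (j + 1)" by (simp add: q_def)
      moreover have "s' = v (j + 1)"
        using s' True n(1) f[OF vE[of j]] v_step[of j] by simp
      ultimately show ?thesis by simp
    next
      case False
      then have i1: "Suc i < n" using i by simp
      have t1: "t + 1 = int (Suc i) + int n * j" using t by simp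
      have "(t + 1) mod int n = int (Suc i)" "(t + 1) div int n = j"
        unfolding t1 using i1 by simp_all
      then show ?thesis using s' by (simp only: q_def nat_int option.sel)
    qed
    ultimately show ?thesis by simp
  qed
  then have "x \<in> aut_shift \<delta>" unfolding aut_shift_def by blast
  moreover have "(shift_map ^^ n) x = x" by (rule ext) (simp add: funpow_shift_map x_def)
  moreover have "block x 0 n = w"
    using n by (intro nth_equalityI) (auto simp: block_def x_def)
  ultimately show ?thesis by blast
qed

theorem fixed_points_bij_cyclic_words:
  assumes "n > 0"
  shows "bij_betw (\<lambda>x. block x 0 n) {x \<in> aut_shift \<delta>. (shift_map ^^ n) x = x}
    {w\<in>words S n. cyclic_word w}"
proof (rule bij_betw_imageI)
  show "inj_on (\<lambda>x. block x 0 n) {x \<in> aut_shift \<delta>. (shift_map ^^ n) x = x}"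
  proof (rule inj_onI, rule ext)
    fix x y t
    assume x: "x \<in> {x \<in> aut_shift \<delta>. (shift_map ^^ n) x = x}"
      and y: "y \<in> {x \<in> aut_shift \<delta>. (shift_map ^^ n) x = x}" and eq: "block x 0 n = block y 0 n"
    define i where "i = nat (t mod int n)"
    have i: "i < n" "int i = t mod int n" using assms by (simp_all add: i_def nat_less_iff)
    have "block x 0 n ! i = block y 0 n ! i" using eq by simp
    then have "x (int i) = y (int i)" using i(1) by (simp add: block_def)
    then show "x t = y t" unfolding i(2) using periodic_mod[of n x t] periodic_mod[of n y t] x y by simp
  qed
  show "(\<lambda>x. block x 0 n) ` {x \<in> aut_shift \<delta>. (shift_map ^^ n) x = x} = {w \<in> words S n. cyclic_word w}"
  proof (intro equalityI subsetI)
    fix w assume "w \<in> (\<lambda>x. block x 0 n) ` {x \<in> aut_shift \<delta>. (shift_map ^^ n) x = x}"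
    then obtain x where x: "x \<in> aut_shift \<delta>" "(shift_map ^^ n) x = x" "w = block x 0 n" by blast
    obtain q where q: "\<forall>t. \<delta> (q t) (x t) = Some (q (t + 1))" using x(1) unfolding aut_shift_def by blast
    have "set w \<subseteq> S" using run_letters[OF run_block[where \<delta>=\<delta> and q=q and x=x and k=0 and n=n, OF q]] x(3) by simp
    then show "w \<in> {w \<in> words S n. cyclic_word w}"
      using periodic_block_cyclic[OF x(1,2)] x(3) by (simp add: words_def block_def)
  next
    fix w assume "w \<in> {w \<in> words S n. cyclic_word w}"
    then have "cyclic_word w" "length w = n" by (simp_all add: words_def)
    from cyclic_word_periodic_point[OF this assms]
    show "w \<in> (\<lambda>x. block x 0 n) ` {x \<in> aut_shift \<delta>. (shift_map ^^ n) x = x}" by blast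
  qed
qed

corollary fixed_point_count_cyclic_words:
  "n > 0 \<Longrightarrow> fixed_point_count (aut_shift \<delta>) n = card {w\<in>words S n. cyclic_word w}"
  unfolding fixed_point_count_def by (rule bij_betw_same_card[OF fixed_points_bij_cyclic_words])

corollary finite_fixed_points:
  "n > 0 \<Longrightarrow> finite {x \<in> aut_shift \<delta>. (shift_map ^^ n) x = x}"
  using bij_betw_finite[OF fixed_points_bij_cyclic_words[of n]] finite_words[OF finite_S, of n] by simp

end

section \<open>Signs of permutations of state sets\<close>

definition same_order :: "('v \<Rightarrow> nat) \<Rightarrow> ('v \<Rightarrow> nat) \<Rightarrow> 'v set \<Rightarrow> bool" where
  "same_order \<alpha> \<beta> P \<longleftrightarrow> (\<forall>u\<in>P. \<forall>v\<in>P. \<alpha> u < \<alpha> v \<longleftrightarrow> \<beta> u < \<beta> v)"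

definition two_subsets :: "'v set \<Rightarrow> 'v set set" where
  "two_subsets E = {P. P \<subseteq> E \<and> card P = 2}"

text \<open>The sign of the permutation that relates two linear orders of \<open>E\<close>, given by injections into the natural numbers, as
the product over two-element subsets of \<open>+1\<close> or \<open>-1\<close>, according to whether the orders agree there.  For a
permutation \<open>f\<close> of \<open>E\<close> the sign of \<open>f\<close> is \<open>order_sign E \<alpha> (\<alpha> \<circ> f)\<close>; this form makes sense for
any injective \<open>f\<close>, so it also covers maps between different sets of states.\<close>

definition order_sign :: "'v set \<Rightarrow> ('v \<Rightarrow> nat) \<Rightarrow> ('v \<Rightarrow> nat) \<Rightarrow> int" where
  "order_sign E \<alpha> \<beta> = (\<Prod>P\<in>two_subsets E. if same_order \<alpha> \<beta> P then 1 else -1)"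

lemma same_order_pair:
  assumes "inj_on \<alpha> {u, v}" "inj_on \<beta> {u, v}" "u \<noteq> v"
  shows "same_order \<alpha> \<beta> {u, v} \<longleftrightarrow> (\<alpha> u < \<alpha> v \<longleftrightarrow> \<beta> u < \<beta> v)"
proof -
  have "\<alpha> u \<noteq> \<alpha> v" "\<beta> u \<noteq> \<beta> v" using assms by (auto simp: inj_on_def)
  then show ?thesis unfolding same_order_def by auto
qed

lemma order_sign_refl [simp]: "order_sign E \<alpha> \<alpha> = 1"
  by (simp add: order_sign_def same_order_def)

lemma two_subsets_empty [simp]: "two_subsets {} = {}"
  by (auto simp: two_subsets_def)

lemma order_sign_cong:
  assumes "\<And>u. u \<in> E \<Longrightarrow> \<beta> u = \<beta>' u"
  shows "order_sign E \<alpha> \<beta> = order_sign E \<alpha> \<beta>'"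
  unfolding order_sign_def
proof (rule prod.cong[OF refl])
  fix P assume "P \<in> two_subsets E"
  then have "\<beta> u = \<beta>' u" if "u \<in> P" for u using assms that unfolding two_subsets_def by blast
  then have "same_order \<alpha> \<beta> P = same_order \<alpha> \<beta>' P" unfolding same_order_def by simp
  then show "(if same_order \<alpha> \<beta> P then 1 else (-1::int)) = (if same_order \<alpha> \<beta>' P then 1 else -1)" by simp
qed

lemma order_sign_trans:
  assumes "inj_on \<alpha> E" "inj_on \<beta> E" "inj_on \<gamma> E"
  shows "order_sign E \<alpha> \<beta> * order_sign E \<beta> \<gamma> = order_sign E \<alpha> \<gamma>"
  unfolding order_sign_def prod.distrib[symmetric]
proof (rule prod.cong[OF refl])
  fix P assume "P \<in> two_subsets E"
  then obtain u v where P: "P = {u, v}" "u \<noteq> v" "{u, v} \<subseteq> E"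
    unfolding two_subsets_def by (auto simp: card_2_iff)
  have inj: "inj_on \<alpha> {u, v}" "inj_on \<beta> {u, v}" "inj_on \<gamma> {u, v}"
    by (rule inj_on_subset[OF assms(1) P(3)], rule inj_on_subset[OF assms(2) P(3)],
        rule inj_on_subset[OF assms(3) P(3)])
  show "(if same_order \<alpha> \<beta> P then 1 else -1) * (if same_order \<beta> \<gamma> P then 1 else -1)
    = (if same_order \<alpha> \<gamma> P then 1 else (-1::int))"
    unfolding P(1) same_order_pair[OF inj(1,2) P(2)] same_order_pair[OF inj(2,3) P(2)]
      same_order_pair[OF inj(1,3) P(2)] by auto
qed

lemma order_sign_image:
  assumes "inj_on f E"
  shows "order_sign (f ` E) \<alpha> \<beta> = order_sign E (\<alpha> \<circ> f) (\<beta> \<circ> f)"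
proof -
  have "bij_betw (\<lambda>P. f ` P) (two_subsets E) (two_subsets (f ` E))"
  proof (rule bij_betw_imageI)
    show "inj_on (\<lambda>P. f ` P) (two_subsets E)"
      using assms by (intro inj_onI) (auto simp: two_subsets_def inj_on_image_eq_iff)
    show "(\<lambda>P. f ` P) ` two_subsets E = two_subsets (f ` E)"
    proof (intro equalityI subsetI)
      fix Q assume "Q \<in> (\<lambda>P. f ` P) ` two_subsets E"
      then obtain P where P: "P \<subseteq> E" "card P = 2" "Q = f ` P" unfolding two_subsets_def by blast
      moreover have "card (f ` P) = card P" using assms P(1) by (intro card_image inj_on_subset[OF assms])
      ultimately show "Q \<in> two_subsets (f ` E)" unfolding two_subsets_def by auto
    next
      fix Q assume "Q \<in> two_subsets (f ` E)"
      then have Q: "Q \<subseteq> f ` E" "card Q = 2" unfolding two_subsets_def by auto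
      then obtain P where P: "P \<subseteq> E" "Q = f ` P" by (auto simp: subset_image_iff)
      have "card (f ` P) = card P" using assms P(1) by (intro card_image inj_on_subset[OF assms])
      then show "Q \<in> (\<lambda>P. f ` P) ` two_subsets E" using P Q unfolding two_subsets_def by auto
    qed
  qed
  then have "order_sign (f ` E) \<alpha> \<beta> = (\<Prod>P\<in>two_subsets E. if same_order \<alpha> \<beta> (f ` P) then 1 else -1)"
    unfolding order_sign_def by (rule prod.reindex_bij_betw[symmetric])
  also have "\<dots> = order_sign E (\<alpha> \<circ> f) (\<beta> \<circ> f)"
    unfolding order_sign_def same_order_def by simp
  finally show ?thesis .
qed

text \<open>A two-element subset of the union lies in \<open>A\<close>, lies in \<open>B\<close>, or meets both.\<close>

lemma order_sign_Un:
  assumes fin: "finite A" "finite B" and disj: "A \<inter> B = {}"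
    and inj: "inj_on \<alpha> (A \<union> B)" "inj_on \<beta> (A \<union> B)"
  shows "order_sign (A \<union> B) \<alpha> \<beta> = order_sign A \<alpha> \<beta> * order_sign B \<alpha> \<beta> *
    (\<Prod>(u, v)\<in>A \<times> B. if (\<alpha> u < \<alpha> v) = (\<beta> u < \<beta> v) then 1 else -1)"
proof -
  let ?s = "\<lambda>P. if same_order \<alpha> \<beta> P then 1 else (-1::int)" and ?X = "(\<lambda>(u, v). {u, v}) ` (A \<times> B)"
  have finp: "finite (two_subsets E)" if "finite E" for E :: "'a set"
    unfolding two_subsets_def by (rule finite_subset[of _ "Pow E"]) (use that in auto)
  have X: "P \<in> ?X \<longleftrightarrow> (\<exists>u\<in>A. \<exists>v\<in>B. P = {u, v})" for P
    by (simp add: image_iff Bex_def)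
  have split: "two_subsets (A \<union> B) = (two_subsets A \<union> two_subsets B) \<union> ?X"
  proof (intro equalityI subsetI)
    fix P assume "P \<in> two_subsets (A \<union> B)"
    then obtain u v where P: "P = {u, v}" "u \<noteq> v" "u \<in> A \<union> B" "v \<in> A \<union> B" "card P = 2"
      unfolding two_subsets_def by (auto simp: card_2_iff)
    then consider "P \<subseteq> A" | "P \<subseteq> B" | "u \<in> A" "v \<in> B" | "u \<in> B" "v \<in> A" by blast
    then show "P \<in> (two_subsets A \<union> two_subsets B) \<union> ?X"
    proof cases
      case 1
      then show ?thesis using P(5) by (simp add: two_subsets_def)
    next
      case 2
      then show ?thesis using P(5) by (simp add: two_subsets_def)
    next
      case 3
      then have "P \<in> ?X" unfolding X using P(1) by blast
      then show ?thesis by (rule UnI2)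
    next
      case 4
      moreover have "P = {v, u}" using P(1) by blast
      ultimately have "P \<in> ?X" unfolding X by blast
      then show ?thesis by (rule UnI2)
    qed
  next
    fix P assume "P \<in> (two_subsets A \<union> two_subsets B) \<union> ?X"
    then show "P \<in> two_subsets (A \<union> B)"
    proof (elim UnE)
      assume "P \<in> ?X"
      then obtain u v where uv: "u \<in> A" "v \<in> B" "P = {u, v}" unfolding X by blast
      then have "u \<noteq> v" using disj by blast
      then have "card P = 2" using uv(3) by simp
      moreover have "P \<subseteq> A \<union> B" using uv by blast
      ultimately show ?thesis by (simp add: two_subsets_def)
    qed (auto simp: two_subsets_def)
  qed
  have d1: "(two_subsets A \<union> two_subsets B) \<inter> ?X = {}"
  proof (rule ccontr)
    assume "(two_subsets A \<union> two_subsets B) \<inter> ?X \<noteq> {}"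
    then obtain P where P: "P \<in> two_subsets A \<union> two_subsets B" "P \<in> ?X" by blast
    then obtain u v where uv: "u \<in> A" "v \<in> B" "P = {u, v}" unfolding X by blast
    have "P \<subseteq> A \<or> P \<subseteq> B" using P(1) by (auto simp: two_subsets_def)
    then show False using uv disj by blast
  qed
  have d2: "two_subsets A \<inter> two_subsets B = {}"
  proof (rule ccontr)
    assume "two_subsets A \<inter> two_subsets B \<noteq> {}"
    then obtain P where P: "P \<subseteq> A" "P \<subseteq> B" "card P = 2" unfolding two_subsets_def by blast
    then have "P = {}" using disj by blast
    then show False using P(3) by simp
  qed
  have "order_sign (A \<union> B) \<alpha> \<beta> = prod ?s (two_subsets A \<union> two_subsets B) * prod ?s ?X"
    unfolding order_sign_def split using finp fin d1 by (intro prod.union_disjoint) auto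
  also have "prod ?s (two_subsets A \<union> two_subsets B) = order_sign A \<alpha> \<beta> * order_sign B \<alpha> \<beta>"
    unfolding order_sign_def using finp fin d2 by (intro prod.union_disjoint) auto
  also have "prod ?s ?X = (\<Prod>x\<in>A \<times> B. ?s ((\<lambda>(u, v). {u, v}) x))"
  proof (rule prod.reindex_cong[of "\<lambda>(u, v). {u, v}"])
    show "inj_on (\<lambda>(u, v). {u, v}) (A \<times> B)" using disj by (auto simp: inj_on_def doubleton_eq_iff)
  qed auto
  also have "\<dots> = (\<Prod>(u, v)\<in>A \<times> B. if (\<alpha> u < \<alpha> v) = (\<beta> u < \<beta> v) then 1 else -1)"
  proof (rule prod.cong[OF refl])
    fix x assume "x \<in> A \<times> B"
    then obtain u v where x: "x = (u, v)" "u \<in> A" "v \<in> B" by blast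
    have uv: "{u, v} \<subseteq> A \<union> B" using x by blast
    have "inj_on \<alpha> {u, v}" "inj_on \<beta> {u, v}"
      by (rule inj_on_subset[OF inj(1) uv], rule inj_on_subset[OF inj(2) uv])
    moreover have "u \<noteq> v" using x disj by blast
    ultimately show "?s ((\<lambda>(u, v). {u, v}) x) = (case x of (u, v) \<Rightarrow> if (\<alpha> u < \<alpha> v) = (\<beta> u < \<beta> v) then 1 else -1)"
      using same_order_pair[of \<alpha> u v \<beta>] x(1) by simp
  qed
  finally show ?thesis .
qed

text \<open>The pairs meeting both sets contribute a product of the form \<open>(\<Prod>x. s x * s (f x))\<close>, which is a
square because \<open>f\<close> permutes these pairs.\<close>

lemma order_sign_permuted_Un:
  assumes fin: "finite A" "finite B" and disj: "A \<inter> B = {}" and inj: "inj_on \<alpha> (A \<union> B)"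
    and f: "bij_betw f A A" "bij_betw f B B"
  shows "order_sign (A \<union> B) \<alpha> (\<alpha> \<circ> f) = order_sign A \<alpha> (\<alpha> \<circ> f) * order_sign B \<alpha> (\<alpha> \<circ> f)"
proof -
  define s where "s = (\<lambda>(u, v). if \<alpha> u < \<alpha> v then 1 else (-1::int))"
  have fAB: "bij_betw f (A \<union> B) (A \<union> B)" using f disj by (intro bij_betw_combine)
  have inj2: "inj_on (\<alpha> \<circ> f) (A \<union> B)"
    using fAB inj by (intro comp_inj_on) (auto simp: bij_betw_def)
  have fx: "bij_betw (map_prod f f) (A \<times> B) (A \<times> B)" using f by (rule bij_betw_map_prod)
  have "(\<Prod>(u, v)\<in>A \<times> B. if (\<alpha> u < \<alpha> v) = ((\<alpha> \<circ> f) u < (\<alpha> \<circ> f) v) then 1 else (-1::int))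
    = (\<Prod>x\<in>A \<times> B. s x * s (map_prod f f x))"
    by (intro prod.cong refl) (auto simp: s_def)
  also have "\<dots> = (\<Prod>x\<in>A \<times> B. s x) * (\<Prod>x\<in>A \<times> B. s (map_prod f f x))" by (rule prod.distrib)
  also have "(\<Prod>x\<in>A \<times> B. s (map_prod f f x)) = (\<Prod>x\<in>A \<times> B. s x)"
    by (rule prod.reindex_bij_betw[OF fx])
  also have "(\<Prod>x\<in>A \<times> B. s x) * (\<Prod>x\<in>A \<times> B. s x) = (\<Prod>x\<in>A \<times> B. s x * s x)" by (rule prod.distrib[symmetric])
  also have "\<dots> = 1" by (intro prod.neutral) (auto simp: s_def)
  finally show ?thesis using order_sign_Un[OF fin disj inj inj2] by simp
qed

text \<open>The sign of a permutation does not depend on the reference order: changing it multiplies the sign by the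
same factor twice.\<close>

lemma order_sign_conjugate:
  assumes f: "bij_betw f A A" and inj: "inj_on \<alpha> A" "inj_on \<beta> A"
  shows "order_sign A \<alpha> (\<alpha> \<circ> f) = order_sign A \<beta> (\<beta> \<circ> f)"
proof -
  have fi: "inj_on f A" "f ` A = A" using f by (auto simp: bij_betw_def)
  have inj2: "inj_on (\<alpha> \<circ> f) A" "inj_on (\<beta> \<circ> f) A" using fi inj by (auto intro!: comp_inj_on)
  have "order_sign A \<alpha> (\<alpha> \<circ> f) = order_sign A \<alpha> \<beta> * order_sign A \<beta> (\<alpha> \<circ> f)"
    using order_sign_trans[OF inj inj2(1)] by simp
  also have "order_sign A \<beta> (\<alpha> \<circ> f) = order_sign A \<beta> (\<beta> \<circ> f) * order_sign A (\<beta> \<circ> f) (\<alpha> \<circ> f)"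
    using order_sign_trans[OF inj(2) inj2(2,1)] by simp
  also have "order_sign A (\<beta> \<circ> f) (\<alpha> \<circ> f) = order_sign A \<beta> \<alpha>"
    using order_sign_image[OF fi(1), of \<beta> \<alpha>] fi(2) by simp
  also have "order_sign A \<alpha> \<beta> * (order_sign A \<beta> (\<beta> \<circ> f) * order_sign A \<beta> \<alpha>)
    = order_sign A \<beta> (\<beta> \<circ> f) * (order_sign A \<alpha> \<beta> * order_sign A \<beta> \<alpha>)" by simp
  also have "order_sign A \<alpha> \<beta> * order_sign A \<beta> \<alpha> = 1"
    using order_sign_trans[OF inj(1,2,1)] by simp
  finally show ?thesis by (simp only: mult_1_right)
qed

lemma inj_on_Suc_mod: "inj_on (\<lambda>i. Suc i mod k) {..<k}"
proof (rule inj_onI)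
  fix i j assume ij: "i \<in> {..<k}" "j \<in> {..<k}" "Suc i mod k = Suc j mod k"
  then have "[i + 1 = j + 1] (mod k)" by (simp add: cong_def)
  then have "[i = j] (mod k)" by (simp only: cong_add_rcancel_nat)
  then show "i = j" using ij(1,2) by (simp add: cong_def)
qed

lemma order_sign_rotation:
  "order_sign {..<Suc k} id (\<lambda>i. Suc i mod Suc k) = (-1) ^ k"
proof -
  let ?s = "\<lambda>i. Suc i mod Suc k"
  have small: "?s i = Suc i" if "i < k" for i using that by simp
  have eq: "{..<Suc k} = {..<k} \<union> {k}" by auto
  have inj: "inj_on ?s ({..<k} \<union> {k})"
    using inj_on_Suc_mod[of "Suc k"] unfolding eq .
  have "order_sign {..<Suc k} id ?s = order_sign {..<k} id ?s * order_sign {k} id ?s *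
    (\<Prod>(i, j)\<in>{..<k} \<times> {k}. if (id i < id j) = (?s i < ?s j) then 1 else -1)"
    unfolding eq by (rule order_sign_Un) (use inj in auto)
  also have "order_sign {..<k} id ?s = 1"
    unfolding order_sign_def
  proof (intro prod.neutral ballI)
    fix P assume "P \<in> two_subsets {..<k}"
    then have "P \<subseteq> {..<k}" by (simp add: two_subsets_def)
    then have "?s i = Suc i" if "i \<in> P" for i using small that by blast
    then have "same_order id ?s P" unfolding same_order_def by simp
    then show "(if same_order id ?s P then 1 else (-1::int)) = 1" by simp
  qed
  also have "order_sign {k} id ?s = 1"
  proof -
    have "two_subsets {k} = {}"
    proof (rule ccontr)
      assume "two_subsets {k} \<noteq> {}"
      then obtain P where P: "P \<subseteq> {k}" "card P = 2" unfolding two_subsets_def by blast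
      have "card P \<le> card {k}" by (rule card_mono[OF _ P(1)]) simp
      then show False using P(2) by simp
    qed
    then show ?thesis by (simp add: order_sign_def)
  qed
  also have "(\<Prod>(i, j)\<in>{..<k} \<times> {k}. if (id i < id j) = (?s i < ?s j) then 1 else (-1::int))
    = (\<Prod>x\<in>{..<k} \<times> {k}. -1)"
    by (intro prod.cong refl) auto
  also have "\<dots> = (-1) ^ k" by (simp add: card_cartesian_product)
  finally show ?thesis by (simp only: mult_1_left)
qed

text \<open>Transport the orbit to \<open>{..<k}\<close>, where the cycle becomes the rotation \<open>i \<mapsto> i + 1\<close> modulo \<open>k\<close>.\<close>

lemma order_sign_orbit:
  assumes k: "k > 0" and per: "(f ^^ k) x = x"
    and least: "\<And>m. 0 < m \<Longrightarrow> m < k \<Longrightarrow> (f ^^ m) x \<noteq> x"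
    and inj: "inj_on \<alpha> ((\<lambda>i. (f ^^ i) x) ` {..<k})"
  shows "bij_betw f ((\<lambda>i. (f ^^ i) x) ` {..<k}) ((\<lambda>i. (f ^^ i) x) ` {..<k})"
    and "order_sign ((\<lambda>i. (f ^^ i) x) ` {..<k}) \<alpha> (\<alpha> \<circ> f) = (-1) ^ (k - 1)"
    and "card ((\<lambda>i. (f ^^ i) x) ` {..<k}) = k"
proof -
  let ?g = "\<lambda>i. (f ^^ i) x" and ?s = "\<lambda>i. Suc i mod k"
  have gi: "inj_on ?g {..<k}"
    using inj_on_funpow_least[OF per least] by (simp add: atLeast0LessThan)
  show cd: "card (?g ` {..<k}) = k" using card_image[OF gi] by simp
  have fg: "f (?g i) = ?g (?s i)" if "i < k" for i
  proof (cases "Suc i = k")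
    case True
    then show ?thesis using per by auto
  next
    case False
    then show ?thesis using that by simp
  qed
  have s_inj: "inj_on ?s {..<k}" by (rule inj_on_Suc_mod)
  have s_im: "?s ` {..<k} = {..<k}"
    by (rule endo_inj_surj) (use s_inj k in auto)
  have "f ` ?g ` {..<k} = ?g ` ?s ` {..<k}" unfolding image_image using fg by (intro image_cong) auto
  then have im: "f ` ?g ` {..<k} = ?g ` {..<k}" unfolding s_im .
  show bij: "bij_betw f (?g ` {..<k}) (?g ` {..<k})"
    unfolding bij_betw_def using im by (auto intro: eq_card_imp_inj_on)
  have s_bij: "bij_betw ?s {..<k} {..<k}" using s_inj s_im by (simp add: bij_betw_def)
  have "order_sign (?g ` {..<k}) \<alpha> (\<alpha> \<circ> f) = order_sign {..<k} (\<alpha> \<circ> ?g) (\<alpha> \<circ> f \<circ> ?g)"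
    by (rule order_sign_image[OF gi])
  also have "\<dots> = order_sign {..<k} (\<alpha> \<circ> ?g) ((\<alpha> \<circ> ?g) \<circ> ?s)"
    by (rule order_sign_cong) (use fg in auto)
  also have "\<dots> = order_sign {..<k} id (id \<circ> ?s)"
    by (rule order_sign_conjugate[OF s_bij]) (use gi inj in \<open>auto intro: comp_inj_on\<close>)
  also have "\<dots> = (-1) ^ (k - 1)"
    using order_sign_rotation[of "k - 1"] k by (simp add: comp_def)
  finally show "order_sign (?g ` {..<k}) \<alpha> (\<alpha> \<circ> f) = (-1) ^ (k - 1)" .
qed

text \<open>Sign-reversing involution: let \<open>c\<close> be the orbit of a point of some invariant set.  Every invariant
set contains \<open>c\<close> or is disjoint from it, and adding \<open>c\<close> multiplies \<open>(-1) ^ card E\<close> by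
\<open>(-1) ^ k\<close> and the sign by \<open>(-1) ^ (k - 1)\<close>, where \<open>k = card c\<close>.\<close>

lemma signed_invariant_sets:
  assumes fin: "finite D" and inj\<alpha>: "inj_on \<alpha> D"
    and Inv: "\<And>E. E \<in> Inv \<longleftrightarrow> E \<subseteq> D \<and> f ` E = E"
  shows "(\<Sum>E\<in>Inv. (-1) ^ card E * order_sign E \<alpha> (\<alpha> \<circ> f)) = (if Inv = {{}} then 1 else 0)"
proof (cases "Inv = {{}}")
  case True
  then show ?thesis by (simp add: order_sign_def)
next
  case False
  have InvD: "E \<subseteq> D" "f ` E = E" if "E \<in> Inv" for E
    using Inv[THEN iffD1, OF that] by (rule conjunct1) (rule Inv[THEN iffD1, OF that, THEN conjunct2])
  have InvI: "E \<in> Inv" if "E \<subseteq> D" "f ` E = E" for E using that unfolding Inv by (rule conjI)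
  have finInv: "finite E" if "E \<in> Inv" for E by (rule finite_subset[OF InvD(1)[OF that] fin])
  have finI: "finite Inv"
  proof (rule finite_subset)
    show "Inv \<subseteq> Pow D" by (rule subsetI) (simp add: InvD(1))
  qed (simp add: fin)
  have empty: "{} \<in> Inv" by (rule InvI) simp_all
  have "\<exists>E0. E0 \<in> Inv \<and> E0 \<noteq> {}"
  proof (rule ccontr)
    assume "\<not> (\<exists>E0. E0 \<in> Inv \<and> E0 \<noteq> {})"
    then have "Inv \<subseteq> {{}}" by blast
    then have "Inv = {{}}" using empty by blast
    with False show False by contradiction
  qed
  then obtain E0 x where E0: "E0 \<in> Inv" "x \<in> E0" by blast
  have bij: "bij_betw f E E" if "E \<in> Inv" for E
  proof -
    have "inj_on f E" by (rule eq_card_imp_inj_on[OF finInv[OF that]]) (simp add: InvD(2)[OF that])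
    then show ?thesis unfolding bij_betw_def using InvD(2)[OF that] by (rule conjI)
  qed
  have orb: "(f ^^ i) y \<in> E" if "E \<in> Inv" "y \<in> E" for i y E
  proof (induction i)
    case (Suc i)
    then have "f ((f ^^ i) y) \<in> f ` E" by (rule imageI)
    then show ?case using InvD(2)[OF that(1)] by simp
  qed (simp add: that)
  have "\<exists>k>0. (f ^^ k) x = x"
  proof -
    have "range (\<lambda>i. (f ^^ i) x) \<subseteq> E0" using orb[OF E0] by blast
    then have "finite (range (\<lambda>i. (f ^^ i) x))" by (rule finite_subset[OF _ finInv[OF E0(1)]])
    then have "\<not> inj (\<lambda>i. (f ^^ i) x)" using finite_imageD infinite_UNIV_nat by blast
    then obtain i0 j0 where "(f ^^ i0) x = (f ^^ j0) x" "i0 \<noteq> j0" unfolding inj_def by blast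
    then obtain i j where ij: "i < j" "(f ^^ i) x = (f ^^ j) x" by (metis nat_neq_iff)
    have "(f ^^ j) x = (f ^^ i) ((f ^^ (j - i)) x)"
      using ij(1) funpow_add[of i "j - i" f] by simp
    moreover have "inj_on (f ^^ i) E0" using bij_betw_funpow[OF bij[OF E0(1)]] by (simp add: bij_betw_def)
    ultimately have "(f ^^ (j - i)) x = x"
      using ij(2) E0(2) orb[OF E0, of "j - i"] by (simp add: inj_on_eq_iff)
    then show ?thesis using ij(1) by (intro exI[of _ "j - i"]) simp
  qed
  then have ex: "\<exists>k. k > 0 \<and> (f ^^ k) x = x" by blast
  define k where "k = (LEAST k. k > 0 \<and> (f ^^ k) x = x)"
  have k: "k > 0" "(f ^^ k) x = x" using LeastI_ex[OF ex] unfolding k_def by auto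
  have least: "(f ^^ m) x \<noteq> x" if "0 < m" "m < k" for m
    using not_less_Least[of m "\<lambda>k. k > 0 \<and> (f ^^ k) x = x"] that unfolding k_def by auto
  define c where "c = (\<lambda>i. (f ^^ i) x) ` {..<k}"
  have xc: "x \<in> c" unfolding c_def using k(1) by (auto intro!: image_eqI[of _ _ 0])
  have cE: "c \<subseteq> E" if "E \<in> Inv" "x \<in> E" for E unfolding c_def using orb[OF that] by auto
  have cD: "c \<subseteq> D" using cE[OF E0] InvD(1)[OF E0(1)] by (rule subset_trans)
  have inj\<alpha>c: "inj_on \<alpha> ((\<lambda>i. (f ^^ i) x) ` {..<k})" using inj_on_subset[OF inj\<alpha> cD] unfolding c_def .
  note oc = order_sign_orbit[OF k least inj\<alpha>c, folded c_def]
  have cI: "c \<in> Inv" using oc(1) cD by (intro InvI) (simp_all add: bij_betw_def)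
  have disj: "c \<inter> E = {}" if E: "E \<in> Inv" "x \<notin> E" for E
  proof (rule ccontr)
    assume "c \<inter> E \<noteq> {}"
    then obtain i where i: "i < k" "(f ^^ i) x \<in> E" unfolding c_def by blast
    have "(f ^^ (k - i)) ((f ^^ i) x) = x"
    proof -
      have "(f ^^ (k - i)) ((f ^^ i) x) = (f ^^ (k - i + i)) x" by (simp only: funpow_add comp_apply)
      then show ?thesis using i(1) k(2) by simp
    qed
    then show False using orb[OF E(1) i(2), of "k - i"] E(2) by simp
  qed
  let ?t = "\<lambda>E. (-1) ^ card E * order_sign E \<alpha> (\<alpha> \<circ> f)"
  let ?I0 = "{E \<in> Inv. x \<notin> E}" and ?I1 = "{E \<in> Inv. x \<in> E}"
  have "sum ?t Inv = sum ?t ?I0 + sum ?t ?I1"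
    using finI by (subst sum.union_disjoint[symmetric]) (auto intro: sum.cong)
  also have "sum ?t ?I1 = (\<Sum>E\<in>?I0. ?t (E \<union> c))"
  proof (rule sum.reindex_bij_betw[symmetric], rule bij_betw_imageI)
    show "inj_on (\<lambda>E. E \<union> c) ?I0" by (rule inj_onI) (use disj in blast)
    show "(\<lambda>E. E \<union> c) ` ?I0 = ?I1"
    proof (intro equalityI subsetI)
      fix E assume "E \<in> (\<lambda>E. E \<union> c) ` ?I0"
      then obtain E' where "E' \<in> Inv" "E = E' \<union> c" by blast
      moreover have "E' \<union> c \<in> Inv"
        using InvD[OF \<open>E' \<in> Inv\<close>] InvD[OF cI] by (intro InvI) (simp_all add: image_Un)
      ultimately show "E \<in> ?I1" using xc by blast
    next
      fix E assume "E \<in> ?I1"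
      then have E: "E \<in> Inv" "x \<in> E" by auto
      have "f ` (E - c) = f ` E - f ` c"
        using bij[OF E(1)] cE[OF E] by (intro inj_on_image_set_diff[of f E]) (auto simp: bij_betw_def)
      then have "E - c \<in> Inv"
        using InvD[OF E(1)] InvD[OF cI] by (intro InvI) auto
      moreover have "x \<notin> E - c" using xc by blast
      moreover have "E = (E - c) \<union> c" using cE[OF E] by blast
      ultimately show "E \<in> (\<lambda>E. E \<union> c) ` ?I0" by blast
    qed
  qed
  also have "\<dots> = (\<Sum>E\<in>?I0. - ?t E)"
  proof (rule sum.cong[OF refl])
    fix E assume "E \<in> ?I0"
    then have E: "E \<in> Inv" "x \<notin> E" by auto
    have finE: "finite E" "finite c" by (rule finInv[OF E(1)], rule finInv[OF cI])
    have dj: "E \<inter> c = {}" using disj[OF E] by blast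
    have "inj_on \<alpha> (E \<union> c)" using InvD(1)[OF E(1)] InvD(1)[OF cI] by (intro inj_on_subset[OF inj\<alpha>]) simp
    then have os: "order_sign (E \<union> c) \<alpha> (\<alpha> \<circ> f) = order_sign E \<alpha> (\<alpha> \<circ> f) * (-1) ^ (k - 1)"
      using order_sign_permuted_Un[OF finE dj _ bij[OF E(1)] bij[OF cI], of \<alpha>] oc(2) by simp
    have "card (E \<union> c) = card E + Suc (k - 1)"
      using card_Un_disjoint[OF finE dj] oc(3) k(1) by simp
    then have "?t (E \<union> c) = - (?t E * ((-1) ^ (k - 1) * (-1) ^ (k - 1)))"
      unfolding os by (simp add: power_add)
    also have "(-1) ^ (k - 1) * (-1) ^ (k - 1) = (1::int)" by (simp flip: power_mult_distrib)
    finally show "?t (E \<union> c) = - ?t E" by (simp only: mult_1_right)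
  qed
  finally show ?thesis unfolding if_not_P[OF False] sum_negf by (simp only: add.right_inverse)
qed

section \<open>Signed subset matrices and their traces\<close>

context automaton
begin

definition word_sign :: "('v \<Rightarrow> nat) \<Rightarrow> 'v set \<Rightarrow> 'a list \<Rightarrow> int" where
  "word_sign \<iota> E w = order_sign E \<iota> (\<iota> \<circ> (\<lambda>u. the (run \<delta> u w)))"

lemma word_sign_append:
  assumes inj: "inj_on \<iota> V" and E: "E \<subseteq> V" and e: "embeds \<delta> E (w @ w')"
  shows "word_sign \<iota> E (w @ w') = word_sign \<iota> E w * word_sign \<iota> (run_image \<delta> E w) w'"
proof -
  define f where "f = (\<lambda>u. the (run \<delta> u w))"
  define g where "g = (\<lambda>u. the (run \<delta> u w'))"
  have e1: "embeds \<delta> E w" and e2: "embeds \<delta> (run_image \<delta> E w) w'" using e by (simp_all add: embeds_append)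
  have im: "run_image \<delta> E w = f ` E" by (simp add: run_image_def f_def)
  have fi: "inj_on f E" using embeds_inj[OF e1] by (simp add: f_def)
  have gi: "inj_on g (f ` E)" using embeds_inj[OF e2] by (simp add: g_def im)
  have fV: "f ` E \<subseteq> V" using run_image_subset[OF E e1] by (simp add: im)
  have im2: "run_image \<delta> (f ` E) w' = g ` f ` E" by (simp add: run_image_def g_def)
  have e3: "embeds \<delta> (f ` E) w'" using e2 unfolding im .
  have gV: "g ` f ` E \<subseteq> V" using run_image_subset[OF fV e3] unfolding im2 .
  have gf: "the (run \<delta> u (w @ w')) = g (f u)" if "u \<in> E" for u
    using e1 that by (auto simp: embeds_def run_append f_def g_def)
  have i1: "inj_on \<iota> E" by (rule inj_on_subset[OF inj E])
  have i2: "inj_on (\<iota> \<circ> f) E" by (rule comp_inj_on[OF fi inj_on_subset[OF inj fV]])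
  have "inj_on (\<iota> \<circ> g) (f ` E)" by (rule comp_inj_on[OF gi inj_on_subset[OF inj gV]])
  then have i3: "inj_on (\<iota> \<circ> g \<circ> f) E" by (rule comp_inj_on[OF fi])
  have "word_sign \<iota> E (w @ w') = order_sign E \<iota> (\<iota> \<circ> g \<circ> f)"
    unfolding word_sign_def by (rule order_sign_cong) (simp add: gf)
  also have "\<dots> = order_sign E \<iota> (\<iota> \<circ> f) * order_sign E (\<iota> \<circ> f) (\<iota> \<circ> g \<circ> f)"
    by (rule order_sign_trans[OF i1 i2 i3, symmetric])
  also have "order_sign E (\<iota> \<circ> f) (\<iota> \<circ> g \<circ> f) = order_sign (f ` E) \<iota> (\<iota> \<circ> g)"
    by (rule order_sign_image[OF fi, symmetric])
  finally show ?thesis unfolding word_sign_def im f_def g_def .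
qed

text \<open>The entries of the \<open>n\<close>-th power of the signed subset matrices, for all sizes of subsets together.\<close>

definition signed_count :: "('v \<Rightarrow> nat) \<Rightarrow> nat \<Rightarrow> 'v set \<Rightarrow> 'v set \<Rightarrow> int" where
  "signed_count \<iota> n E E' =
    (\<Sum>w\<in>words S n. if embeds \<delta> E w \<and> run_image \<delta> E w = E' then word_sign \<iota> E w else 0)"

lemma signed_count_0: "signed_count \<iota> 0 E E' = (if E = E' then 1 else 0)"
  by (simp add: signed_count_def word_sign_def comp_def)

lemma signed_count_card: "signed_count \<iota> n E E' \<noteq> 0 \<Longrightarrow> card E' = card E"
  unfolding signed_count_def
proof (elim sum.not_neutral_contains_not_neutral)
  fix w assume "(if embeds \<delta> E w \<and> run_image \<delta> E w = E' then word_sign \<iota> E w else 0) \<noteq> 0"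
  then have "embeds \<delta> E w" "run_image \<delta> E w = E'" by (auto split: if_split_asm)
  then show "card E' = card E" using card_run_image by blast
qed

lemma signed_count_add:
  assumes inj: "inj_on \<iota> V" and E: "E \<subseteq> V"
  shows "signed_count \<iota> (m + n) E E'' = (\<Sum>E'\<in>Pow V. signed_count \<iota> m E E' * signed_count \<iota> n E' E'')"
proof -
  let ?A = "\<lambda>x E'. if embeds \<delta> E x \<and> run_image \<delta> E x = E' then word_sign \<iota> E x else 0"
  have "(\<Sum>E'\<in>Pow V. signed_count \<iota> m E E' * signed_count \<iota> n E' E'')
    = (\<Sum>x\<in>words S m. \<Sum>E'\<in>Pow V. ?A x E' * signed_count \<iota> n E' E'')"
    unfolding signed_count_def[of \<iota> m] sum_distrib_right by (rule sum.swap)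
  also have "\<dots> = (\<Sum>x\<in>words S m. \<Sum>y\<in>words S n.
      if embeds \<delta> E (x @ y) \<and> run_image \<delta> E (x @ y) = E'' then word_sign \<iota> E (x @ y) else 0)"
  proof (rule sum.cong[OF refl])
    fix x
    show "(\<Sum>E'\<in>Pow V. ?A x E' * signed_count \<iota> n E' E'') = (\<Sum>y\<in>words S n.
      if embeds \<delta> E (x @ y) \<and> run_image \<delta> E (x @ y) = E'' then word_sign \<iota> E (x @ y) else 0)"
    proof (cases "embeds \<delta> E x")
      case False
      then show ?thesis by (simp add: embeds_append)
    next
      case True
      let ?E1 = "run_image \<delta> E x"
      have "?E1 \<in> Pow V" using run_image_subset[OF E True] by simp
      have "(\<Sum>E'\<in>Pow V. ?A x E' * signed_count \<iota> n E' E'')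
        = (\<Sum>E'\<in>Pow V. if E' = ?E1 then word_sign \<iota> E x * signed_count \<iota> n E' E'' else 0)"
        by (rule sum.cong[OF refl]) (use True in auto)
      also have "\<dots> = word_sign \<iota> E x * signed_count \<iota> n ?E1 E''"
        using finite_V \<open>?E1 \<in> Pow V\<close> by (simp add: sum.delta)
      also have "\<dots> = (\<Sum>y\<in>words S n. word_sign \<iota> E x *
          (if embeds \<delta> ?E1 y \<and> run_image \<delta> ?E1 y = E'' then word_sign \<iota> ?E1 y else 0))"
        unfolding signed_count_def by (rule sum_distrib_left)
      also have "\<dots> = (\<Sum>y\<in>words S n.
          if embeds \<delta> E (x @ y) \<and> run_image \<delta> E (x @ y) = E'' then word_sign \<iota> E (x @ y) else 0)"
      proof (rule sum.cong[OF refl])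
        fix y
        show "word_sign \<iota> E x * (if embeds \<delta> ?E1 y \<and> run_image \<delta> ?E1 y = E'' then word_sign \<iota> ?E1 y else 0)
          = (if embeds \<delta> E (x @ y) \<and> run_image \<delta> E (x @ y) = E'' then word_sign \<iota> E (x @ y) else 0)"
        proof (cases "embeds \<delta> ?E1 y")
          case e: True
          then have exy: "embeds \<delta> E (x @ y)" using True by (simp add: embeds_append)
          show ?thesis
            unfolding word_sign_append[OF inj E exy] run_image_append[OF True] using e exy by simp
        qed (simp add: embeds_append)
      qed
      finally show ?thesis .
    qed
  qed
  also have "\<dots> = signed_count \<iota> (m + n) E E''"
    unfolding signed_count_def by (rule sum_words_add[symmetric])
  finally show ?thesis by simp
qed

text \<open>Apply \<open>signed_invariant_sets\<close> to every single word and exchange the sums; the empty set contributes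
the number of all words.\<close>

lemma signed_trace:
  assumes inj: "inj_on \<iota> V"
  shows "int (card {w\<in>words S n. cyclic_word w})
    = (\<Sum>E | E \<subseteq> V \<and> odd (card E). signed_count \<iota> n E E)
      - (\<Sum>E | E \<subseteq> V \<and> E \<noteq> {} \<and> even (card E). signed_count \<iota> n E E)"
proof -
  have finw: "finite (words S n)" by (rule finite_words[OF finite_S])
  define Inv where "Inv w = {E. E \<subseteq> V \<and> embeds \<delta> E w \<and> run_image \<delta> E w = E}" for w
  have finI: "finite (Inv w)" for w
    unfolding Inv_def by (rule finite_subset[of _ "Pow V"]) (use finite_V in auto)
  have cyc: "cyclic_word w \<longleftrightarrow> Inv w \<noteq> {{}}" for w
  proof -
    have empty: "{} \<in> Inv w" by (simp add: Inv_def embeds_def run_image_def)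
    show ?thesis
    proof
      assume "cyclic_word w"
      then obtain E where E: "E \<subseteq> V" "E \<noteq> {}" "embeds \<delta> E w" "run_image \<delta> E w = E"
        unfolding cyclic_word_def by (elim exE conjE)
      have "E \<in> Inv w" unfolding Inv_def using E(1,3,4) by simp
      then show "Inv w \<noteq> {{}}" using E(2) by blast
    next
      assume ne: "Inv w \<noteq> {{}}"
      have "\<exists>E. E \<in> Inv w \<and> E \<noteq> {}"
      proof (rule ccontr)
        assume "\<not> (\<exists>E. E \<in> Inv w \<and> E \<noteq> {})"
        then have "Inv w \<subseteq> {{}}" by blast
        then have "Inv w = {{}}" using empty by blast
        with ne show False by contradiction
      qed
      then obtain E where E: "E \<in> Inv w" "E \<noteq> {}" by (elim exE conjE)
      then show "cyclic_word w"
        unfolding cyclic_word_def Inv_def by (intro exI[of _ E]) simp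
    qed
  qed
  have word: "(\<Sum>E\<in>Inv w. (-1) ^ card E * word_sign \<iota> E w) = (if cyclic_word w then 0 else 1)" for w
  proof -
    define D where "D = {u \<in> V. run \<delta> u w \<noteq> None}"
    define f where "f = (\<lambda>u. the (run \<delta> u w))"
    have D: "finite D" "D \<subseteq> V" using finite_V by (auto simp: D_def)
    have "E \<in> Inv w \<longleftrightarrow> E \<subseteq> D \<and> f ` E = E" for E
    proof
      assume "E \<in> Inv w"
      then show "E \<subseteq> D \<and> f ` E = E"
        unfolding Inv_def D_def embeds_def run_image_def f_def by auto
    next
      assume E: "E \<subseteq> D \<and> f ` E = E"
      then have "finite E" using D by (auto intro: finite_subset)
      then have fi: "inj_on f E" using E by (intro eq_card_imp_inj_on) auto
      have "inj_on (\<lambda>u. run \<delta> u w) E"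
      proof (rule inj_onI)
        fix u v assume "u \<in> E" "v \<in> E" "run \<delta> u w = run \<delta> v w"
        then show "u = v" using inj_onD[OF fi, of u v] by (simp add: f_def)
      qed
      moreover have "\<forall>u\<in>E. run \<delta> u w \<noteq> None" "E \<subseteq> V" using E unfolding D_def by auto
      moreover have "run_image \<delta> E w = E" using E by (simp add: run_image_def f_def)
      ultimately show "E \<in> Inv w" unfolding Inv_def embeds_def by simp
    qed
    from signed_invariant_sets[OF D(1) inj_on_subset[OF inj D(2)] this]
    have r: "(\<Sum>E\<in>Inv w. (-1) ^ card E * word_sign \<iota> E w) = (if Inv w = {{}} then 1 else 0)"
      unfolding word_sign_def f_def .
    show ?thesis unfolding r cyc by (cases "Inv w = {{}}") simp_all
  qed
  have tot: "(\<Sum>E\<in>Pow V. (-1) ^ card E * signed_count \<iota> n E E) = int (card {w\<in>words S n. \<not> cyclic_word w})"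
  proof -
    have "(\<Sum>E\<in>Pow V. (-1) ^ card E * signed_count \<iota> n E E)
      = (\<Sum>w\<in>words S n. \<Sum>E\<in>Pow V. if embeds \<delta> E w \<and> run_image \<delta> E w = E then (-1) ^ card E * word_sign \<iota> E w else 0)"
      unfolding signed_count_def sum_distrib_left
      by (subst sum.swap) (intro sum.cong refl, simp)
    also have "\<dots> = (\<Sum>w\<in>words S n. \<Sum>E\<in>Inv w. (-1) ^ card E * word_sign \<iota> E w)"
    proof (rule sum.cong[OF refl])
      fix w
      have "{E \<in> Pow V. embeds \<delta> E w \<and> run_image \<delta> E w = E} = Inv w" by (auto simp: Inv_def)
      then show "(\<Sum>E\<in>Pow V. if embeds \<delta> E w \<and> run_image \<delta> E w = E then (-1) ^ card E * word_sign \<iota> E w else 0)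
        = (\<Sum>E\<in>Inv w. (-1) ^ card E * word_sign \<iota> E w)"
        using finite_V by (simp flip: sum.inter_filter)
    qed
    also have "\<dots> = (\<Sum>w\<in>words S n. if cyclic_word w then 0 else 1)" by (simp only: word)
    also have "\<dots> = int (card {w\<in>words S n. \<not> cyclic_word w})"
      using finw by (simp add: sum.If_cases Int_def Collect_neg_eq[symmetric])
    finally show ?thesis .
  qed
  have empty: "signed_count \<iota> n {} {} = int (card (words S n))"
    by (simp add: signed_count_def embeds_def run_image_def word_sign_def order_sign_def)
  let ?O = "{E. E \<subseteq> V \<and> odd (card E)}" and ?E = "{E. E \<subseteq> V \<and> E \<noteq> {} \<and> even (card E)}"
  have fin: "finite ?O" "finite ?E"
    by (rule finite_subset[of _ "Pow V"]; use finite_V in auto)+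
  have un: "Pow V = insert {} (?O \<union> ?E)" by auto
  have "(\<Sum>E\<in>Pow V. (-1) ^ card E * signed_count \<iota> n E E)
    = signed_count \<iota> n {} {} + (\<Sum>E\<in>?O \<union> ?E. (-1) ^ card E * signed_count \<iota> n E E)"
    unfolding un using fin by (subst sum.insert) auto
  also have "(\<Sum>E\<in>?O \<union> ?E. (-1) ^ card E * signed_count \<iota> n E E)
    = (\<Sum>E\<in>?O. (-1) ^ card E * signed_count \<iota> n E E) + (\<Sum>E\<in>?E. (-1) ^ card E * signed_count \<iota> n E E)"
    using fin by (intro sum.union_disjoint) auto
  also have "(\<Sum>E\<in>?O. (-1) ^ card E * signed_count \<iota> n E E) = - (\<Sum>E\<in>?O. signed_count \<iota> n E E)"
    unfolding sum_negf[symmetric] by (intro sum.cong) auto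
  also have "(\<Sum>E\<in>?E. (-1) ^ card E * signed_count \<iota> n E E) = (\<Sum>E\<in>?E. signed_count \<iota> n E E)"
    by (intro sum.cong) auto
  finally have main: "int (card {w\<in>words S n. \<not> cyclic_word w}) = int (card (words S n))
    + (- (\<Sum>E\<in>?O. signed_count \<iota> n E E) + (\<Sum>E\<in>?E. signed_count \<iota> n E E))"
    unfolding tot empty .
  have "card (words S n) = card ({w\<in>words S n. cyclic_word w} \<union> {w\<in>words S n. \<not> cyclic_word w})"
    by (intro arg_cong[of _ _ card]) auto
  also have "\<dots> = card {w\<in>words S n. cyclic_word w} + card {w\<in>words S n. \<not> cyclic_word w}"
    using finw by (intro card_Un_disjoint) auto
  finally show ?thesis using main by simp
qed

end

section \<open>Power sums and rationality of the zeta function\<close>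

lemma upper_triangular_pow:
  fixes B :: "'b :: comm_ring_1 mat"
  assumes B: "B \<in> carrier_mat n n" and ut: "\<And>i j. i < n \<Longrightarrow> j < i \<Longrightarrow> B $$ (i, j) = 0"
  shows "(\<forall>i<n. \<forall>j<i. (B ^\<^sub>m k) $$ (i, j) = 0) \<and> (\<forall>i<n. (B ^\<^sub>m k) $$ (i, i) = (B $$ (i, i)) ^ k)"
proof (induction k)
  case 0
  then show ?case using B by auto
next
  case (Suc k)
  have C: "B ^\<^sub>m k \<in> carrier_mat n n" using B by simp
  have entry: "(B ^\<^sub>m Suc k) $$ (i, j) = (\<Sum>l<n. (B ^\<^sub>m k) $$ (i, l) * B $$ (l, j))" if "i < n" "j < n" for i j
    using that B C by (simp add: scalar_prod_def atLeast0LessThan)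
  have "(B ^\<^sub>m Suc k) $$ (i, j) = 0" if ij: "i < n" "j < i" for i j
  proof -
    have "(B ^\<^sub>m k) $$ (i, l) * B $$ (l, j) = 0" if "l < n" for l
      using Suc ij ut[of l j] that by (cases "l < i") auto
    then show ?thesis using entry[of i j] ij by simp
  qed
  moreover have "(B ^\<^sub>m Suc k) $$ (i, i) = (B $$ (i, i)) ^ Suc k" if i: "i < n" for i
  proof -
    have "(B ^\<^sub>m k) $$ (i, l) * B $$ (l, i) = (if l = i then (B $$ (i, i)) ^ k * B $$ (i, i) else 0)" if "l < n" for l
      using Suc i ut[of l i] that by (cases "l < i"; cases "l = i") auto
    then have "(\<Sum>l<n. (B ^\<^sub>m k) $$ (i, l) * B $$ (l, i)) = (\<Sum>l<n. if l = i then (B $$ (i, i)) ^ k * B $$ (i, i) else 0)"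
      by (intro sum.cong) auto
    then show ?thesis using entry[OF i i] i by (simp add: sum.delta mult.commute)
  qed
  ultimately show ?case by blast
qed

lemma sum_diag_mult_commute:
  fixes A B :: "'b :: comm_ring_1 mat"
  assumes "A \<in> carrier_mat n n" "B \<in> carrier_mat n n"
  shows "(\<Sum>i<n. (A * B) $$ (i, i)) = (\<Sum>i<n. (B * A) $$ (i, i))"
proof -
  have "(\<Sum>i<n. (A * B) $$ (i, i)) = (\<Sum>i<n. \<Sum>j<n. A $$ (i, j) * B $$ (j, i))"
    using assms by (intro sum.cong refl) (simp add: scalar_prod_def atLeast0LessThan)
  also have "\<dots> = (\<Sum>j<n. \<Sum>i<n. B $$ (j, i) * A $$ (i, j))"
    by (subst sum.swap) (simp add: mult.commute)
  also have "\<dots> = (\<Sum>i<n. (B * A) $$ (i, i))"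
    using assms by (intro sum.cong refl) (simp add: scalar_prod_def atLeast0LessThan)
  finally show ?thesis .
qed

text \<open>Triangularise over the complex numbers; the powers of a triangular matrix have the powers of its
diagonal entries on the diagonal.\<close>

theorem trace_of_powers:
  fixes A :: "complex mat"
  assumes A: "A \<in> carrier_mat n n"
  shows "\<exists>es. \<forall>k. (\<Sum>i<n. (A ^\<^sub>m k) $$ (i, i)) = (\<Sum>e\<leftarrow>es. e ^ k)"
proof -
  obtain as where as: "char_poly A = (\<Prod>a\<leftarrow>as. [:- a, 1:])" using char_poly_factorized[OF A] by blast
  obtain B P Q where sd: "schur_decomposition A as = (B, P, Q)" by (cases "schur_decomposition A as") auto
  have sim: "similar_mat_wit A B P Q" and ut: "upper_triangular B"
    using schur_decomposition[OF A as sd] by auto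
  have c: "B \<in> carrier_mat n n" "P \<in> carrier_mat n n" "Q \<in> carrier_mat n n" "Q * P = 1\<^sub>m n"
    using similar_mat_witD2[OF A sim] by auto
  have "(\<Sum>i<n. (A ^\<^sub>m k) $$ (i, i)) = (\<Sum>e\<leftarrow>map (\<lambda>i. B $$ (i, i)) [0..<n]. e ^ k)" for k
  proof -
    have Bk: "B ^\<^sub>m k \<in> carrier_mat n n" using c by simp
    have Ak: "A ^\<^sub>m k = P * B ^\<^sub>m k * Q" by (rule similar_mat_wit_pow_id[OF sim])
    have PB: "P * B ^\<^sub>m k \<in> carrier_mat n n" using c Bk by simp
    have "(\<Sum>i<n. (A ^\<^sub>m k) $$ (i, i)) = (\<Sum>i<n. (Q * (P * B ^\<^sub>m k)) $$ (i, i))"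
      unfolding Ak by (rule sum_diag_mult_commute[OF PB c(3)])
    also have "Q * (P * B ^\<^sub>m k) = (Q * P) * B ^\<^sub>m k" using c Bk by (intro assoc_mult_mat[symmetric]) auto
    also have "\<dots> = B ^\<^sub>m k" using c Bk by simp
    also have "(\<Sum>i<n. (B ^\<^sub>m k) $$ (i, i)) = (\<Sum>i<n. (B $$ (i, i)) ^ k)"
      using upper_triangular_pow[OF c(1), of k] ut c(1) unfolding upper_triangular_def
      by (intro sum.cong refl) auto
    also have "\<dots> = (\<Sum>e\<leftarrow>map (\<lambda>i. B $$ (i, i)) [0..<n]. e ^ k)"
      by (simp add: sum_list_map_eq_sum_count comp_def interv_sum_list_conv_sum_set_nat atLeast0LessThan)
    finally show ?thesis .
  qed
  then show ?thesis by (intro exI allI)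
qed

corollary trace_of_kernel_powers:
  fixes W :: "nat \<Rightarrow> 'i \<Rightarrow> 'i \<Rightarrow> complex"
  assumes fin: "finite I"
    and W0: "\<And>i j. i \<in> I \<Longrightarrow> j \<in> I \<Longrightarrow> W 0 i j = (if i = j then 1 else 0)"
    and WS: "\<And>n i j. i \<in> I \<Longrightarrow> j \<in> I \<Longrightarrow> W (n + 1) i j = (\<Sum>k\<in>I. W n i k * W 1 k j)"
  shows "\<exists>es. \<forall>n. (\<Sum>i\<in>I. W n i i) = (\<Sum>e\<leftarrow>es. e ^ n)"
proof -
  define N where "N = card I"
  obtain h where h: "bij_betw h {..<N} I" using ex_bij_betw_nat_finite[OF fin] unfolding N_def atLeast0LessThan by blast
  have hI: "h i \<in> I" if "i < N" for i using h that by (auto simp: bij_betw_def)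
  have hinj: "h i = h j \<longleftrightarrow> i = j" if "i < N" "j < N" for i j
    using h that by (auto simp: bij_betw_def inj_on_def)
  define A where "A = mat N N (\<lambda>(i, j). W 1 (h i) (h j))"
  have A: "A \<in> carrier_mat N N" by (simp add: A_def)
  have Ak: "\<forall>i<N. \<forall>j<N. (A ^\<^sub>m k) $$ (i, j) = W k (h i) (h j)" for k
  proof (induction k)
    case 0
    then show ?case using A W0 hI hinj by simp
  next
    case (Suc k)
    have C: "A ^\<^sub>m k \<in> carrier_mat N N" using A by simp
    have "(A ^\<^sub>m Suc k) $$ (i, j) = W (Suc k) (h i) (h j)" if ij: "i < N" "j < N" for i j
    proof -
      have "(A ^\<^sub>m Suc k) $$ (i, j) = (\<Sum>l<N. (A ^\<^sub>m k) $$ (i, l) * A $$ (l, j))"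
        using ij A C by (simp add: scalar_prod_def atLeast0LessThan)
      also have "\<dots> = (\<Sum>l<N. W k (h i) (h l) * W 1 (h l) (h j))"
        using Suc ij by (intro sum.cong refl) (simp add: A_def)
      also have "\<dots> = (\<Sum>x\<in>I. W k (h i) x * W 1 x (h j))"
        by (rule sum.reindex_bij_betw[OF h])
      also have "\<dots> = W (k + 1) (h i) (h j)" using WS[OF hI[OF ij(1)] hI[OF ij(2)], of k] by simp
      finally show ?thesis by simp
    qed
    then show ?case by blast
  qed
  obtain es where es: "\<forall>k. (\<Sum>i<N. (A ^\<^sub>m k) $$ (i, i)) = (\<Sum>e\<leftarrow>es. e ^ k)"
    using trace_of_powers[OF A] by blast
  have "(\<Sum>i\<in>I. W n i i) = (\<Sum>e\<leftarrow>es. e ^ n)" for n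
  proof -
    have "(\<Sum>i\<in>I. W n i i) = (\<Sum>i<N. W n (h i) (h i))" by (rule sum.reindex_bij_betw[OF h, symmetric])
    also have "\<dots> = (\<Sum>i<N. (A ^\<^sub>m n) $$ (i, i))" using Ak[of n] by simp
    finally show ?thesis using es by simp
  qed
  then show ?thesis by blast
qed

lemma sums_Ln_1_minus:
  fixes w :: complex
  assumes "norm w < 1"
  shows "(\<lambda>n. w ^ Suc n / of_nat (Suc n)) sums (- Ln (1 - w))"
proof -
  have "(\<lambda>n. - ((- (- w)) ^ n) / complex_of_nat n) sums Ln (1 + (- w))"
    using assms by (intro Ln_series') simp
  then have "(\<lambda>n. - (- (w ^ n) / complex_of_nat n)) sums (- Ln (1 - w))" by (intro sums_minus) simp
  then have "(\<lambda>n. w ^ n / complex_of_nat n) sums (- Ln (1 - w))" by simp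
  then show ?thesis by (subst sums_Suc_iff) simp
qed

lemma sums_power_sum_exp:
  fixes es :: "complex list"
  assumes "\<forall>e\<in>set es. norm (e * z) < 1"
  shows "\<exists>s. (\<lambda>n. (\<Sum>e\<leftarrow>es. e ^ Suc n) / of_nat (Suc n) * z ^ Suc n) sums s \<and>
    exp s = 1 / poly (\<Prod>e\<leftarrow>es. [:1, - e:]) z \<and> poly (\<Prod>e\<leftarrow>es. [:1, - e:]) z \<noteq> 0"
  using assms
proof (induction es)
  case Nil
  then show ?case by (intro exI[of _ 0]) simp
next
  case (Cons e es)
  then obtain s where s: "(\<lambda>n. (\<Sum>e\<leftarrow>es. e ^ Suc n) / of_nat (Suc n) * z ^ Suc n) sums s"
    "exp s = 1 / poly (\<Prod>e\<leftarrow>es. [:1, - e:]) z" "poly (\<Prod>e\<leftarrow>es. [:1, - e:]) z \<noteq> 0" by auto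
  have e: "norm (e * z) < 1" using Cons.prems by simp
  then have ne: "1 - e * z \<noteq> 0" by auto
  have "(\<lambda>n. (e * z) ^ Suc n / of_nat (Suc n) + (\<Sum>e\<leftarrow>es. e ^ Suc n) / of_nat (Suc n) * z ^ Suc n) sums (- Ln (1 - e * z) + s)"
    by (intro sums_add sums_Ln_1_minus[OF e] s(1))
  moreover have "(e * z) ^ Suc n / of_nat (Suc n) + (\<Sum>e\<leftarrow>es. e ^ Suc n) / of_nat (Suc n) * z ^ Suc n
    = (\<Sum>e\<leftarrow>e # es. e ^ Suc n) / of_nat (Suc n) * z ^ Suc n" for n
    by (simp only: power_mult_distrib list.map sum_list.Cons add_divide_distrib distrib_right times_divide_eq_left)
  ultimately have sm: "(\<lambda>n. (\<Sum>e\<leftarrow>e # es. e ^ Suc n) / of_nat (Suc n) * z ^ Suc n) sums (- Ln (1 - e * z) + s)"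
    by (simp only:)
  have pe: "poly (\<Prod>e\<leftarrow>e # es. [:1, - e:]) z = (1 - e * z) * poly (\<Prod>e\<leftarrow>es. [:1, - e:]) z"
    by (simp add: algebra_simps)
  have "exp (- Ln (1 - e * z) + s) = 1 / poly (\<Prod>e\<leftarrow>e # es. [:1, - e:]) z"
    unfolding pe exp_add exp_minus s(2) exp_Ln[OF ne] by (simp add: divide_inverse)
  with sm show ?case
    unfolding pe using s(3) ne by (intro exI[of _ "- Ln (1 - e * z) + s"]) simp
qed

text \<open>\<open>exp (\<Sum>n. (e z) ^ n / n) = 1 / (1 - e z)\<close> for each eigenvalue \<open>e\<close>; a common factor of numerator and
denominator is divided out.\<close>

theorem is_zeta_fraction_power_sums:
  fixes es fs :: "complex list"
  assumes F: "\<And>n. n > 0 \<Longrightarrow> of_nat (fixed_point_count X n) = (\<Sum>e\<leftarrow>es. e ^ n) - (\<Sum>f\<leftarrow>fs. f ^ n)"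
  shows "\<exists>P Q. is_zeta_fraction X P Q"
proof -
  define P0 where "P0 = (\<Prod>f\<leftarrow>fs. [:1, - f:])"
  define Q0 where "Q0 = (\<Prod>e\<leftarrow>es. [:1, - e:])"
  define g where "g = gcd P0 Q0"
  define P where "P = P0 div g"
  define Q where "Q = Q0 div g"
  have Q0: "Q0 \<noteq> 0" unfolding Q0_def prod_list_zero_iff by auto
  then have g0: "g \<noteq> 0" by (simp add: g_def)
  have PQ: "P0 = P * g" "Q0 = Q * g" by (simp_all add: P_def Q_def g_def)
  have cop: "coprime P Q" unfolding P_def Q_def g_def using Q0 by (intro div_gcd_coprime) simp
  define B where "B = 1 + (\<Sum>e\<in>set (es @ fs). norm e)"
  have B: "B > 0" "\<And>e. e \<in> set es \<or> e \<in> set fs \<Longrightarrow> norm e \<le> B"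
  proof -
    show "B > 0" unfolding B_def by (intro add_pos_nonneg sum_nonneg) auto
    show "norm e \<le> B" if "e \<in> set es \<or> e \<in> set fs" for e
    proof -
      have "norm e \<le> (\<Sum>e\<in>set (es @ fs). norm e)" using that by (intro member_le_sum) auto
      then show ?thesis by (simp add: B_def)
    qed
  qed
  have near: "eventually (\<lambda>z::complex. norm z < 1 / B) (nhds 0)"
  proof -
    have "eventually (\<lambda>z::complex. z \<in> ball 0 (1 / B)) (nhds 0)"
      using B(1) by (intro eventually_nhds_in_open) auto
    then show ?thesis by (simp add: dist_norm)
  qed
  have main: "summable (\<lambda>n. zeta_term X z (Suc n)) \<and> poly P z / poly Q z = exp (\<Sum>n. zeta_term X z (Suc n))"
    if z: "norm z < 1 / B" for z
  proof -
    have small: "norm (e * z) < 1" if "e \<in> set es \<or> e \<in> set fs" for e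
    proof -
      have "norm (e * z) \<le> B * norm z" using B(2)[OF that] by (simp add: norm_mult mult_right_mono)
      also have "\<dots> < 1" using z B(1) by (simp add: field_simps)
      finally show ?thesis .
    qed
    have "\<forall>e\<in>set es. norm (e * z) < 1" using small by simp
    from sums_power_sum_exp[OF this, folded Q0_def]
    obtain s where s: "(\<lambda>n. (\<Sum>e\<leftarrow>es. e ^ Suc n) / of_nat (Suc n) * z ^ Suc n) sums s"
      "exp s = 1 / poly Q0 z" "poly Q0 z \<noteq> 0"
      by (elim exE conjE)
    have "\<forall>e\<in>set fs. norm (e * z) < 1" using small by simp
    from sums_power_sum_exp[OF this, folded P0_def]
    obtain t where t: "(\<lambda>n. (\<Sum>e\<leftarrow>fs. e ^ Suc n) / of_nat (Suc n) * z ^ Suc n) sums t"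
      "exp t = 1 / poly P0 z" "poly P0 z \<noteq> 0"
      by (elim exE conjE)
    have "zeta_term X z (Suc n) = (\<Sum>e\<leftarrow>es. e ^ Suc n) / of_nat (Suc n) * z ^ Suc n
       - (\<Sum>e\<leftarrow>fs. e ^ Suc n) / of_nat (Suc n) * z ^ Suc n" for n
      unfolding zeta_term_def F[OF zero_less_Suc] by (simp only: diff_divide_distrib left_diff_distrib)
    then have sm: "(\<lambda>n. zeta_term X z (Suc n)) sums (s - t)" using sums_diff[OF s(1) t(1)] by simp
    have "exp (s - t) = poly P0 z / poly Q0 z" unfolding exp_diff s(2) t(2) by simp
    also have "\<dots> = poly P z / poly Q z" using s(3) by (simp add: PQ)
    finally show ?thesis using sums_summable[OF sm] sums_unique[OF sm] by simp
  qed
  have "eventually (\<lambda>z. summable (\<lambda>n. zeta_term X z (Suc n)) \<and>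
      poly P z / poly Q z = exp (\<Sum>n. zeta_term X z (Suc n))) (nhds 0)"
    using near by eventually_elim (rule main)
  moreover have "Q \<noteq> 0" using Q0 PQ by auto
  ultimately show ?thesis
    unfolding is_zeta_fraction_def using cop by (intro exI[of _ P] exI[of _ Q] conjI)
qed

text \<open>A word that embeds a set preserves its size, so the signed counts restricted to the sets of odd
size, and to the nonempty sets of even size, are again powers of matrices.\<close>

theorem (in automaton) cyclic_words_power_sums:
  "\<exists>es fs :: complex list. \<forall>n. of_nat (card {w\<in>words S n. cyclic_word w})
     = (\<Sum>e\<leftarrow>es. e ^ n) - (\<Sum>f\<leftarrow>fs. f ^ n)"
proof -
  obtain \<iota> :: "'v \<Rightarrow> nat" where \<iota>: "inj_on \<iota> V"
    using finite_imp_inj_to_nat_seg[OF finite_V] by blast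
  have ex: "\<exists>es :: complex list. \<forall>n. (\<Sum>E\<in>I. of_int (signed_count \<iota> n E E)) = (\<Sum>e\<leftarrow>es. e ^ n)"
    if I: "I \<subseteq> Pow V" and closed: "\<And>E E'. E \<in> I \<Longrightarrow> E' \<in> Pow V \<Longrightarrow> card E' = card E \<Longrightarrow> E' \<in> I" for I
  proof (rule trace_of_kernel_powers[where W = "\<lambda>n E E'. of_int (signed_count \<iota> n E E')"])
    show "finite I" by (rule finite_subset[OF I]) (simp add: finite_V)
    show "of_int (signed_count \<iota> 0 E E') = (if E = E' then 1 else (0 :: complex))" for E E'
      by (simp add: signed_count_0)
    show "of_int (signed_count \<iota> (n + 1) E E'')
      = (\<Sum>E'\<in>I. of_int (signed_count \<iota> n E E') * of_int (signed_count \<iota> 1 E' E'') :: complex)"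
      if E: "E \<in> I" for n E E''
    proof -
      have "signed_count \<iota> (n + 1) E E'' = (\<Sum>E'\<in>Pow V. signed_count \<iota> n E E' * signed_count \<iota> 1 E' E'')"
        by (rule signed_count_add[OF \<iota>]) (use E I in auto)
      also have "\<dots> = (\<Sum>E'\<in>I. signed_count \<iota> n E E' * signed_count \<iota> 1 E' E'')"
      proof (rule sum.mono_neutral_right)
        show "\<forall>E'\<in>Pow V - I. signed_count \<iota> n E E' * signed_count \<iota> 1 E' E'' = 0"
        proof
          fix E' assume E': "E' \<in> Pow V - I"
          then have "card E' \<noteq> card E" using closed[OF E] by blast
          then have "signed_count \<iota> n E E' = 0" using signed_count_card by blast
          then show "signed_count \<iota> n E E' * signed_count \<iota> 1 E' E'' = 0" by simp
        qed
      qed (use I finite_V in auto)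
      finally show ?thesis by simp
    qed
  qed
  obtain es :: "complex list" where es:
    "\<forall>n. (\<Sum>E | E \<subseteq> V \<and> odd (card E). of_int (signed_count \<iota> n E E)) = (\<Sum>e\<leftarrow>es. e ^ n)"
    using ex[of "{E. E \<subseteq> V \<and> odd (card E)}"] by auto
  have "\<exists>fs :: complex list. \<forall>n. (\<Sum>E | E \<subseteq> V \<and> E \<noteq> {} \<and> even (card E). of_int (signed_count \<iota> n E E)) = (\<Sum>e\<leftarrow>fs. e ^ n)"
  proof (rule ex)
    fix E E' assume E: "E \<in> {E. E \<subseteq> V \<and> E \<noteq> {} \<and> even (card E)}" "E' \<in> Pow V" "card E' = card E"
    have "finite E" using E(1) finite_V by (auto intro: finite_subset)
    then have "card E' \<noteq> 0" using E by simp
    then show "E' \<in> {E. E \<subseteq> V \<and> E \<noteq> {} \<and> even (card E)}" using E by auto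
  qed auto
  then obtain fs :: "complex list" where fs:
    "\<forall>n. (\<Sum>E | E \<subseteq> V \<and> E \<noteq> {} \<and> even (card E). of_int (signed_count \<iota> n E E)) = (\<Sum>e\<leftarrow>fs. e ^ n)"
    by blast
  have "of_nat (card {w\<in>words S n. cyclic_word w}) = (\<Sum>e\<leftarrow>es. e ^ n) - (\<Sum>f\<leftarrow>fs. f ^ n)" for n
  proof -
    have "(of_nat (card {w\<in>words S n. cyclic_word w}) :: complex) = of_int (int (card {w\<in>words S n. cyclic_word w}))" by simp
    also have "\<dots> = (\<Sum>e\<leftarrow>es. e ^ n) - (\<Sum>f\<leftarrow>fs. f ^ n)"
      unfolding signed_trace[OF \<iota>] using es fs by simp
    finally show ?thesis .
  qed
  then show ?thesis by blast
qed

section \<open>The zeta function at its dominant pole\<close>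

text \<open>Subtracting \<open>-ln (1 - lam ^ p * z ^ p)\<close> from the series in the exponent leaves the power series
with coefficients \<open>c n\<close>, which converges for \<open>\<bar>z\<bar> < 1 / \<beta>\<close>, a disc with \<open>1 / lam\<close> in its
interior.  The resulting identity between holomorphic functions, known near \<open>0\<close>, extends to this
disc by the identity theorem.\<close>

lemma zeta_residue:
  fixes lam \<beta> C :: real
  assumes PQ: "is_zeta_fraction X P Q" and p: "p > 0" and \<beta>: "0 < \<beta>" "\<beta> < lam"
    and F: "\<And>n. n > 0 \<Longrightarrow>
      \<bar>real (fixed_point_count X n) - (if p dvd n then real p * lam ^ n else 0)\<bar> \<le> C * \<beta> ^ n"
  defines "c \<equiv> \<lambda>n. (real (fixed_point_count X n) - (if p dvd n then real p * lam ^ n else 0)) / real n"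
  shows "summable (\<lambda>n. c (Suc n) / lam ^ Suc n)"
    and "((\<lambda>z::complex. (1 - of_real lam ^ p * z ^ p) * artin_mazur_zeta X z) \<longlongrightarrow>
          of_real (exp (\<Sum>n. c (Suc n) / lam ^ Suc n))) (at (of_real (inverse lam)))"
proof -
  have lam: "lam > 0" using \<beta> by simp
  have c_le: "\<bar>c (Suc n)\<bar> \<le> C * \<beta> ^ Suc n" for n
  proof -
    have "\<bar>c (Suc n)\<bar> = \<bar>real (fixed_point_count X (Suc n)) - (if p dvd Suc n then real p * lam ^ Suc n else 0)\<bar> / real (Suc n)"
      unfolding c_def by (simp only: abs_divide abs_of_nat)
    also have "\<dots> \<le> (C * \<beta> ^ Suc n) / real (Suc n)" by (intro divide_right_mono F) auto
    also have "\<dots> \<le> (C * \<beta> ^ Suc n) / 1"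
    proof (rule divide_left_mono)
      have "0 \<le> \<bar>real (fixed_point_count X (Suc n)) - (if p dvd Suc n then real p * lam ^ Suc n else 0)\<bar>" by simp
      also have "\<dots> \<le> C * \<beta> ^ Suc n" by (rule F) simp
      finally show "0 \<le> C * \<beta> ^ Suc n" .
    qed auto
    finally show ?thesis by simp
  qed
  \<comment> \<open>Radius of a disc around \<open>0\<close> that contains \<open>1 / lam\<close> and on which the corrected series converges.\<close>
  define R where "R = 1 / \<beta>"
  have R: "R > 0" "1 / lam < R" using \<beta> lam by (simp_all add: R_def field_simps)
  have sm: "summable (\<lambda>n. of_real (c (Suc n)) * z ^ Suc n)" if z: "norm z < R" for z :: complex
  proof (rule summable_norm_cancel, rule summable_comparison_test)
    show "\<exists>N. \<forall>n\<ge>N. norm (norm (complex_of_real (c (Suc n)) * z ^ Suc n)) \<le> C * (\<beta> * norm z) ^ Suc n"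
    proof (intro exI allI impI)
      fix n
      have "norm (norm (complex_of_real (c (Suc n)) * z ^ Suc n)) = \<bar>c (Suc n)\<bar> * norm z ^ Suc n"
        by (simp add: norm_mult norm_power)
      also have "\<dots> \<le> (C * \<beta> ^ Suc n) * norm z ^ Suc n" by (intro mult_right_mono c_le) simp
      finally show "norm (norm (complex_of_real (c (Suc n)) * z ^ Suc n)) \<le> C * (\<beta> * norm z) ^ Suc n"
        by (simp only: power_mult_distrib mult.assoc)
    qed
    have "\<beta> * norm z < 1" using z \<beta> by (simp add: R_def field_simps)
    then have "summable (\<lambda>n. (\<beta> * norm z) ^ n)" using \<beta> by (intro summable_geometric) simp
    then have "summable (\<lambda>n. (\<beta> * norm z) ^ Suc n)" by (subst summable_Suc_iff)
    then show "summable (\<lambda>n. C * (\<beta> * norm z) ^ Suc n)" by (rule summable_mult)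
  qed
  define g where "g z = (\<Sum>n. of_real (c (Suc n)) * z ^ Suc n)" for z :: complex
  have g_sums: "(\<lambda>n. of_real (c (Suc n)) * z ^ Suc n) sums g z" if "norm z < R" for z
    unfolding g_def using sm[OF that] by (rule summable_sums)
  define a where "a n = complex_of_real (if n = 0 then 0 else c n)" for n
  have "(\<lambda>n. a n * (z - 0) ^ n) sums g z" if "z \<in> ball 0 R" for z
  proof -
    have "norm z < R" using that by simp
    from g_sums[OF this] have "(\<lambda>n. a (Suc n) * z ^ Suc n) sums g z" by (simp add: a_def)
    then show ?thesis by (subst (asm) sums_Suc_iff) (simp add: a_def)
  qed
  then have g_hol: "g holomorphic_on ball 0 R" by (rule power_series_holomorphic)
  have zeta_near: "eventually (\<lambda>z. (1 - of_real lam ^ p * z ^ p) * poly P z = exp (g z) * poly Q z) (nhds 0)"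
  proof -
    have ev: "eventually (\<lambda>z. z \<in> ball 0 (1 / lam)) (nhds (0::complex))"
      using lam by (intro eventually_nhds_in_open) auto
    have "eventually (\<lambda>z. summable (\<lambda>n. zeta_term X z (Suc n)) \<and>
        poly P z / poly Q z = exp (\<Sum>n. zeta_term X z (Suc n))) (nhds 0)"
      using PQ by (simp add: is_zeta_fraction_def)
    with ev show ?thesis
    proof eventually_elim
      case (elim z)
      then have z: "norm z < 1 / lam" and zR: "norm z < R" using R by auto
      define w where "w = of_real lam ^ p * z ^ p"
      have w: "norm w < 1"
      proof -
        have "norm w = (lam * norm z) ^ p" using lam by (simp add: w_def norm_mult norm_power power_mult_distrib)
        also have "\<dots> < 1" using z lam p by (intro power_less_one_iff[THEN iffD2]) (auto simp: field_simps)
        finally show ?thesis .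
      qed
      let ?b = "\<lambda>n. if p dvd n then (of_nat p * (of_real lam * z) ^ n) / of_nat n else 0"
      have "(\<lambda>m. - ((- (- w)) ^ m) / complex_of_nat m) sums Ln (1 + (- w))"
        using w by (intro Ln_series') simp
      then have "(\<lambda>m. - (- (w ^ m) / complex_of_nat m)) sums (- Ln (1 - w))" by (intro sums_minus) simp
      then have Ln_sums: "(\<lambda>m. w ^ m / complex_of_nat m) sums (- Ln (1 - w))" by simp
      have "w ^ m / complex_of_nat m = ?b (m * p)" for m
        using p by (simp add: w_def power_mult_distrib flip: power_mult) (simp add: mult.commute)
      then have "(\<lambda>m. ?b (m * p)) sums (- Ln (1 - w))" using Ln_sums by simp
      moreover have "strict_mono (\<lambda>m. m * p)" using p by (intro strict_monoI) simp
      moreover have "?b n = 0" if "n \<notin> range (\<lambda>m. m * p)" for n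
        using that by (auto simp: dvd_def mult.commute)
      ultimately have "?b sums (- Ln (1 - w))" using sums_mono_reindex[of "\<lambda>m. m * p" ?b] by simp
      then have b_sums: "(\<lambda>n. ?b (Suc n)) sums (- Ln (1 - w))" by (subst sums_Suc_iff) simp
      have zt: "zeta_term X z (Suc n) = of_real (c (Suc n)) * z ^ Suc n + ?b (Suc n)" for n
        by (simp add: zeta_term_def c_def power_mult_distrib field_simps del: of_nat_Suc)
      have "(\<lambda>n. zeta_term X z (Suc n)) sums (g z + (- Ln (1 - w)))"
        unfolding zt by (intro sums_add g_sums zR b_sums)
      then have e: "poly P z / poly Q z = exp (g z + (- Ln (1 - w)))" using elim sums_unique by metis
      have w1: "1 - w \<noteq> 0" using w by auto
      have "exp (g z + (- Ln (1 - w))) = exp (g z) / (1 - w)"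
        unfolding exp_add exp_minus exp_Ln[OF w1] by (simp add: divide_inverse)
      then have e2: "poly P z / poly Q z = exp (g z) / (1 - w)" using e by simp
      have "poly Q z \<noteq> 0"
      proof
        assume "poly Q z = 0"
        then show False using e2 w1 by simp
      qed
      then have "(1 - w) * poly P z = exp (g z) * poly Q z" using e2 w1 by (simp add: field_simps)
      then show ?case by (simp add: w_def)
    qed
  qed
  have zeta_all: "(1 - of_real lam ^ p * z ^ p) * poly P z = exp (g z) * poly Q z" if z: "z \<in> ball 0 R" for z
  proof -
    from zeta_near[unfolded eventually_nhds]
    obtain U where U0: "open U \<and> 0 \<in> U \<and>
        (\<forall>z\<in>U. (1 - of_real lam ^ p * z ^ p) * poly P z = exp (g z) * poly Q z)" by (elim exE)
    then have U: "open U" "0 \<in> U"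
      "\<And>z. z \<in> U \<Longrightarrow> (1 - of_real lam ^ p * z ^ p) * poly P z = exp (g z) * poly Q z" by auto
    show ?thesis
    proof (rule analytic_continuation_open[where s = "U \<inter> ball 0 R" and s' = "ball 0 R"
        and f = "\<lambda>z. (1 - of_real lam ^ p * z ^ p) * poly P z" and g = "\<lambda>z. exp (g z) * poly Q z"])
      show "U \<inter> ball 0 R \<noteq> {}" using U(2) R(1) by auto
      show "(\<lambda>z. exp (g z) * poly Q z) holomorphic_on ball 0 R"
        by (intro holomorphic_intros g_hol)
      show "(\<lambda>z. (1 - of_real lam ^ p * z ^ p) * poly P z) holomorphic_on ball 0 R"
        by (intro holomorphic_intros)
    qed (use U z in auto)
  qed
  let ?z0 = "complex_of_real (inverse lam)"
  have nz0: "norm ?z0 = 1 / lam"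
  proof -
    have "norm ?z0 = \<bar>inverse lam\<bar>" by (rule norm_of_real)
    then show ?thesis using lam by (simp only: inverse_eq_divide abs_of_pos zero_less_divide_1_iff)
  qed
  have z0: "?z0 \<in> ball 0 R" using nz0 R(2) by simp
  have term_eq: "of_real (c (Suc n)) * ?z0 ^ Suc n = complex_of_real (c (Suc n) / lam ^ Suc n)" for n
    by (simp only: of_real_mult[symmetric] of_real_power[symmetric] power_inverse divide_inverse)
  have "summable (\<lambda>n. complex_of_real (c (Suc n) / lam ^ Suc n))"
    using sm[of ?z0] z0 unfolding term_eq by simp
  then show smr: "summable (\<lambda>n. c (Suc n) / lam ^ Suc n)" by (simp only: summable_of_real_iff)
  have gz0: "g ?z0 = of_real (\<Sum>n. c (Suc n) / lam ^ Suc n)"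
    unfolding g_def term_eq by (rule suminf_of_real[OF smr, symmetric])
  have "isCont (\<lambda>z. exp (g z)) ?z0"
  proof -
    have "continuous_on (ball 0 R) g" by (rule holomorphic_on_imp_continuous_on[OF g_hol])
    then have "isCont g ?z0" using z0 by (simp add: continuous_on_eq_continuous_at)
    then show ?thesis by (intro continuous_intros)
  qed
  then have lim: "((\<lambda>z. exp (g z)) \<longlongrightarrow> exp (g ?z0)) (at ?z0)" by (simp add: isCont_def)
  have "eventually (\<lambda>z. exp (g z) = (1 - of_real lam ^ p * z ^ p) * artin_mazur_zeta X z) (at ?z0)"
  proof -
    have Qne: "Q \<noteq> 0" using PQ by (simp add: is_zeta_fraction_def)
    have e1: "eventually (\<lambda>z. z \<in> ball 0 R) (at ?z0)" using z0 by (intro eventually_at_in_open') auto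
    have e2: "eventually (\<lambda>z. poly Q z \<noteq> 0) (at ?z0)"
    proof -
      have fin: "finite ({z. poly Q z = 0} - {?z0})" using poly_roots_finite[OF Qne] by simp
      have op: "open (- ({z. poly Q z = 0} - {?z0}))" using finite_imp_closed[OF fin] by (rule open_Compl)
      have "?z0 \<in> - ({z. poly Q z = 0} - {?z0})" by blast
      from eventually_at_in_open[OF op this] show ?thesis by (rule eventually_mono) blast
    qed
    show ?thesis using e1 e2
    proof eventually_elim
      case (elim z)
      have az: "artin_mazur_zeta X z = poly P z / poly Q z" using zeta_eq_fraction[OF PQ] by simp
      show ?case unfolding az times_divide_eq_right zeta_all[OF elim(1)] using elim(2) by simp
    qed
  qed
  from Lim_transform_eventually[OF lim this]
  show "((\<lambda>z::complex. (1 - of_real lam ^ p * z ^ p) * artin_mazur_zeta X z) \<longlongrightarrow>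
          of_real (exp (\<Sum>n. c (Suc n) / lam ^ Suc n))) (at ?z0)"
    unfolding gz0 exp_of_real .
qed

section \<open>Closed orbits and fixed points\<close>

definition orbit_number :: "(int \<Rightarrow> 'a) set \<Rightarrow> nat \<Rightarrow> nat" where
  "orbit_number X d = card {\<tau> \<in> closed_orbits X. card \<tau> = d}"

locale finite_periodic_shift =
  fixes X :: "(int \<Rightarrow> 'a) set"
  assumes invariant: "x \<in> X \<Longrightarrow> shift_map x \<in> X"
    and finite_fixed: "n > 0 \<Longrightarrow> finite {x \<in> X. (shift_map ^^ n) x = x}"
begin

lemma orbit_in: "x \<in> X \<Longrightarrow> (shift_map ^^ i) x \<in> X"
  by (induction i) (auto intro: invariant)

lemma orbit_eq_range:
  assumes "n > 0" "(shift_map ^^ n) x = x"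
  shows "{(shift_map ^^ k) x | k. k < n} = range (\<lambda>i. (shift_map ^^ i) x)"
proof (intro equalityI subsetI)
  fix y assume "y \<in> range (\<lambda>i. (shift_map ^^ i) x)"
  then obtain i where i: "y = (shift_map ^^ i) x" by blast
  then have "y = (shift_map ^^ (i mod n)) x" using funpow_mod_eq[OF assms(2)] by simp
  moreover have "i mod n < n" using assms(1) by simp
  ultimately show "y \<in> {(shift_map ^^ k) x | k. k < n}" by blast
qed blast

lemma closed_orbitE:
  assumes "\<tau> \<in> closed_orbits X"
  obtains x where "x \<in> X" "\<tau> = range (\<lambda>i. (shift_map ^^ i) x)" "finite \<tau>" "card \<tau> > 0"
    "\<And>n. (shift_map ^^ n) x = x \<longleftrightarrow> card \<tau> dvd n"
proof -
  obtain x n where x: "\<tau> = {(shift_map ^^ k) x | k. k < n}" "x \<in> X" "n \<ge> 1" "(shift_map ^^ n) x = x"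
    "\<forall>k. 1 \<le> k \<and> k \<le> n - 1 \<longrightarrow> (shift_map ^^ k) x \<noteq> x"
    using assms unfolding closed_orbits_def by blast
  have least: "(shift_map ^^ k) x \<noteq> x" if "0 < k" "k < n" for k using x(5) that by auto
  have \<tau>: "\<tau> = (\<lambda>k. (shift_map ^^ k) x) ` {0..<n}" unfolding x(1) by auto
  have card: "card \<tau> = n"
    unfolding \<tau> using card_image[OF inj_on_funpow_least[OF x(4) least]] by simp
  have "(shift_map ^^ m) x = x \<longleftrightarrow> n dvd m" for m
  proof -
    have "(shift_map ^^ m) x = (shift_map ^^ (m mod n)) x" by (rule funpow_mod_eq[OF x(4), symmetric])
    moreover have "m mod n < n" using x(3) by simp
    ultimately show ?thesis using least[of "m mod n"] by (cases "m mod n = 0") (auto simp: dvd_eq_mod_eq_0)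
  qed
  moreover have "\<tau> = range (\<lambda>i. (shift_map ^^ i) x)" using orbit_eq_range[of n x] x by simp
  moreover have "finite \<tau>" unfolding \<tau> by simp
  ultimately show thesis using that[of x] card x by simp
qed

lemma periodic_in_orbit:
  assumes "x \<in> X" "n > 0" "(shift_map ^^ n) x = x"
  shows "range (\<lambda>i. (shift_map ^^ i) x) \<in> closed_orbits X"
proof -
  have ex: "\<exists>n. n > 0 \<and> (shift_map ^^ n) x = x" using assms by blast
  define m where "m = (LEAST n. n > 0 \<and> (shift_map ^^ n) x = x)"
  have m: "m > 0" "(shift_map ^^ m) x = x" using LeastI_ex[OF ex] unfolding m_def by auto
  have "(shift_map ^^ k) x \<noteq> x" if "1 \<le> k \<and> k \<le> m - 1" for k
  proof -
    have "k < m" "k > 0" using that m(1) by linarith+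
    then show ?thesis
      using not_less_Least[of k "\<lambda>n. n > 0 \<and> (shift_map ^^ n) x = x", folded m_def] by blast
  qed
  then show ?thesis
    unfolding closed_orbits_def using orbit_eq_range[OF m] m assms(1)
    by (intro CollectI exI[of _ x] exI[of _ m]) simp
qed

lemma orbit_of_member:
  assumes \<tau>: "\<tau> \<in> closed_orbits X" and y: "y \<in> \<tau>"
  shows "y \<in> X" "\<tau> = range (\<lambda>i. (shift_map ^^ i) y)" "(shift_map ^^ n) y = y \<longleftrightarrow> card \<tau> dvd n"
proof -
  obtain x where x: "x \<in> X" "\<tau> = range (\<lambda>i. (shift_map ^^ i) x)" "card \<tau> > 0"
    "\<And>n. (shift_map ^^ n) x = x \<longleftrightarrow> card \<tau> dvd n"
    by (rule closed_orbitE[OF \<tau>], rule that)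
  obtain k where k: "y = (shift_map ^^ k) x" using x(2) y by blast
  show "y \<in> X" using k orbit_in[OF x(1)] by simp
  have xk: "(shift_map ^^ (card \<tau> * Suc k - k)) y = x"
  proof -
    have le: "k \<le> card \<tau> * Suc k" using x(3) by (cases "card \<tau>") auto
    have "(shift_map ^^ (card \<tau> * Suc k - k)) y = (shift_map ^^ (card \<tau> * Suc k - k + k)) x"
      unfolding k by (simp only: funpow_add comp_apply)
    also have "\<dots> = x" using le x(4)[of "card \<tau> * Suc k"] by simp
    finally show ?thesis .
  qed
  show "\<tau> = range (\<lambda>i. (shift_map ^^ i) y)"
  proof (intro equalityI subsetI)
    fix z assume "z \<in> \<tau>"
    then obtain i where "z = (shift_map ^^ i) x" using x(2) by blast
    then have "z = (shift_map ^^ (i + (card \<tau> * Suc k - k))) y" using xk by (simp only: funpow_add comp_apply)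
    then show "z \<in> range (\<lambda>i. (shift_map ^^ i) y)" by blast
  next
    fix z assume "z \<in> range (\<lambda>i. (shift_map ^^ i) y)"
    then obtain i where "z = (shift_map ^^ i) y" by blast
    then have "z = (shift_map ^^ (i + k)) x" unfolding k by (simp only: funpow_add comp_apply)
    then show "z \<in> \<tau>" using x(2) by blast
  qed
  show "(shift_map ^^ n) y = y \<longleftrightarrow> card \<tau> dvd n"
  proof
    assume n: "(shift_map ^^ n) y = y"
    let ?j = "card \<tau> * Suc k - k"
    have "(shift_map ^^ n) x = (shift_map ^^ (n + ?j)) y" using xk by (simp only: funpow_add comp_apply)
    also have "n + ?j = ?j + n" by (rule add.commute)
    also have "(shift_map ^^ (?j + n)) y = x" using n xk by (simp only: funpow_add comp_apply)
    finally show "card \<tau> dvd n" using x(4) by blast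
  next
    assume "card \<tau> dvd n"
    then have n: "(shift_map ^^ n) x = x" using x(4) by blast
    have "(shift_map ^^ n) y = (shift_map ^^ (n + k)) x" unfolding k by (simp only: funpow_add comp_apply)
    also have "n + k = k + n" by (rule add.commute)
    also have "(shift_map ^^ (k + n)) x = y" using n k by (simp only: funpow_add comp_apply)
    finally show "(shift_map ^^ n) y = y" .
  qed
qed

lemma fixed_points_eq_Union:
  assumes "n > 0"
  shows "{x \<in> X. (shift_map ^^ n) x = x} = \<Union>{\<tau> \<in> closed_orbits X. card \<tau> dvd n}"
proof (intro equalityI subsetI)
  fix x assume "x \<in> {x \<in> X. (shift_map ^^ n) x = x}"
  then have x: "x \<in> X" "(shift_map ^^ n) x = x" by auto
  let ?\<tau> = "range (\<lambda>i. (shift_map ^^ i) x)"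
  have \<tau>: "?\<tau> \<in> closed_orbits X" by (rule periodic_in_orbit[OF x(1) assms x(2)])
  have "(shift_map ^^ 0) x \<in> ?\<tau>" by (rule rangeI)
  then have xin: "x \<in> ?\<tau>" by simp
  have "card ?\<tau> dvd n" using orbit_of_member(3)[OF \<tau> xin, of n] x(2) by blast
  then show "x \<in> \<Union>{\<tau> \<in> closed_orbits X. card \<tau> dvd n}" using \<tau> xin by blast
next
  fix x assume "x \<in> \<Union>{\<tau> \<in> closed_orbits X. card \<tau> dvd n}"
  then obtain \<tau> where \<tau>: "\<tau> \<in> closed_orbits X" "card \<tau> dvd n" "x \<in> \<tau>" by blast
  then show "x \<in> {x \<in> X. (shift_map ^^ n) x = x}"
    using orbit_of_member(1)[OF \<tau>(1,3)] orbit_of_member(3)[OF \<tau>(1,3), of n] by simp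
qed

lemma finite_orbits_dvd:
  assumes "n > 0"
  shows "finite {\<tau> \<in> closed_orbits X. card \<tau> dvd n}"
  by (rule finite_UnionD) (use finite_fixed[OF assms] fixed_points_eq_Union[OF assms] in simp)

lemma card_orbit_pos: "\<tau> \<in> closed_orbits X \<Longrightarrow> card \<tau> > 0"
  by (rule closed_orbitE)

lemma finite_orbits_card: "finite {\<tau> \<in> closed_orbits X. card \<tau> = d}"
proof (cases "d = 0")
  case True
  have e: "{\<tau> \<in> closed_orbits X. card \<tau> = d} = {}" using True card_orbit_pos by fastforce
  show ?thesis unfolding e by simp
next
  case False
  show ?thesis by (rule finite_subset[OF _ finite_orbits_dvd[of d]]) (use False in auto)
qed

text \<open>The points fixed by the \<open>n\<close>-th power are the disjoint union of the closed orbits whose size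
divides \<open>n\<close>.\<close>

theorem fixed_point_count_orbits:
  assumes n: "n > 0"
  shows "fixed_point_count X n = (\<Sum>d | d dvd n. d * orbit_number X d)"
proof -
  let ?C = "{\<tau> \<in> closed_orbits X. card \<tau> dvd n}"
  have "disjoint ?C"
  proof (rule disjointI)
    fix \<tau> \<tau>' assume "\<tau> \<in> ?C" "\<tau>' \<in> ?C" "\<tau> \<noteq> \<tau>'"
    then have t: "\<tau> \<in> closed_orbits X" "\<tau>' \<in> closed_orbits X" by auto
    show "\<tau> \<inter> \<tau>' = {}"
    proof (rule ccontr)
      assume "\<tau> \<inter> \<tau>' \<noteq> {}"
      then obtain y where y: "y \<in> \<tau>" "y \<in> \<tau>'" by blast
      show False using orbit_of_member(2)[OF t(1) y(1)] orbit_of_member(2)[OF t(2) y(2)] \<open>\<tau> \<noteq> \<tau>'\<close> by simp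
    qed
  qed
  moreover have "finite \<tau>" if "\<tau> \<in> ?C" for \<tau>
  proof -
    have "\<tau> \<in> closed_orbits X" using that by simp
    then show ?thesis by (rule closed_orbitE)
  qed
  ultimately have "card (\<Union>?C) = sum card ?C" by (rule card_Union_disjoint)
  then have "fixed_point_count X n = sum card ?C"
    unfolding fixed_point_count_def fixed_points_eq_Union[OF n] .
  also have "\<dots> = (\<Sum>d | d dvd n. \<Sum>\<tau> | \<tau> \<in> ?C \<and> card \<tau> = d. card \<tau>)"
    by (rule sum.group[symmetric]) (use finite_orbits_dvd[OF n] n in auto)
  also have "\<dots> = (\<Sum>d | d dvd n. d * orbit_number X d)"
  proof (rule sum.cong[OF refl])
    fix d assume "d \<in> {d. d dvd n}"
    then have eq: "{\<tau>. \<tau> \<in> ?C \<and> card \<tau> = d} = {\<tau> \<in> closed_orbits X. card \<tau> = d}" by auto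
    have "(\<Sum>\<tau> | \<tau> \<in> ?C \<and> card \<tau> = d. card \<tau>) = (\<Sum>\<tau> | \<tau> \<in> closed_orbits X \<and> card \<tau> = d. d)"
      unfolding eq by (rule sum.cong) auto
    also have "\<dots> = d * orbit_number X d" by (simp add: orbit_number_def)
    finally show "(\<Sum>\<tau> | \<tau> \<in> ?C \<and> card \<tau> = d. card \<tau>) = d * orbit_number X d" .
  qed
  finally show ?thesis .
qed

lemma orbits_le:
  "{\<tau>. \<tau> \<in> closed_orbits X \<and> card \<tau> \<le> N} = (\<Union>d\<in>{1..N}. {\<tau> \<in> closed_orbits X. card \<tau> = d})"
proof (intro equalityI subsetI)
  fix \<tau> assume "\<tau> \<in> {\<tau>. \<tau> \<in> closed_orbits X \<and> card \<tau> \<le> N}"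
  then have t: "\<tau> \<in> closed_orbits X" "card \<tau> \<le> N" by auto
  then have "card \<tau> \<in> {1..N}" using card_orbit_pos[OF t(1)] by simp
  then show "\<tau> \<in> (\<Union>d\<in>{1..N}. {\<tau> \<in> closed_orbits X. card \<tau> = d})" using t by blast
qed auto

lemma finite_orbits_le: "finite {\<tau>. \<tau> \<in> closed_orbits X \<and> card \<tau> \<le> N}"
  unfolding orbits_le using finite_orbits_card by simp

lemma sum_orbits_le:
  fixes f :: "nat \<Rightarrow> real"
  shows "(\<Sum>\<tau> | \<tau> \<in> closed_orbits X \<and> card \<tau> \<le> N. f (card \<tau>)) = (\<Sum>d=1..N. real (orbit_number X d) * f d)"
proof -
  have "(\<Sum>\<tau> | \<tau> \<in> closed_orbits X \<and> card \<tau> \<le> N. f (card \<tau>))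
    = (\<Sum>d=1..N. \<Sum>\<tau> | \<tau> \<in> closed_orbits X \<and> card \<tau> = d. f (card \<tau>))"
    unfolding orbits_le by (rule sum.UNION_disjoint) (use finite_orbits_card in auto)
  also have "\<dots> = (\<Sum>d=1..N. real (orbit_number X d) * f d)"
    by (intro sum.cong refl) (simp add: orbit_number_def)
  finally show ?thesis .
qed

lemma has_sum_orbits:
  fixes f :: "nat \<Rightarrow> real"
  assumes nn: "\<And>d. d \<ge> 1 \<Longrightarrow> f d \<ge> 0"
    and hs: "((\<lambda>d. real (orbit_number X d) * f d) has_sum s) {1..}"
  shows "((\<lambda>\<tau>. f (card \<tau>)) has_sum s) (closed_orbits X)"
proof -
  let ?O = "\<lambda>d. {\<tau> \<in> closed_orbits X. card \<tau> = d}"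
  have inner: "((\<lambda>\<tau>. f (card (snd (d, \<tau>)))) has_sum (real (orbit_number X d) * f d)) (?O d)" for d
  proof (rule has_sum_finiteI[OF finite_orbits_card])
    show "real (orbit_number X d) * f d = (\<Sum>\<tau>\<in>?O d. f (card (snd (d, \<tau>))))"
      by (simp add: orbit_number_def)
  qed
  have "((\<lambda>x. f (card (snd x))) has_sum s) (Sigma {1..} ?O)"
  proof (rule has_sum_SigmaI[OF inner hs])
    show "(\<lambda>x. f (card (snd x))) summable_on Sigma {1..} ?O"
    proof (rule summable_on_SigmaI[OF inner])
      show "(\<lambda>d. real (orbit_number X d) * f d) summable_on {1..}" using hs by (rule has_sum_imp_summable)
    qed (use nn in auto)
  qed
  moreover have "bij_betw snd (Sigma {1..} ?O) (closed_orbits X)"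
  proof (rule bij_betw_imageI)
    show "inj_on snd (Sigma {1..} ?O)" by (auto simp: inj_on_def)
    show "snd ` Sigma {1..} ?O = closed_orbits X"
    proof (intro equalityI subsetI)
      fix \<tau> assume t: "\<tau> \<in> closed_orbits X"
      then have "(card \<tau>, \<tau>) \<in> Sigma {1..} ?O" using card_orbit_pos[OF t] by simp
      then show "\<tau> \<in> snd ` Sigma {1..} ?O" by force
    qed auto
  qed
  ultimately show ?thesis
    using has_sum_reindex_bij_betw[of snd "Sigma {1..} ?O" "closed_orbits X" "\<lambda>\<tau>. f (card \<tau>)" s] by simp
qed

end

section \<open>Asymptotic lemmas\<close>

text \<open>Reverse the order of summation: with \<open>k = M - m\<close> the terms become
\<open>q ^ (-k) * M / (M - k)\<close>.  They tend to \<open>q ^ (-k)\<close> and are dominated by \<open>(k + 1) * q ^ (-k)\<close>, so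
Tannery's theorem gives the limit \<open>(\<Sum>k. q ^ (-k))\<close>.\<close>

lemma exponential_sum_over_n_asymptotics:
  fixes q :: real
  assumes q: "q > 1"
  shows "(\<lambda>M. (\<Sum>m=1..M. q ^ m / real m) * real M / q ^ M) \<longlonglongrightarrow> q / (q - 1)"
proof -
  define a where "a k M = (if k < M then (1 / q) ^ k * (real M / real (M - k)) else 0)" for k M :: nat
  have eq: "(\<Sum>m=1..M. q ^ m / real m) * real M / q ^ M = (\<Sum>k. a k M)" for M
  proof -
    have "(\<Sum>k. a k M) = (\<Sum>k<M. a k M)" by (rule suminf_finite) (auto simp: a_def)
    also have "\<dots> = (\<Sum>m=1..M. q ^ m / real m * real M / q ^ M)"
    proof (rule sum.reindex_bij_witness[of _ "\<lambda>m. M - m" "\<lambda>k. M - k"])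
      fix k assume k: "k \<in> {..<M}"
      have "q ^ M = q ^ (M - k) * q ^ k" using k by (simp flip: power_add)
      then show "q ^ (M - k) / real (M - k) * real M / q ^ M = a k M"
        using k q by (simp add: a_def power_one_over field_simps)
    qed auto
    also have "\<dots> = (\<Sum>m=1..M. q ^ m / real m) * real M / q ^ M"
      by (simp add: sum_distrib_right sum_divide_distrib)
    finally show ?thesis by simp
  qed
  have lim: "((\<lambda>M. a k M) \<longlongrightarrow> (1 / q) ^ k) sequentially" for k
  proof -
    have "((\<lambda>M. (1 / q) ^ k * (real M / (real M - real k))) \<longlongrightarrow> (1 / q) ^ k * 1) sequentially"
      by (intro tendsto_mult tendsto_const) real_asymp
    moreover have "eventually (\<lambda>M. (1 / q) ^ k * (real M / (real M - real k)) = a k M) sequentially"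
      using eventually_gt_at_top[of k] by eventually_elim (simp add: a_def of_nat_diff)
    ultimately show ?thesis by (simp add: Lim_transform_eventually)
  qed
  have bound: "norm (a k M) \<le> real (Suc k) * (1 / q) ^ k" for k M
  proof (cases "k < M")
    case True
    then obtain d where d: "M = k + Suc d" by (metis less_imp_Suc_add add_Suc_right)
    have "real M / real (M - k) \<le> real (Suc k)"
    proof -
      have "real M \<le> real (Suc k) * real (Suc d)" unfolding d by (simp add: algebra_simps)
      then show ?thesis by (simp add: d pos_divide_le_eq)
    qed
    then have "(1 / q) ^ k * (real M / real (M - k)) \<le> (1 / q) ^ k * real (Suc k)"
      using q by (intro mult_left_mono) auto
    moreover have "(1 / q) ^ k * (real M / real (M - k)) \<ge> 0" using q by simp
    ultimately show ?thesis using True by (simp only: a_def if_True real_norm_def abs_of_nonneg mult.commute)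
  qed (use q in \<open>simp add: a_def\<close>)
  have sm: "summable (\<lambda>k. real (Suc k) * (1 / q) ^ k)"
  proof -
    have "norm (1 / q) < 1" using q by simp
    from geometric_deriv_sums[OF this] show ?thesis by (rule sums_summable)
  qed
  have ev: "eventually (\<lambda>(k, M). norm (a k M) \<le> real (Suc k) * (1 / q) ^ k) (at_top \<times>\<^sub>F sequentially)"
    by (rule always_eventually) (intro allI, simp only: split_paired_all prod.case bound)
  have "((\<lambda>M. suminf (\<lambda>k. a k M)) \<longlongrightarrow> suminf (\<lambda>k. (1 / q) ^ k)) sequentially"
    by (rule tannerys_theorem[THEN conjunct2, THEN conjunct2, OF lim ev sm]) simp
  moreover have "suminf (\<lambda>k. (1 / q) ^ k) = q / (q - 1)"
    using q by (subst suminf_geometric) (auto simp: field_simps)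
  ultimately show ?thesis unfolding eq by simp
qed

lemma sum_multiples:
  fixes f :: "nat \<Rightarrow> real"
  assumes p: "p > 0"
  shows "(\<Sum>n=1..N. if p dvd n then f n else 0) = (\<Sum>m=1..N div p. f (p * m))"
proof -
  have "(\<Sum>n=1..N. if p dvd n then f n else 0) = (\<Sum>n\<in>{n\<in>{1..N}. p dvd n}. f n)"
    by (rule sum.inter_filter[symmetric]) simp
  also have "\<dots> = (\<Sum>m=1..N div p. f (p * m))"
  proof (rule sum.reindex_bij_witness[of _ "\<lambda>m. p * m" "\<lambda>n. n div p"])
    fix n assume n: "n \<in> {n\<in>{1..N}. p dvd n}"
    then obtain k where k: "n = p * k" by (auto elim: dvdE)
    then have "k \<ge> 1" using n by (cases k) auto
    moreover have "k \<le> N div p" using n k p by (simp add: less_eq_div_iff_mult_less_eq mult.commute)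
    ultimately show "n div p \<in> {1..N div p}" using k p by simp
  next
    fix m assume m: "m \<in> {1..N div p}"
    then have "p * m \<le> N" using p by (simp add: less_eq_div_iff_mult_less_eq mult.commute)
    then show "p * m \<in> {n\<in>{1..N}. p dvd n}" using m p by simp
  qed (use p in auto)
  finally show ?thesis .
qed

lemma filterlim_div_at_top:
  fixes p :: nat
  assumes p_pos: "p > 0"
  shows "filterlim (\<lambda>N. N div p) at_top at_top"
  unfolding filterlim_at_top
proof
  fix Z
  show "eventually (\<lambda>N. Z \<le> N div p) at_top"
    using eventually_ge_at_top[of "Z * p"] by eventually_elim (use p_pos in \<open>simp add: less_eq_div_iff_mult_less_eq\<close>)
qed

lemma ratio_div_tendsto_1:
  fixes p :: nat
  assumes p_pos: "p > 0"
  shows "(\<lambda>N. real N / (real p * real (N div p))) \<longlonglongrightarrow> 1"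
proof (rule tendsto_sandwich)
  show "eventually (\<lambda>N. 1 \<le> real N / (real p * real (N div p))) sequentially"
    using eventually_ge_at_top[of p]
  proof eventually_elim
    case (elim N)
    have "p * (N div p) \<le> N" by simp
    then have "real p * real (N div p) \<le> real N" by (simp flip: of_nat_mult)
    moreover have "N div p > 0" using elim p_pos by (simp add: div_greater_zero_iff)
    ultimately show ?case using p_pos by (simp add: le_divide_eq)
  qed
  show "eventually (\<lambda>N. real N / (real p * real (N div p)) \<le> 1 + 1 / real (N div p)) sequentially"
    using eventually_ge_at_top[of p]
  proof eventually_elim
    case (elim N)
    have M: "N div p > 0" using elim p_pos by (simp add: div_greater_zero_iff)
    have "N = p * (N div p) + N mod p" by simp
    moreover have "N mod p \<le> p" using p_pos by (simp add: less_imp_le)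
    ultimately have "N \<le> p * (N div p) + p" by linarith
    then have "real N \<le> real p * real (N div p) + real p" by (metis of_nat_add of_nat_le_iff of_nat_mult)
    then have "real N / (real p * real (N div p)) \<le> (real p * real (N div p) + real p) / (real p * real (N div p))"
      by (intro divide_right_mono) auto
    also have "\<dots> = 1 + 1 / real (N div p)" using M p_pos by (simp add: field_simps)
    finally show ?case .
  qed
  have "(\<lambda>N. 1 / real (N div p)) \<longlonglongrightarrow> 0"
    using filterlim_compose[OF lim_const_over_n[of 1] filterlim_div_at_top[OF p_pos]] by simp
  from tendsto_add[OF tendsto_const this, of 1]
  show "(\<lambda>N. 1 + 1 / real (N div p)) \<longlonglongrightarrow> 1" by simp
qed simp

lemma ln_minus_linear_sums:
  fixes x :: real
  assumes x: "0 \<le> x" "x < 1"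
  shows "(\<lambda>n. x ^ (n + 2) / real (n + 2)) sums (ln (1 / (1 - x)) - x)"
proof -
  have "(\<lambda>n. complex_of_real x ^ Suc n / of_nat (Suc n)) sums (- Ln (1 - complex_of_real x))"
    using x by (intro sums_Ln_1_minus) simp
  moreover have "- Ln (1 - complex_of_real x) = complex_of_real (- ln (1 - x))"
  proof -
    have "1 - complex_of_real x = complex_of_real (1 - x)" by simp
    moreover have "Ln (complex_of_real (1 - x)) = complex_of_real (ln (1 - x))"
      using x by (intro Ln_of_real) simp
    ultimately show ?thesis by simp
  qed
  moreover have "complex_of_real x ^ Suc n / of_nat (Suc n) = complex_of_real (x ^ Suc n / real (Suc n))" for n
    by (simp only: of_real_divide of_real_power of_real_of_nat_eq)
  ultimately have "(\<lambda>n. complex_of_real (x ^ Suc n / real (Suc n))) sums complex_of_real (- ln (1 - x))" by (simp only:)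
  then have "(\<lambda>n. x ^ Suc n / real (Suc n)) sums (- ln (1 - x))" by (simp only: sums_of_real_iff)
  then have "(\<lambda>n. x ^ Suc (Suc n) / real (Suc (Suc n))) sums (- ln (1 - x) - x ^ Suc 0 / real (Suc 0))"
    by (subst sums_Suc_iff) simp
  moreover have "- ln (1 - x) = ln (1 / (1 - x))" using x by (simp add: ln_div)
  ultimately show ?thesis by simp
qed

section \<open>Orbit counts from fixed point counts\<close>

text \<open>All that the final asymptotics use about the shift: \<open>F n\<close> stands for the number of points fixed by
the \<open>n\<close>-th power, \<open>orb d\<close> for the number of closed orbits of size \<open>d\<close>.\<close>

locale orbit_growth =
  fixes F orb :: "nat \<Rightarrow> nat" and p :: nat and lam \<beta> C :: real
  assumes F_orbits: "n > 0 \<Longrightarrow> F n = (\<Sum>d | d dvd n. d * orb d)"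
    and p_pos: "p > 0" and lam: "lam > 1" and \<beta>: "0 < \<beta>" "\<beta> < lam"
    and F_growth: "n > 0 \<Longrightarrow> \<bar>real (F n) - (if p dvd n then real p * lam ^ n else 0)\<bar> \<le> C * \<beta> ^ n"
begin

definition growth_defect :: "nat \<Rightarrow> real" where
  "growth_defect n = (real (F n) - (if p dvd n then real p * lam ^ n else 0)) / real n"

text \<open>The part of \<open>F n / n\<close> that comes from points of smaller period.\<close>

definition imprimitive_share :: "nat \<Rightarrow> real" where
  "imprimitive_share n = (\<Sum>d\<in>{d. d dvd n} - {n}. real d * real (orb d)) / real n"

lemma orbit_decomposition:
  assumes n: "n > 0"
  shows "real (orb n) = (if p dvd n then real p * lam ^ n / real n else 0) + growth_defect n - imprimitive_share n"
proof -
  have "F n = n * orb n + (\<Sum>d\<in>{d. d dvd n} - {n}. d * orb d)"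
    unfolding F_orbits[OF n] using n by (subst sum.remove[of _ n]) auto
  then have "real (F n) = real (n * orb n + (\<Sum>d\<in>{d. d dvd n} - {n}. d * orb d))" by simp
  then have "real (F n) = real n * real (orb n) + (\<Sum>d\<in>{d. d dvd n} - {n}. real d * real (orb d))" by simp
  then show ?thesis using n by (simp add: growth_defect_def imprimitive_share_def field_simps)
qed

lemma imprimitive_share_nonneg: "imprimitive_share n \<ge> 0"
  unfolding imprimitive_share_def by (intro divide_nonneg_nonneg sum_nonneg) auto

lemma C_nonneg: "C \<ge> 0"
proof -
  have "0 \<le> C * \<beta> ^ 1" using F_growth[of 1] by linarith
  then show ?thesis using \<beta> by (simp add: zero_le_mult_iff)
qed

lemma F_le:
  assumes n: "n > 0"
  shows "real (F n) \<le> (real p + C) * lam ^ n"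
proof -
  have "real (F n) \<le> (if p dvd n then real p * lam ^ n else 0) + C * \<beta> ^ n" using F_growth[OF n] by linarith
  moreover have "(if p dvd n then real p * lam ^ n else 0) \<le> real p * lam ^ n" using lam by simp
  moreover have "C * \<beta> ^ n \<le> C * lam ^ n" using \<beta> C_nonneg by (intro mult_left_mono power_mono) auto
  ultimately show ?thesis by (simp add: algebra_simps)
qed

text \<open>A proper divisor of \<open>n\<close> is at most \<open>n / 2\<close>, which bounds each summand by a multiple of
\<open>lam ^ (n / 2)\<close>; there are at most \<open>n\<close> summands.\<close>

lemma imprimitive_share_le: "n > 0 \<Longrightarrow> imprimitive_share n \<le> (real p + C) * (sqrt lam) ^ n"
proof -
  assume n: "n > 0"
  have dd: "real d * real (orb d) \<le> (real p + C) * (sqrt lam) ^ n" if d: "d \<in> {d. d dvd n} - {n}" for d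
  proof -
    obtain k where k: "n = d * k" using d by (auto elim: dvdE)
    have "k \<noteq> 0" "k \<noteq> 1" "d > 0" using n d k by auto
    then have k2: "2 * d \<le> n" unfolding k by (cases k) auto
    have "d * orb d \<le> F d" unfolding F_orbits[OF \<open>d > 0\<close>]
      using \<open>d > 0\<close> by (intro member_le_sum) auto
    then have "real d * real (orb d) \<le> real (F d)" by (simp flip: of_nat_mult)
    also have "\<dots> \<le> (real p + C) * lam ^ d" by (rule F_le[OF \<open>d > 0\<close>])
    also have "lam ^ d = (sqrt lam) ^ (2 * d)" using lam by (simp add: power_mult)
    also have "(real p + C) * (sqrt lam) ^ (2 * d) \<le> (real p + C) * (sqrt lam) ^ n"
      using k2 lam C_nonneg by (intro mult_left_mono power_increasing) auto
    finally show ?thesis .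
  qed
  have fin: "finite {d. d dvd n}" using n by simp
  have "card ({d. d dvd n} - {n}) \<le> card {1..n}"
    by (intro card_mono) (use n in \<open>auto dest: dvd_imp_le intro: Suc_leI dvd_pos_nat\<close>)
  then have cn: "real (card ({d. d dvd n} - {n})) \<le> real n" by simp
  have "(\<Sum>d\<in>{d. d dvd n} - {n}. real d * real (orb d)) \<le> (\<Sum>d\<in>{d. d dvd n} - {n}. (real p + C) * (sqrt lam) ^ n)"
    by (intro sum_mono dd)
  also have "\<dots> = real (card ({d. d dvd n} - {n})) * ((real p + C) * (sqrt lam) ^ n)" by simp
  also have "\<dots> \<le> real n * ((real p + C) * (sqrt lam) ^ n)"
    using cn C_nonneg lam by (intro mult_right_mono) auto
  finally show "imprimitive_share n \<le> (real p + C) * (sqrt lam) ^ n"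
    unfolding imprimitive_share_def using n by (simp add: divide_le_eq mult.commute)
qed

lemma growth_defect_le: "n > 0 \<Longrightarrow> \<bar>growth_defect n\<bar> \<le> C * \<beta> ^ n"
proof -
  assume n: "n > 0"
  have "\<bar>growth_defect n\<bar> \<le> (C * \<beta> ^ n) / real n"
    unfolding growth_defect_def abs_divide abs_of_nat by (intro divide_right_mono F_growth n) simp
  also have "\<dots> \<le> (C * \<beta> ^ n) / 1" using n C_nonneg \<beta> by (intro divide_left_mono) auto
  finally show ?thesis by simp
qed

lemma sqrt_lam: "1 < sqrt lam" "sqrt lam < lam"
proof -
  show "1 < sqrt lam" using lam by simp
  then have "sqrt lam * 1 < sqrt lam * sqrt lam" by (intro mult_strict_left_mono) auto
  then show "sqrt lam < lam" using lam by simp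
qed

lemma exp_bound_summable:
  assumes "\<And>n. n > 0 \<Longrightarrow> \<bar>f n\<bar> \<le> B * \<theta> ^ n" "0 < \<theta>" "\<theta> < lam"
  shows "summable (\<lambda>n. f (Suc n) / lam ^ Suc n)"
proof (rule summable_comparison_test)
  show "\<exists>N. \<forall>n\<ge>N. norm (f (Suc n) / lam ^ Suc n) \<le> B * (\<theta> / lam) ^ Suc n"
  proof (intro exI allI impI)
    fix n
    have "norm (f (Suc n) / lam ^ Suc n) = \<bar>f (Suc n)\<bar> / lam ^ Suc n" using lam by (simp add: abs_divide power_abs)
    also have "\<dots> \<le> (B * \<theta> ^ Suc n) / lam ^ Suc n" using lam by (intro divide_right_mono assms(1)) auto
    finally show "norm (f (Suc n) / lam ^ Suc n) \<le> B * (\<theta> / lam) ^ Suc n"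
      by (simp only: power_divide times_divide_eq_right)
  qed
  have "summable (\<lambda>n. (\<theta> / lam) ^ n)" using assms lam by (intro summable_geometric) simp
  then have "summable (\<lambda>n. (\<theta> / lam) ^ Suc n)" by (subst summable_Suc_iff)
  then show "summable (\<lambda>n. B * (\<theta> / lam) ^ Suc n)" by (rule summable_mult)
qed

lemma summable_growth_defect: "summable (\<lambda>n. growth_defect (Suc n) / lam ^ Suc n)"
  by (rule exp_bound_summable[OF growth_defect_le \<beta>])

lemma summable_imprimitive_share: "summable (\<lambda>n. imprimitive_share (Suc n) / lam ^ Suc n)"
proof (rule exp_bound_summable)
  show "\<bar>imprimitive_share n\<bar> \<le> (real p + C) * (sqrt lam) ^ n" if "n > 0" for n
    using imprimitive_share_le[OF that] imprimitive_share_nonneg[of n] by simp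
qed (use sqrt_lam in auto)

text \<open>The logarithm of the limit in \<open>zeta_residue\<close>.\<close>

definition log_residue :: real where "log_residue = (\<Sum>n. growth_defect (Suc n) / lam ^ Suc n)"

text \<open>In a shift, the sum of \<open>ln (1 / (1 - x)) - x\<close> at \<open>x = lam ^ (- card \<tau>)\<close> over all closed orbits \<open>\<tau>\<close>,
here in the form in which it splits off from the partial sums; \<open>orbit_log_defect_has_sum\<close> identifies
the two.\<close>

definition log_defect :: real where "log_defect = (\<Sum>n. imprimitive_share (Suc n) / lam ^ Suc n)"

lemma partial_sums_shift:
  fixes f :: "nat \<Rightarrow> real"
  shows "(\<Sum>n=1..N. f n) = (\<Sum>n<N. f (Suc n))"
  by (rule sum.reindex_bij_witness[of _ Suc "\<lambda>n. n - 1"]) auto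

theorem weighted_orbit_sum_limit:
  "(\<lambda>N. (\<Sum>n=1..N. real (orb n) / lam ^ n) - (ln (real (N div p)) + euler_mascheroni + log_residue - log_defect)) \<longlonglongrightarrow> 0"
proof -
  have decomp: "(\<Sum>n=1..N. real (orb n) / lam ^ n)
      = harm (N div p) + (\<Sum>n<N. growth_defect (Suc n) / lam ^ Suc n) - (\<Sum>n<N. imprimitive_share (Suc n) / lam ^ Suc n)" for N
  proof -
    have "(\<Sum>n=1..N. real (orb n) / lam ^ n)
      = (\<Sum>n=1..N. (if p dvd n then real p / real n else 0) + growth_defect n / lam ^ n - imprimitive_share n / lam ^ n)"
    proof (rule sum.cong[OF refl])
      fix n assume "n \<in> {1..N}"
      then have n: "n > 0" by simp
      show "real (orb n) / lam ^ n = (if p dvd n then real p / real n else 0) + growth_defect n / lam ^ n - imprimitive_share n / lam ^ n"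
        unfolding orbit_decomposition[OF n] using n lam
        by (cases "p dvd n") (simp_all add: add_divide_distrib diff_divide_distrib)
    qed
    also have "\<dots> = (\<Sum>n=1..N. if p dvd n then real p / real n else 0) + (\<Sum>n=1..N. growth_defect n / lam ^ n) - (\<Sum>n=1..N. imprimitive_share n / lam ^ n)"
      by (simp only: sum.distrib sum_subtractf)
    also have "(\<Sum>n=1..N. if p dvd n then real p / real n else 0) = (\<Sum>m=1..N div p. real p / real (p * m))"
      by (rule sum_multiples[OF p_pos])
    also have "\<dots> = harm (N div p)"
      unfolding harm_def using p_pos by (intro sum.cong refl) (simp add: field_simps)
    finally show ?thesis unfolding partial_sums_shift .
  qed
  note div_top = filterlim_div_at_top[OF p_pos]
  have h: "(\<lambda>N. harm (N div p) - ln (real (N div p))) \<longlonglongrightarrow> (euler_mascheroni :: real)"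
    using filterlim_compose[OF euler_mascheroni_LIMSEQ div_top] by simp
  have sc: "(\<lambda>N. \<Sum>n<N. growth_defect (Suc n) / lam ^ Suc n) \<longlonglongrightarrow> log_residue"
    unfolding log_residue_def by (rule summable_LIMSEQ[OF summable_growth_defect])
  have se: "(\<lambda>N. \<Sum>n<N. imprimitive_share (Suc n) / lam ^ Suc n) \<longlonglongrightarrow> log_defect"
    unfolding log_defect_def by (rule summable_LIMSEQ[OF summable_imprimitive_share])
  have "(\<lambda>N. (harm (N div p) - ln (real (N div p))) + (\<Sum>n<N. growth_defect (Suc n) / lam ^ Suc n)
      - (\<Sum>n<N. imprimitive_share (Suc n) / lam ^ Suc n) - (euler_mascheroni + log_residue - log_defect)) \<longlonglongrightarrow> euler_mascheroni + log_residue - log_defect - (euler_mascheroni + log_residue - log_defect)"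
    by (intro tendsto_diff tendsto_add h sc se tendsto_const)
  then show ?thesis unfolding decomp by (simp add: algebra_simps)
qed

theorem orbit_count_asymptotics:
  "(\<lambda>N. \<Sum>n=1..N. real (orb n)) \<sim>[at_top] (\<lambda>N. real p * lam ^ (p * (N div p + 1)) / (real N * (lam ^ p - 1)))"
proof (rule asymp_equivI')
  define q where "q = lam ^ p"
  have q: "q > 1" unfolding q_def using lam p_pos by (simp add: one_less_power)
  define D where "D N = real p * q ^ (N div p + 1) / (real N * (q - 1))" for N
  have D_eq: "D N = real p * lam ^ (p * (N div p + 1)) / (real N * (lam ^ p - 1))" for N
    unfolding D_def q_def by (simp only: power_mult)
  define S where "S M = (\<Sum>m=1..M. q ^ m / real m)" for M
  define err where "err N = (\<Sum>n=1..N. growth_defect n - imprimitive_share n)" for N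
  \<comment> \<open>Both error terms are \<open>O(\<theta> ^ n)\<close>, and \<open>\<theta> > 1\<close> lets the last term dominate the partial sums.\<close>
  define \<theta> where "\<theta> = max \<beta> (sqrt lam)"
  have \<theta>: "1 < \<theta>" "\<theta> < lam" "\<beta> \<le> \<theta>" "sqrt lam \<le> \<theta>"
  proof -
    show le: "sqrt lam \<le> \<theta>" and "\<beta> \<le> \<theta>" by (simp_all add: \<theta>_def)
    show "1 < \<theta>" by (rule less_le_trans[OF sqrt_lam(1) le])
    show "\<theta> < lam" using sqrt_lam(2) \<beta> by (simp add: \<theta>_def)
  qed
  have decomp: "(\<Sum>n=1..N. real (orb n)) = S (N div p) + err N" for N
  proof -
    have "(\<Sum>n=1..N. real (orb n)) = (\<Sum>n=1..N. (if p dvd n then real p * lam ^ n / real n else 0) + (growth_defect n - imprimitive_share n))"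
      by (intro sum.cong refl) (simp add: orbit_decomposition)
    also have "\<dots> = (\<Sum>n=1..N. if p dvd n then real p * lam ^ n / real n else 0) + err N"
      by (simp only: sum.distrib err_def)
    also have "(\<Sum>n=1..N. if p dvd n then real p * lam ^ n / real n else 0)
      = (\<Sum>m=1..N div p. real p * lam ^ (p * m) / real (p * m))"
      by (rule sum_multiples[OF p_pos])
    also have "\<dots> = S (N div p)"
      unfolding S_def q_def using p_pos by (intro sum.cong refl) (simp add: power_mult)
    finally show ?thesis .
  qed
  note div_top = filterlim_div_at_top[OF p_pos]
  have SM: "(\<lambda>N. S (N div p) * real (N div p) / q ^ (N div p)) \<longlonglongrightarrow> q / (q - 1)"
    unfolding S_def using filterlim_compose[OF exponential_sum_over_n_asymptotics[OF q] div_top] by simp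
  note ratio = ratio_div_tendsto_1[OF p_pos]
  have main: "(\<lambda>N. S (N div p) / D N) \<longlonglongrightarrow> 1"
  proof -
    have "(\<lambda>N. (S (N div p) * real (N div p) / q ^ (N div p)) * (real N / (real p * real (N div p))) * ((q - 1) / q))
        \<longlonglongrightarrow> (q / (q - 1)) * 1 * ((q - 1) / q)"
      by (intro tendsto_mult SM ratio tendsto_const)
    moreover have "(q / (q - 1)) * 1 * ((q - 1) / q) = 1" using q by simp
    moreover have "eventually (\<lambda>N. (S (N div p) * real (N div p) / q ^ (N div p)) * (real N / (real p * real (N div p))) * ((q - 1) / q)
        = S (N div p) / D N) sequentially"
      using eventually_ge_at_top[of p]
    proof eventually_elim
      case (elim N)
      have M: "N div p > 0" using elim p_pos by (simp add: div_greater_zero_iff)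
      then show ?case using q p_pos elim by (simp add: D_def field_simps)
    qed
    ultimately show ?thesis by (simp add: Lim_transform_eventually)
  qed
  have err: "(\<lambda>N. err N / D N) \<longlonglongrightarrow> 0"
  proof (rule Lim_null_comparison)
    define K' where "K' = C + (real p + C)"
    have K': "K' \<ge> 0" using C_nonneg by (simp add: K'_def)
    have el: "\<bar>err N\<bar> \<le> real N * (K' * \<theta> ^ N)" for N
    proof -
      have "\<bar>err N\<bar> \<le> (\<Sum>n=1..N. \<bar>growth_defect n - imprimitive_share n\<bar>)" unfolding err_def by (rule sum_abs)
      also have "\<dots> \<le> (\<Sum>n=1..N. K' * \<theta> ^ N)"
      proof (rule sum_mono)
        fix n assume n: "n \<in> {1..N}"
        then have n0: "n > 0" by simp
        have "\<bar>growth_defect n - imprimitive_share n\<bar> \<le> \<bar>growth_defect n\<bar> + \<bar>imprimitive_share n\<bar>" by (rule abs_triangle_ineq4)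
        also have "\<dots> \<le> C * \<beta> ^ n + (real p + C) * (sqrt lam) ^ n"
          using growth_defect_le[OF n0] imprimitive_share_le[OF n0] imprimitive_share_nonneg[of n] by simp
        also have "\<dots> \<le> C * \<theta> ^ n + (real p + C) * \<theta> ^ n"
          using C_nonneg \<beta> \<theta> sqrt_lam by (intro add_mono mult_left_mono power_mono) auto
        also have "\<dots> = K' * \<theta> ^ n" by (simp add: K'_def algebra_simps)
        also have "\<dots> \<le> K' * \<theta> ^ N" using n \<theta> K' by (intro mult_left_mono power_increasing) auto
        finally show "\<bar>growth_defect n - imprimitive_share n\<bar> \<le> K' * \<theta> ^ N" .
      qed
      also have "\<dots> = real N * (K' * \<theta> ^ N)" by simp
      finally show ?thesis .
    qed
    have D_ge: "D N \<ge> lam ^ N / (real N * (q - 1))" if "N > 0" for N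
    proof -
      have "N \<le> p * (N div p + 1)" using p_pos
        by (metis Suc_eq_plus1 dividend_less_times_div less_imp_le mult_Suc_right add.commute)
      then have "lam ^ N \<le> lam ^ (p * (N div p + 1))" using lam by (intro power_increasing) auto
      also have "\<dots> = 1 * q ^ (N div p + 1)" by (simp only: q_def power_mult mult_1)
      also have "\<dots> \<le> real p * q ^ (N div p + 1)" using p_pos q by (intro mult_right_mono) auto
      finally show ?thesis unfolding D_def using q that by (intro divide_right_mono) auto
    qed
    show "eventually (\<lambda>N. norm (err N / D N) \<le> (K' * (q - 1)) * (real N ^ 2 * (\<theta> / lam) ^ N)) sequentially"
      using eventually_gt_at_top[of 0]
    proof eventually_elim
      case (elim N)
      have L: "lam ^ N / (real N * (q - 1)) > 0" using elim q lam by simp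
      have "norm (err N / D N) = \<bar>err N\<bar> / D N" using D_ge[OF elim] L by (simp add: abs_divide)
      also have "\<dots> \<le> (real N * (K' * \<theta> ^ N)) / D N"
        using D_ge[OF elim] L by (intro divide_right_mono el) auto
      also have "\<dots> \<le> (real N * (K' * \<theta> ^ N)) / (lam ^ N / (real N * (q - 1)))"
        using D_ge[OF elim] L K' \<theta> by (intro divide_left_mono mult_pos_pos) auto
      also have "\<dots> = (K' * (q - 1)) * (real N ^ 2 * (\<theta> / lam) ^ N)"
        by (simp add: power_divide power2_eq_square)
      finally show ?case .
    qed
    have t: "0 < \<theta> / lam" "\<theta> / lam < 1" using \<theta> lam by auto
    define x where "x = \<theta> / lam"
    have "(\<lambda>N. real N ^ 2 * x ^ N) \<longlonglongrightarrow> 0"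
      using t unfolding x_def[symmetric] by real_asymp
    from tendsto_mult_right_zero[OF this]
    show "(\<lambda>N. (K' * (q - 1)) * (real N ^ 2 * (\<theta> / lam) ^ N)) \<longlonglongrightarrow> 0"
      unfolding x_def .
  qed
  have "(\<lambda>N. S (N div p) / D N + err N / D N) \<longlonglongrightarrow> 1 + 0" by (intro tendsto_add main err)
  then show "(\<lambda>N. (\<Sum>n=1..N. real (orb n)) / (real p * lam ^ (p * (N div p + 1)) / (real N * (lam ^ p - 1)))) \<longlonglongrightarrow> 1"
    unfolding decomp D_eq[symmetric] add_divide_distrib by simp
qed

text \<open>Both sides are the sum of \<open>orb d * lam ^ (- d * k) / k\<close> over all \<open>d \<ge> 1\<close> and \<open>k \<ge> 2\<close>.  Summing
over \<open>k\<close> first gives the power series of \<open>ln (1 / (1 - x)) - x\<close> at \<open>x = lam ^ (- d)\<close>; collecting the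
pairs with \<open>d * k = n\<close> gives \<open>imprimitive_share n / lam ^ n\<close>.\<close>

theorem orbit_log_defect_has_sum:
  "((\<lambda>d. real (orb d) * (ln (1 / (1 - 1 / lam ^ d)) - 1 / lam ^ d)) has_sum log_defect) {1..}"
proof -
  define t where "t = (\<lambda>(d, k). real (orb d) * ((1 / lam ^ d) ^ k / real k))"
  define B where "B n = {(d, k). d \<ge> 1 \<and> k \<ge> 2 \<and> d * k = n}" for n :: nat
  have t0: "t x \<ge> 0" for x using lam by (auto simp: t_def split: prod.splits)
  have finB: "finite (B n)" if "n \<ge> 1" for n
    by (rule finite_subset[of _ "{1..n} \<times> {1..n}"]) (use that in \<open>auto simp: B_def\<close>)
  have tB: "(\<Sum>x\<in>B n. t x) = imprimitive_share n / lam ^ n" if n: "n \<ge> 1" for n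
  proof -
    have "imprimitive_share n / lam ^ n = (\<Sum>d\<in>{d. d dvd n} - {n}. real d * real (orb d) / real n / lam ^ n)"
      by (simp add: imprimitive_share_def sum_divide_distrib)
    also have "\<dots> = (\<Sum>x\<in>B n. t x)"
    proof (rule sum.reindex_bij_witness[of _ fst "\<lambda>d. (d, n div d)"])
      fix d assume d: "d \<in> {d. d dvd n} - {n}"
      then obtain k where k: "n = d * k" by (auto elim: dvdE)
      have dk: "d > 0" "k \<noteq> 0" "k \<noteq> 1" using d n k by auto
      then show "(d, n div d) \<in> B n" using k by (simp add: B_def)
      show "t (d, n div d) = real d * real (orb d) / real n / lam ^ n"
        using dk k lam by (simp add: t_def power_mult power_one_over field_simps)
    next
      fix x assume x: "x \<in> B n"
      then obtain d k where dk: "x = (d, k)" "d \<ge> 1" "k \<ge> 2" "n = d * k" by (auto simp: B_def)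
      then show "fst x \<in> {d. d dvd n} - {n}" by simp
      show "(fst x, n div fst x) = x" using dk by simp
    qed auto
    finally show ?thesis by simp
  qed
  have "(\<lambda>n. imprimitive_share (Suc n) / lam ^ Suc n) sums log_defect" unfolding log_defect_def by (rule summable_sums[OF summable_imprimitive_share])
  then have "((\<lambda>n. imprimitive_share (Suc n) / lam ^ Suc n) has_sum log_defect) UNIV"
    by (rule sums_nonneg_imp_has_sum) (use imprimitive_share_nonneg lam in simp)
  moreover have sucb: "bij_betw Suc UNIV {1..}"
    by (rule bij_betwI[of _ _ _ "\<lambda>n. n - 1"]) auto
  ultimately have hK: "((\<lambda>n. imprimitive_share n / lam ^ n) has_sum log_defect) {1..}"
    using has_sum_reindex_bij_betw[OF sucb, of "\<lambda>n. imprimitive_share n / lam ^ n" log_defect] by simp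
  have inner: "((\<lambda>x. t (snd (n, x))) has_sum (imprimitive_share n / lam ^ n)) (B n)" if "n \<in> {1..}" for n
    using that by (intro has_sum_finiteI finB) (simp_all add: tB)
  have hS: "((\<lambda>y. t (snd y)) has_sum log_defect) (Sigma {1..} B)"
  proof (rule has_sum_SigmaI[OF inner hK])
    show "(\<lambda>y. t (snd y)) summable_on Sigma {1..} B"
      by (rule summable_on_SigmaI[OF inner]) (use has_sum_imp_summable[OF hK] t0 in auto)
  qed
  have bij: "bij_betw snd (Sigma {1..} B) ({1..} \<times> {2..})"
  proof (rule bij_betw_imageI)
    show "inj_on snd (Sigma {1..} B)" by (auto simp: inj_on_def B_def)
    show "snd ` Sigma {1..} B = {1..} \<times> {2..}"
    proof (intro equalityI subsetI)
      fix x :: "nat \<times> nat" assume "x \<in> {1..} \<times> {2..}"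
      then obtain d k where dk: "x = (d, k)" "d \<ge> 1" "k \<ge> 2" by auto
      then have "(d * k, x) \<in> Sigma {1..} B" by (simp add: B_def)
      then have "snd (d * k, x) \<in> snd ` Sigma {1..} B" by (rule imageI)
      then show "x \<in> snd ` Sigma {1..} B" by simp
    qed (auto simp: B_def)
  qed
  have hP: "(t has_sum log_defect) ({1..} \<times> {2..})"
    using hS has_sum_reindex_bij_betw[OF bij, of t log_defect] by simp
  show ?thesis
  proof (rule has_sum_Sigma'[OF hP])
    fix d :: nat assume d: "d \<in> {1..}"
    have x: "0 \<le> 1 / lam ^ d" "1 / lam ^ d < 1" using lam d by (auto intro: one_less_power)
    have "((\<lambda>n. (1 / lam ^ d) ^ (n + 2) / real (n + 2)) has_sum (ln (1 / (1 - 1 / lam ^ d)) - 1 / lam ^ d)) UNIV"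
      by (rule sums_nonneg_imp_has_sum[OF ln_minus_linear_sums[OF x]]) (use x in simp)
    moreover have b2: "bij_betw (\<lambda>n::nat. n + 2) UNIV {2..}"
      by (rule bij_betwI[of _ _ _ "\<lambda>n. n - 2"]) auto
    ultimately have "((\<lambda>k. (1 / lam ^ d) ^ k / real k) has_sum (ln (1 / (1 - 1 / lam ^ d)) - 1 / lam ^ d)) {2..}"
      using has_sum_reindex_bij_betw[OF b2, of "\<lambda>k. (1 / lam ^ d) ^ k / real k"] by simp
    then show "((\<lambda>k. t (d, k)) has_sum real (orb d) * (ln (1 / (1 - 1 / lam ^ d)) - 1 / lam ^ d)) {2..}"
      unfolding t_def prod.case by (rule has_sum_cmult_right)
  qed
qed

theorem log_defect_pos:
  assumes d: "d > 0" "orb d > 0"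
  shows "log_defect > 0"
  unfolding log_defect_def
proof (rule suminf_pos2[OF summable_imprimitive_share])
  show "0 \<le> imprimitive_share (Suc n) / lam ^ Suc n" for n
    using imprimitive_share_nonneg[of "Suc n"] lam by simp
  \<comment> \<open>Points of period \<open>d\<close> are imprimitive among those fixed by the power \<open>2 * d\<close>.\<close>
  have "d \<in> {k. k dvd 2 * d} - {2 * d}" using d by simp
  then have "0 < (\<Sum>k\<in>{k. k dvd 2 * d} - {2 * d}. real k * real (orb k))"
    using d by (intro sum_pos2[of _ d]) auto
  then have "0 < imprimitive_share (2 * d)" unfolding imprimitive_share_def using d by simp
  then show "0 < imprimitive_share (Suc (2 * d - 1)) / lam ^ Suc (2 * d - 1)" using d lam by simp
qed

text \<open>The logarithm of the product is minus the sum of \<open>ln (1 / (1 - x)) - x\<close>, which converges to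
\<open>log_defect\<close>, and minus the weighted orbit sum; \<open>log_defect\<close> cancels.\<close>

theorem orbit_product_asymptotics:
  "(\<lambda>N. exp (- (\<Sum>n=1..N. real (orb n) * ln (1 / (1 - 1 / lam ^ n)))))
     \<sim>[at_top] (\<lambda>N. real p * exp (- euler_mascheroni) / (exp log_residue * real N))"
proof (rule asymp_equivI')
  define W where "W N = (\<Sum>n=1..N. real (orb n) / lam ^ n)" for N
  define f where "f d = real (orb d) * (ln (1 / (1 - 1 / lam ^ d)) - 1 / lam ^ d)" for d
  have "(f has_sum log_defect) {1..}" using orbit_log_defect_has_sum unfolding f_def .
  moreover have sucb: "bij_betw Suc UNIV {1..}"
    by (rule bij_betwI[of _ _ _ "\<lambda>n. n - 1"]) auto
  ultimately have "((\<lambda>n. f (Suc n)) has_sum log_defect) UNIV"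
    using has_sum_reindex_bij_betw[OF sucb, of f log_defect] by simp
  then have "(\<lambda>n. f (Suc n)) sums log_defect" by (rule has_sum_imp_sums)
  then have D: "(\<lambda>N. \<Sum>n=1..N. f n) \<longlonglongrightarrow> log_defect"
    unfolding partial_sums_shift sums_def .
  have split: "(\<Sum>n=1..N. real (orb n) * ln (1 / (1 - 1 / lam ^ n))) = (\<Sum>n=1..N. f n) + W N" for N
    unfolding W_def sum.distrib[symmetric] by (intro sum.cong refl) (simp add: f_def algebra_simps)
  have W: "(\<lambda>N. W N - (ln (real (N div p)) + euler_mascheroni + log_residue - log_defect)) \<longlonglongrightarrow> 0"
    using weighted_orbit_sum_limit unfolding W_def .
  have "(\<lambda>N. - (\<Sum>n=1..N. f n) - (W N - (ln (real (N div p)) + euler_mascheroni + log_residue - log_defect))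
      + (- euler_mascheroni - log_residue + log_defect)) \<longlonglongrightarrow> - log_defect - 0 + (- euler_mascheroni - log_residue + log_defect)"
    by (intro tendsto_add tendsto_diff tendsto_minus D W tendsto_const)
  then have "(\<lambda>N. - ((\<Sum>n=1..N. f n) + W N) + ln (real (N div p))) \<longlonglongrightarrow> - euler_mascheroni - log_residue"
    by (simp add: algebra_simps)
  then have "(\<lambda>N. exp (- ((\<Sum>n=1..N. f n) + W N) + ln (real (N div p)))) \<longlonglongrightarrow> exp (- euler_mascheroni - log_residue)"
    by (rule tendsto_exp)
  then have lim: "(\<lambda>N. exp (- ((\<Sum>n=1..N. f n) + W N) + ln (real (N div p))) * (real N / (real p * real (N div p)))
      * (exp log_residue / exp (- euler_mascheroni)))
    \<longlonglongrightarrow> exp (- euler_mascheroni - log_residue) * 1 * (exp log_residue / exp (- euler_mascheroni))"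
    by (intro tendsto_mult ratio_div_tendsto_1[OF p_pos] tendsto_const)
  have one: "exp (- euler_mascheroni - log_residue) * 1 * (exp log_residue / exp (- euler_mascheroni)) = (1::real)"
    by (simp add: exp_diff)
  have ev: "eventually (\<lambda>N. exp (- ((\<Sum>n=1..N. f n) + W N) + ln (real (N div p))) * (real N / (real p * real (N div p)))
      * (exp log_residue / exp (- euler_mascheroni))
      = exp (- ((\<Sum>n=1..N. f n) + W N)) / (real p * exp (- euler_mascheroni) / (exp log_residue * real N))) sequentially"
    using eventually_ge_at_top[of p]
  proof eventually_elim
    case (elim N)
    have M: "real (N div p) > 0" using elim p_pos by (simp add: div_greater_zero_iff)
    show ?case unfolding exp_add exp_ln[OF M] using M p_pos by simp
  qed
  show "(\<lambda>N. exp (- (\<Sum>n=1..N. real (orb n) * ln (1 / (1 - 1 / lam ^ n))))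
      / (real p * exp (- euler_mascheroni) / (exp log_residue * real N))) \<longlonglongrightarrow> 1"
    unfolding split by (rule Lim_transform_eventually[OF lim[unfolded one] ev])
qed

end

section \<open>From graphs to automata, and the theorem\<close>

definition graph_step :: "('v, 'e) pre_digraph \<Rightarrow> ('e \<Rightarrow> 'a) \<Rightarrow> 'v \<Rightarrow> 'a \<Rightarrow> 'v option" where
  "graph_step G L v a =
     (if \<exists>e\<in>arcs G. tail G e = v \<and> L e = a
      then Some (head G (SOME e. e \<in> arcs G \<and> tail G e = v \<and> L e = a)) else None)"

lemma graph_step_iff:
  assumes "right_resolving G L"
  shows "graph_step G L v a = Some u \<longleftrightarrow> (\<exists>e\<in>arcs G. tail G e = v \<and> L e = a \<and> head G e = u)"
proof (cases "\<exists>e\<in>arcs G. tail G e = v \<and> L e = a")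
  case True
  define e where "e = (SOME e. e \<in> arcs G \<and> tail G e = v \<and> L e = a)"
  have "\<exists>e. e \<in> arcs G \<and> tail G e = v \<and> L e = a" using True by blast
  then have e: "e \<in> arcs G \<and> tail G e = v \<and> L e = a" unfolding e_def by (rule someI_ex)
  have uniq: "e' = e" if "e' \<in> arcs G" "tail G e' = v" "L e' = a" for e'
    using assms e that unfolding right_resolving_def by blast
  have "graph_step G L v a = Some (head G e)" unfolding graph_step_def e_def using True by simp
  then show ?thesis using e uniq by auto
qed (auto simp: graph_step_def)

lemma graph_step_automaton:
  assumes G: "essential_digraph G" and rr: "right_resolving G L"
  shows "essential_automaton (verts G) (L ` arcs G) (graph_step G L)"
proof -
  interpret essential_digraph G by (rule G)
  show ?thesis
  proof
    show "v \<in> verts G \<and> a \<in> L ` arcs G \<and> u \<in> verts G" if "graph_step G L v a = Some u" for v a u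
      using that unfolding graph_step_iff[OF rr] by auto
    show "\<exists>a u. graph_step G L v a = Some u" if v: "v \<in> verts G" for v
      using ex_out_arc[OF v] unfolding graph_step_iff[OF rr] by blast
    show "\<exists>v a. graph_step G L v a = Some u" if u: "u \<in> verts G" for u
      using ex_in_arc[OF u] unfolding graph_step_iff[OF rr] by blast
  qed auto
qed

lemma aut_shift_graph_step:
  assumes rr: "right_resolving G L"
  shows "aut_shift (graph_step G L) = {\<lambda>k. L (e k) | e. bi_infinite_path G e}"
proof (intro equalityI subsetI)
  fix x assume "x \<in> aut_shift (graph_step G L)"
  then obtain q where "\<forall>t. graph_step G L (q t) (x t) = Some (q (t + 1))" unfolding aut_shift_def by blast
  then have "\<forall>t. \<exists>e. e \<in> arcs G \<and> tail G e = q t \<and> L e = x t \<and> head G e = q (t + 1)"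
    unfolding graph_step_iff[OF rr] by blast
  then obtain e where e: "\<forall>t. e t \<in> arcs G \<and> tail G (e t) = q t \<and> L (e t) = x t \<and> head G (e t) = q (t + 1)"
    by (rule exE[OF choice])
  then have "bi_infinite_path G e" unfolding bi_infinite_path_def by simp
  moreover have "x = (\<lambda>k. L (e k))" using e by auto
  ultimately show "x \<in> {\<lambda>k. L (e k) | e. bi_infinite_path G e}" by blast
next
  fix x assume "x \<in> {\<lambda>k. L (e k) | e. bi_infinite_path G e}"
  then obtain e where x: "x = (\<lambda>k. L (e k))" and e: "bi_infinite_path G e" by blast
  have "graph_step G L (tail G (e t)) (x t) = Some (tail G (e (t + 1)))" for t
    unfolding graph_step_iff[OF rr] using e unfolding bi_infinite_path_def x by metis
  then show "x \<in> aut_shift (graph_step G L)"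
    unfolding aut_shift_def by (intro CollectI exI[of _ "\<lambda>t. tail G (e t)"] allI)
qed

text \<open>Edges are coded as pairs of a state and a letter.\<close>

lemma automaton_nat_presentation:
  fixes W :: "'v set" and S :: "'a set"
  assumes "essential_automaton W S \<epsilon>"
  shows "\<exists>(H :: (nat, nat) pre_digraph) K. presentation H K (aut_shift \<epsilon>) \<and> right_resolving H K \<and>
    card (verts H) = card W"
proof -
  interpret E: essential_automaton W S \<epsilon> by (rule assms)
  obtain f :: "'v \<Rightarrow> nat" where f: "inj_on f W" using finite_imp_inj_to_nat_seg[OF E.finite_V] by blast
  obtain g :: "'a \<Rightarrow> nat" where g: "inj_on g S" using finite_imp_inj_to_nat_seg[OF E.finite_S] by blast
  define T where "T = {(v, a). \<epsilon> v a \<noteq> None}"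
  have T: "v \<in> W" "a \<in> S" "the (\<epsilon> v a) \<in> W" if "(v, a) \<in> T" for v a
    using that E.step unfolding T_def by auto
  have finT: "finite T"
    by (rule finite_subset[of _ "W \<times> S"]) (use T E.finite_V E.finite_S in auto)
  define h where "h = (\<lambda>(v, a). prod_encode (f v, g a))"
  define tl where "tl n = fst (prod_decode n)" for n
  define st where "st n = inv_into W f (fst (prod_decode n))" for n
  define K where "K n = inv_into S g (snd (prod_decode n))" for n
  define H where "H = \<lparr>verts = f ` W, arcs = h ` T, tail = tl, head = (\<lambda>n. f (the (\<epsilon> (st n) (K n))))\<rparr>"
  have h: "tl (h (v, a)) = f v" "st (h (v, a)) = v" "K (h (v, a)) = a" if "(v, a) \<in> T" for v a
    using T[OF that] f g by (simp_all add: h_def tl_def st_def K_def)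
  have Hs: "verts H = f ` W" "arcs H = h ` T" "tail H = tl" "head H = (\<lambda>n. f (the (\<epsilon> (st n) (K n))))"
    by (simp_all add: H_def)
  have hd: "head H (h (v, a)) = f (the (\<epsilon> v a))" if "(v, a) \<in> T" for v a
    unfolding Hs using h[OF that] by simp
  have tail: "tail H (h (v, a)) = f v" if "(v, a) \<in> T" for v a unfolding Hs by (rule h[OF that])
  have in_arcs: "h (v, a) \<in> arcs H" if "(v, a) \<in> T" for v a unfolding Hs using that by (rule imageI)
  have arcsE: "\<exists>v a. n = h (v, a) \<and> (v, a) \<in> T" if "n \<in> arcs H" for n using that unfolding Hs by auto
  have ess: "essential_digraph H"
  proof
    fix n assume "n \<in> arcs H"
    then obtain v a where n: "n = h (v, a)" "(v, a) \<in> T" using arcsE by blast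
    show "tail H n \<in> verts H" "head H n \<in> verts H"
      unfolding n(1) tail[OF n(2)] hd[OF n(2)] using T[OF n(2)] by (simp_all add: Hs)
  next
    show "finite (verts H)" "finite (arcs H)" unfolding Hs using E.finite_V finT by auto
  next
    fix n assume "n \<in> verts H"
    then obtain v where v: "n = f v" "v \<in> W" unfolding Hs by blast
    obtain u a where "\<epsilon> u a = Some v" using E.in_step[OF v(2)] by blast
    then have "(u, a) \<in> T" "the (\<epsilon> u a) = v" by (simp_all add: T_def)
    then show "\<exists>e\<in>arcs H. head H e = n"
      using in_arcs[of u a] hd[of u a] v(1) by (intro bexI[of _ "h (u, a)"]) simp_all
    obtain a u where "\<epsilon> v a = Some u" using E.out_step[OF v(2)] by blast
    then have "(v, a) \<in> T" by (simp add: T_def)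
    then show "\<exists>e\<in>arcs H. tail H e = n"
      using in_arcs[of v a] tail[of v a] v(1) by (intro bexI[of _ "h (v, a)"]) simp_all
  qed
  have "aut_shift \<epsilon> = {\<lambda>k. K (e k) | e. bi_infinite_path H e}"
  proof (intro equalityI subsetI)
    fix x assume "x \<in> aut_shift \<epsilon>"
    then obtain q where q: "\<forall>t. \<epsilon> (q t) (x t) = Some (q (t + 1))" unfolding aut_shift_def by blast
    have qT: "(q t, x t) \<in> T" "the (\<epsilon> (q t) (x t)) = q (t + 1)" for t using q by (simp_all add: T_def)
    have "bi_infinite_path H (\<lambda>t. h (q t, x t))"
      unfolding bi_infinite_path_def using in_arcs[OF qT(1)] hd[OF qT(1)] tail[OF qT(1)] qT(2) by simp
    moreover have "x = (\<lambda>t. K (h (q t, x t)))" using h(3)[OF qT(1)] by simp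
    ultimately show "x \<in> {\<lambda>k. K (e k) | e. bi_infinite_path H e}"
      by (intro CollectI exI[of _ "\<lambda>t. h (q t, x t)"] conjI)
  next
    fix x assume "x \<in> {\<lambda>k. K (e k) | e. bi_infinite_path H e}"
    then obtain e where x: "x = (\<lambda>k. K (e k))" and e: "bi_infinite_path H e" by blast
    have "\<forall>t. \<exists>va. e t = h va \<and> va \<in> T" using e unfolding bi_infinite_path_def Hs by blast
    then obtain va where va: "\<forall>t. e t = h (va t) \<and> va t \<in> T" by (rule exE[OF choice])
    define q where "q t = fst (va t)" for t
    define y where "y t = snd (va t)" for t
    have qy: "e t = h (q t, y t)" "(q t, y t) \<in> T" for t using va by (simp_all add: q_def y_def)
    have "\<epsilon> (q t) (x t) = Some (q (t + 1))" for t
    proof -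
      have xy: "x t = y t" unfolding x qy(1) by (rule h(3)[OF qy(2)])
      have "head H (e t) = tail H (e (t + 1))" using e unfolding bi_infinite_path_def by simp
      then have "f (the (\<epsilon> (q t) (y t))) = f (q (t + 1))"
        unfolding qy(1) hd[OF qy(2)] tail[OF qy(2)] .
      then have "the (\<epsilon> (q t) (y t)) = q (t + 1)"
        using f T(3)[OF qy(2)[of t]] T(1)[OF qy(2)[of "t + 1"]] by (simp add: inj_on_eq_iff)
      moreover have "\<epsilon> (q t) (y t) \<noteq> None" using qy(2)[of t] by (simp add: T_def)
      ultimately show ?thesis unfolding xy by auto
    qed
    then show "x \<in> aut_shift \<epsilon>" unfolding aut_shift_def by (intro CollectI exI[of _ q] allI)
  qed
  then have "presentation H K (aut_shift \<epsilon>)" unfolding presentation_def using ess by simp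
  moreover have "right_resolving H K"
    unfolding right_resolving_def
  proof (intro ballI impI)
    fix m n assume mn: "m \<in> arcs H" "n \<in> arcs H" and eq: "tail H m = tail H n \<and> K m = K n"
    obtain v a where m: "m = h (v, a)" "(v, a) \<in> T" using arcsE[OF mn(1)] by blast
    obtain u b where n: "n = h (u, b)" "(u, b) \<in> T" using arcsE[OF mn(2)] by blast
    have "f v = f u" "a = b"
      using eq unfolding m(1) n(1) tail[OF m(2)] tail[OF n(2)] h(3)[OF m(2)] h(3)[OF n(2)] by simp_all
    then show "m = n" using f T(1)[OF m(2)] T(1)[OF n(2)] m(1) n(1) by (simp add: inj_on_eq_iff)
  qed
  moreover have "card (verts H) = card W" unfolding Hs by (rule card_image[OF f])
  ultimately show ?thesis by blast
qed

text \<open>Carries minimality among graphs on natural numbers over to automata on the vertex type of \<open>G\<close>.\<close>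

lemma minimal_presentation_automaton:
  assumes "minimal_rr_presentation G L X"
  shows "minimal_automaton (verts G) (graph_step G L)"
  unfolding minimal_automaton_def
proof (intro allI impI)
  have G: "presentation G L X" "right_resolving G L" and min: "\<And>(H :: (nat, nat) pre_digraph) K.
      presentation H K X \<Longrightarrow> right_resolving H K \<Longrightarrow> card (verts G) \<le> card (verts H)"
    using assms unfolding minimal_rr_presentation_def by auto
  fix W S \<epsilon>
  assume W: "essential_automaton W S \<epsilon> \<and> aut_shift \<epsilon> = aut_shift (graph_step G L)"
  have X: "aut_shift \<epsilon> = X"
    using W G(1) aut_shift_graph_step[OF G(2)] unfolding presentation_def by simp
  have "\<exists>(H :: (nat, nat) pre_digraph) K. presentation H K (aut_shift \<epsilon>) \<and> right_resolving H K \<and> card (verts H) = card W"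
    by (rule automaton_nat_presentation) (use W in blast)
  then obtain H :: "(nat, nat) pre_digraph" and K where
    H: "presentation H K X" "right_resolving H K" "card (verts H) = card W" unfolding X by (elim exE conjE)
  show "card (verts G) \<le> card W" using min[OF H(1,2)] H(3) by simp
qed

lemma adj_power_pos_iff:
  assumes G: "essential_digraph G" and rr: "right_resolving G L" and u: "u \<in> verts G"
  shows "adj_power G n u v > 0 \<longleftrightarrow> automaton.reach (graph_step G L) n u v"
proof -
  interpret essential_digraph G by (rule G)
  interpret A: essential_automaton "verts G" "L ` arcs G" "graph_step G L" by (rule graph_step_automaton[OF G rr])
  have adj: "adj_matrix G w v > 0 \<longleftrightarrow> (\<exists>a. graph_step G L w a = Some v)" for w v
  proof -
    have "adj_matrix G w v > 0 \<longleftrightarrow> {e \<in> arcs G. tail G e = w \<and> head G e = v} \<noteq> {}"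
      unfolding adj_matrix_def by (simp add: card_gt_0_iff)
    also have "\<dots> \<longleftrightarrow> (\<exists>a. graph_step G L w a = Some v)"
      unfolding graph_step_iff[OF rr] by blast
    finally show ?thesis .
  qed
  show ?thesis
  proof (induction n arbitrary: v)
    case 0
    then show ?case by (auto simp: A.reach_def)
  next
    case (Suc n)
    have "adj_power G (Suc n) u v > 0 \<longleftrightarrow> (\<exists>w\<in>verts G. adj_power G n u w > 0 \<and> adj_matrix G w v > 0)"
      by (auto simp: sum_eq_0_iff simp flip: neq0_conv)
    also have "\<dots> \<longleftrightarrow> (\<exists>w\<in>verts G. A.reach n u w \<and> (\<exists>a. graph_step G L w a = Some v))"
      unfolding Suc adj ..
    also have "\<dots> \<longleftrightarrow> A.reach (Suc n) u v"
    proof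
      assume "\<exists>w\<in>verts G. A.reach n u w \<and> (\<exists>a. graph_step G L w a = Some v)"
      then obtain w a where w: "A.reach n u w" "graph_step G L w a = Some v" by blast
      have "A.reach 1 w v" unfolding A.reach_def using w(2) by (intro exI[of _ "[a]"]) simp
      from A.reach_add[OF w(1) this] show "A.reach (Suc n) u v" by simp
    next
      assume "A.reach (Suc n) u v"
      then obtain y where y: "length y = Suc n" "run (graph_step G L) u y = Some v" unfolding A.reach_def by blast
      then have "y \<noteq> []" by auto
      then have split: "y = butlast y @ [last y]" by simp
      have "Option.bind (run (graph_step G L) u (butlast y)) (\<lambda>w. run (graph_step G L) w [last y]) = Some v"
        using y(2) run_append[of "graph_step G L" u "butlast y" "[last y]"] split by simp
      then obtain w where w: "run (graph_step G L) u (butlast y) = Some w" "graph_step G L w (last y) = Some v"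
        by (auto simp: bind_eq_Some_conv)
      have "A.reach n u w" unfolding A.reach_def using w(1) y(1) by (intro exI[of _ "butlast y"]) simp
      then show "\<exists>w\<in>verts G. A.reach n u w \<and> (\<exists>a. graph_step G L w a = Some v)"
        using w(2) A.run_in_V[OF w(1) u] by blast
    qed
    finally show ?case .
  qed
qed

lemma topological_entropy_empty: "topological_entropy {} = 0"
proof -
  have "(\<lambda>n. ln (real (card (words_of_length ({} :: (int \<Rightarrow> 'a) set) n))) / real n) = (\<lambda>n. 0)"
    by (simp add: words_of_length_def)
  then show ?thesis unfolding topological_entropy_def by (simp add: limI)
qed

theorem theorem3:
  fixes X :: "(int \<Rightarrow> 'a) set"
    and G :: "('v, 'e) pre_digraph" and L :: "'e \<Rightarrow> 'a"
    and lam :: real and p :: nat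
  assumes "sofic_shift X" and "irreducible_shift X"
    and "lam > 0" and "topological_entropy X = ln lam" and "ln lam > 0"
    and "minimal_rr_presentation G L X" and "graph_period G = p"
  shows "\<exists>\<alpha> C :: real. \<alpha> > 0 \<and> C > 0 \<and>
    ((\<lambda>z::complex. (1 - of_real lam ^ p * z ^ p) * artin_mazur_zeta X z) \<longlongrightarrow> of_real \<alpha>)
      (at (of_real (inverse lam))) \<and>
    ((\<lambda>\<tau>. ln (1 / (1 - 1 / lam ^ card \<tau>)) - 1 / lam ^ card \<tau>) has_sum C) (closed_orbits X) \<and>
    orbit_count X \<sim>[at_top]
      (\<lambda>N. real p * lam ^ (p * (N div p + 1)) / (real N * (lam ^ p - 1))) \<and>
    mertens_product X \<sim>[at_top] (\<lambda>N. real p * exp (- euler_mascheroni) / (\<alpha> * real N)) \<and>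
    (\<lambda>N. mertens_sum X N - (ln (real (N div p)) + euler_mascheroni + ln \<alpha> - C)) \<in> o(\<lambda>_. 1)"
proof -
  have lam1: "lam > 1" using assms(3,5) by simp
  have G: "essential_digraph G" and rr: "right_resolving G L" and X0: "X = {\<lambda>k. L (e k) | e. bi_infinite_path G e}"
    using assms(6) unfolding minimal_rr_presentation_def presentation_def by auto
  let ?V = "verts G" and ?S = "L ` arcs G" and ?\<delta> = "graph_step G L"
  have X: "X = aut_shift ?\<delta>" using X0 aut_shift_graph_step[OF rr] by simp
  have min: "minimal_automaton ?V ?\<delta>" by (rule minimal_presentation_automaton[OF assms(6)])
  have irr: "irreducible_shift (aut_shift ?\<delta>)" using assms(2) X by simp
  interpret E: essential_automaton ?V ?S ?\<delta> by (rule graph_step_automaton[OF G rr])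
  have ne: "?V \<noteq> {}"
  proof
    assume "?V = {}"
    then have "\<not> (\<delta>' (q t) (x t) = Some s)" if "\<delta>' = ?\<delta>" for \<delta>' and q :: "int \<Rightarrow> 'v" and x s t
      using E.step that by blast
    then have "X = {}" unfolding X aut_shift_def by blast
    then show False using assms(4,5) topological_entropy_empty[where 'a = 'a] by simp
  qed
  interpret Co: connected_automaton ?V ?S ?\<delta>
    by unfold_locales (use ne E.minimal_strongly_connected[OF min irr] in auto)
  obtain \<rho> r where pr: "\<rho> > 0" "\<forall>v\<in>?V. r v > 0" "\<forall>u\<in>?V. (\<Sum>v\<in>?V. E.path_count 1 u v * r v) = \<rho> * r u"
    using Co.perron_eigenvector_exists by (elim exE conjE)
  interpret P: perron_automaton ?V ?S ?\<delta> \<rho> r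
    by unfold_locales (use pr in auto)
  have "\<exists>m s z. s \<in> ?V \<and> run ?\<delta> s m = Some z \<and> (\<forall>t\<in>?V. run ?\<delta> t m \<in> {None, Some z})"
    by (rule E.minimal_synchronizing_word[OF min ne]) blast
  then interpret Sy: synchronized_automaton ?V ?S ?\<delta> \<rho> r
    by unfold_locales
  have "ln \<rho> = ln lam" using P.topological_entropy_eq assms(4) X by simp
  then have rho: "\<rho> = lam" using pr(1) assms(3) by simp
  define b where "b = (SOME v. v \<in> ?V)"
  have b: "b \<in> ?V" unfolding b_def using ne by (simp add: some_in_eq)
  have p: "p = Co.return_period b"
    using assms(7) adj_power_pos_iff[OF G rr b] unfolding graph_period_def Co.return_period_def Let_def b_def[symmetric] by simp
  have p_pos: "p > 0" using Co.return_times_eventually[OF b] p by simp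
  obtain C \<beta> where C: "0 < \<beta>" "\<beta> < lam" "C > 0"
    "\<And>n. \<bar>real (card {w\<in>words ?S n. E.cyclic_word w}) - (if p dvd n then real p * lam ^ n else 0)\<bar> \<le> C * \<beta> ^ n"
    by (rule Sy.cyclic_word_asymptotics[OF b, folded p, unfolded rho], rule that)
  have Fc: "fixed_point_count X n = card {w\<in>words ?S n. E.cyclic_word w}" if "n > 0" for n
    unfolding X by (rule E.fixed_point_count_cyclic_words[OF that])
  have F: "\<bar>real (fixed_point_count X n) - (if p dvd n then real p * lam ^ n else 0)\<bar> \<le> C * \<beta> ^ n" if "n > 0" for n
    unfolding Fc[OF that] by (rule C(4))
  obtain P Q where PQ: "is_zeta_fraction X P Q"
  proof -
    obtain es fs :: "complex list" where
      "\<forall>n. of_nat (card {w\<in>words ?S n. E.cyclic_word w}) = (\<Sum>e\<leftarrow>es. e ^ n) - (\<Sum>f\<leftarrow>fs. f ^ n)"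
      using E.cyclic_words_power_sums by (elim exE)
    then have "\<exists>P Q. is_zeta_fraction X P Q"
      by (intro is_zeta_fraction_power_sums[of X es fs]) (simp add: Fc)
    then show thesis using that by (elim exE)
  qed
  interpret O: finite_periodic_shift X
  proof
    fix x assume "x \<in> X"
    then obtain q where "\<forall>t. ?\<delta> (q t) (x t) = Some (q (t + 1))" unfolding X aut_shift_def by blast
    then have "\<forall>t. ?\<delta> (q (t + 1)) (shift_map x t) = Some (q (t + 1 + 1))" unfolding shift_map_def by blast
    then show "shift_map x \<in> X" unfolding X aut_shift_def by (intro CollectI exI[of _ "\<lambda>t. q (t + 1)"])
  next
    fix n :: nat assume "n > 0"
    then show "finite {x \<in> X. (shift_map ^^ n) x = x}" unfolding X by (rule E.finite_fixed_points)
  qed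
  interpret Gr: orbit_growth "fixed_point_count X" "orbit_number X" p lam \<beta> C
    by unfold_locales (use O.fixed_point_count_orbits p_pos lam1 C F in auto)
  define \<alpha> where "\<alpha> = exp Gr.log_residue"
  have exp_lam: "exp (topological_entropy X * real k) = lam ^ k" for k
    using assms(3) unfolding assms(4) by (simp add: exp_of_nat_mult mult.commute)
  have zeta: "((\<lambda>z::complex. (1 - of_real lam ^ p * z ^ p) * artin_mazur_zeta X z) \<longlongrightarrow> of_real \<alpha>) (at (of_real (inverse lam)))"
    using zeta_residue(2)[OF PQ p_pos C(1,2) F] unfolding \<alpha>_def Gr.log_residue_def Gr.growth_defect_def .
  have defect: "((\<lambda>\<tau>. ln (1 / (1 - 1 / lam ^ card \<tau>)) - 1 / lam ^ card \<tau>) has_sum Gr.log_defect) (closed_orbits X)"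
  proof (rule O.has_sum_orbits[OF _ Gr.orbit_log_defect_has_sum])
    fix d :: nat assume d: "d \<ge> 1"
    have x: "0 < 1 / lam ^ d" "1 / lam ^ d < 1" using lam1 d by (auto intro: one_less_power)
    have "ln (1 - 1 / lam ^ d) \<le> - (1 / lam ^ d)" using ln_add_one_self_le_self2[of "- (1 / lam ^ d)"] x by simp
    then show "0 \<le> ln (1 / (1 - 1 / lam ^ d)) - 1 / lam ^ d" using x by (simp add: ln_div)
  qed
  have defect_pos: "Gr.log_defect > 0"
  proof -
    obtain M where M: "\<And>m. m \<ge> M \<Longrightarrow> E.reach (p * m) b b"
      using Co.return_times_eventually[OF b] p by blast
    define n where "n = p * Suc M"
    have n: "n > 0" using p_pos by (simp add: n_def)
    obtain w where w: "length w = n" "run ?\<delta> b w = Some b"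
      using M[of "Suc M"] unfolding E.reach_def n_def by auto
    have "embeds ?\<delta> {b} w" "run_image ?\<delta> {b} w = {b}" using w(2) by (simp_all add: embeds_def run_image_def)
    then have "E.cyclic_word w" unfolding E.cyclic_word_def using b by (intro exI[of _ "{b}"]) simp
    moreover have "w \<in> words ?S n" using w E.run_letters by (simp add: words_def)
    ultimately have "{w\<in>words ?S n. E.cyclic_word w} \<noteq> {}" by blast
    then have "fixed_point_count X n \<noteq> 0"
      unfolding Fc[OF n] using finite_words[OF E.finite_S, of n] by simp
    then have "(\<Sum>d | d dvd n. d * orbit_number X d) \<noteq> 0" unfolding O.fixed_point_count_orbits[OF n] .
    then obtain d where "d dvd n" "d * orbit_number X d \<noteq> 0" by (metis (mono_tags, lifting) mem_Collect_eq sum.neutral)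
    then show ?thesis by (intro Gr.log_defect_pos[of d]) auto
  qed
  have count: "orbit_count X = (\<lambda>N. \<Sum>n=1..N. real (orbit_number X n))"
    unfolding orbit_count_def by (rule ext) (use O.sum_orbits_le[of "\<lambda>_. 1"] in simp)
  have msum: "mertens_sum X N = (\<Sum>n=1..N. real (orbit_number X n) / lam ^ n)" for N
    unfolding mertens_sum_def exp_lam using O.sum_orbits_le[of "\<lambda>d. 1 / lam ^ d"] by simp
  have mprod: "mertens_product X = (\<lambda>N. exp (- (\<Sum>n=1..N. real (orbit_number X n) * ln (1 / (1 - 1 / lam ^ n)))))"
  proof
    fix N
    have "1 - 1 / lam ^ card \<tau> = exp (- ln (1 / (1 - 1 / lam ^ card \<tau>)))" if "\<tau> \<in> closed_orbits X" for \<tau>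
    proof -
      have "1 / lam ^ card \<tau> < 1" using lam1 O.card_orbit_pos[OF that] by (simp add: one_less_power)
      then have "1 - 1 / lam ^ card \<tau> > 0" by simp
      moreover have "y = exp (- ln (1 / y))" if "y > 0" for y :: real using that by (simp add: ln_div)
      ultimately show ?thesis by blast
    qed
    then have "mertens_product X N = (\<Prod>\<tau> | \<tau> \<in> closed_orbits X \<and> card \<tau> \<le> N. exp (- ln (1 / (1 - 1 / lam ^ card \<tau>))))"
      unfolding mertens_product_def exp_lam by (intro prod.cong refl) simp
    also have "\<dots> = exp (\<Sum>\<tau> | \<tau> \<in> closed_orbits X \<and> card \<tau> \<le> N. - ln (1 / (1 - 1 / lam ^ card \<tau>)))"
      by (rule exp_sum[OF O.finite_orbits_le, symmetric])
    also have "\<dots> = exp (- (\<Sum>n=1..N. real (orbit_number X n) * ln (1 / (1 - 1 / lam ^ n))))"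
      unfolding sum_negf using O.sum_orbits_le[of "\<lambda>d. ln (1 / (1 - 1 / lam ^ d))"] by simp
    finally show "mertens_product X N = exp (- (\<Sum>n=1..N. real (orbit_number X n) * ln (1 / (1 - 1 / lam ^ n))))" .
  qed
  have little: "(\<lambda>N. mertens_sum X N - (ln (real (N div p)) + euler_mascheroni + ln \<alpha> - Gr.log_defect)) \<in> o(\<lambda>_. 1)"
    by (rule smalloI_tendsto) (use Gr.weighted_orbit_sum_limit in \<open>simp_all add: msum \<alpha>_def\<close>)
  show ?thesis
    by (intro exI[of _ \<alpha>] exI[of _ Gr.log_defect] conjI zeta defect defect_pos little)
      (use Gr.orbit_count_asymptotics Gr.orbit_product_asymptotics in \<open>simp_all add: \<alpha>_def count mprod\<close>)
qed

end
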